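(* Unless $\mathrm{E}=\mathrm{NE}$, \textsc{MSO$_2$ Reconfiguration} (MSOR$_2$) on $n$-vertex uncolored graphs of neighborhood diversity $2$ cannot be solved in time $\mathcal{O}(n^{f(|\phi|)})$ for any function $f$.
   Context: $\mathrm{E}=\mathrm{DTIME}(2^{O(n)})$ and $\mathrm{NE}=\mathrm{NTIME}(2^{O(n)})$. MSO$_2$ formulas over graphs use vertex, vertex-set, edge and edge-set variables, atomic formulas $x=y$, $E(x,y)$, membership in set variables, and edge–vertex incidence $I(e,x)$, closed under Boolean connectives and quantification; $|\phi|$ is formula length. For an MSO$_2$ formula $\phi(X)$ with one free vertex-set variable and a graph $G$, a $\mathsf{TJ}(\phi)$-sequence from $S_0$ to $S_\ell$ is a sequence $S_0,\dots,S_\ell$ of vertex subsets with $|S_{i-1}\setminus S_i|=|S_i\setminus S_{i-1}|=1$ for all $i\in[\ell]$ and $G\models\phi(S_i)$ for all $i$. MSOR$_2$: given such $\phi$, a graph $G=(V,E)$ and $S,S'\subseteq V$ with $|S|=|S'|$, $G\models\phi(S)$, $G\models\phi(S')$, decide whether a $\mathsf{TJ}(\phi)$-sequence from $S$ to $S'$ exists. Two vertices $u,v$ are twins if $N(u)=N(v)$ or $N[u]=N[v]$; the neighborhood diversity of $G$ is the number of classes of the partition of $V$ into maximal sets of pairwise twin vertices. *)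

theory Defs
  imports Main
begin

section \<open>Multi-tape Turing machines, E and NE\<close>

text \<open>
  A machine has a number of two-way infinite tapes and a transition relation on states and
  tuples of scanned symbols. States and symbols are natural numbers; as the relation is finite,
  only finitely many of them matter. Symbol 0 is the blank, 1 and 2 are the input bits.
  State 0 is initial. A machine halts when no transition applies, and it accepts by halting in
  state 1.
\<close>

type_synonym transition = "(nat \<times> nat list) \<times> (nat \<times> nat list \<times> int list)"

record tm =
  num_tapes :: nat
  trans :: "transition set"

definition turing_machine :: "tm \<Rightarrow> bool" where
  "turing_machine M \<longleftrightarrow> num_tapes M \<ge> 1 \<and> finite (trans M) \<and>
     (\<forall>((q, rs), (q', ws, ds)) \<in> trans M.
        length rs = num_tapes M \<and> length ws = num_tapes M \<and> length ds = num_tapes M \<and>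
        set ds \<subseteq> {-1, 0, 1})"

definition deterministic :: "tm \<Rightarrow> bool" where
  "deterministic M \<longleftrightarrow> single_valued (trans M)"

text \<open>A configuration: state, contents of each tape, head position on each tape.\<close>

type_synonym config = "nat \<times> (nat \<Rightarrow> int \<Rightarrow> nat) \<times> (nat \<Rightarrow> int)"

inductive tm_step :: "tm \<Rightarrow> config \<Rightarrow> config \<Rightarrow> bool" for M :: tm where
  "((q, map (\<lambda>j. T j (h j)) [0..<num_tapes M]), (q', ws, ds)) \<in> trans M \<Longrightarrow>
   tm_step M (q, T, h)
     (q',
      (\<lambda>j. if j < num_tapes M then (T j)(h j := ws ! j) else T j),
      (\<lambda>j. if j < num_tapes M then h j + ds ! j else h j))"

definition bit_symbol :: "bool \<Rightarrow> nat" where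
  "bit_symbol b = (if b then 2 else 1)"

definition input_tape :: "bool list \<Rightarrow> int \<Rightarrow> nat" where
  "input_tape x i = (if 0 \<le> i \<and> i < int (length x) then bit_symbol (x ! nat i) else 0)"

definition initial_config :: "bool list \<Rightarrow> config" where
  "initial_config x = (0, (\<lambda>j. if j = 0 then input_tape x else (\<lambda>_. 0)), (\<lambda>_. 0))"

definition accepts :: "tm \<Rightarrow> bool list \<Rightarrow> bool" where
  "accepts M x \<longleftrightarrow> (\<exists>c. (tm_step M)\<^sup>*\<^sup>* (initial_config x) c \<and> (\<nexists>c'. tm_step M c c') \<and> fst c = 1)"

definition halts_within :: "tm \<Rightarrow> bool list \<Rightarrow> nat \<Rightarrow> bool" where
  "halts_within M x t \<longleftrightarrow> (\<forall>m c. (tm_step M ^^ m) (initial_config x) c \<longrightarrow> m \<le> t)"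

text \<open>The factor \<open>C\<close> is the constant of \<open>O(t(n))\<close>.\<close>

definition NTIME :: "(nat \<Rightarrow> nat) \<Rightarrow> bool list set set" where
  "NTIME t = {L. \<exists>M C. turing_machine M \<and>
     (\<forall>x. halts_within M x (C * t (length x)) \<and> (accepts M x \<longleftrightarrow> x \<in> L))}"

definition DTIME :: "(nat \<Rightarrow> nat) \<Rightarrow> bool list set set" where
  "DTIME t = {L. \<exists>M C. turing_machine M \<and> deterministic M \<and>
     (\<forall>x. halts_within M x (C * t (length x)) \<and> (accepts M x \<longleftrightarrow> x \<in> L))}"

definition class_E :: "bool list set set" where
  "class_E = (\<Union>c. DTIME (\<lambda>n. 2 ^ (c * n)))"

definition class_NE :: "bool list set set" where
  "class_NE = (\<Union>c. NTIME (\<lambda>n. 2 ^ (c * n)))"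


section \<open>Graphs and neighborhood diversity\<close>

record 'a ugraph =
  verts :: "'a set"
  edges :: "'a set set"

definition simple_graph :: "'a ugraph \<Rightarrow> bool" where
  "simple_graph G \<longleftrightarrow> finite (verts G) \<and>
     (\<forall>e \<in> edges G. \<exists>u \<in> verts G. \<exists>v \<in> verts G. u \<noteq> v \<and> e = {u, v})"

definition nbhd :: "'a ugraph \<Rightarrow> 'a \<Rightarrow> 'a set" where
  "nbhd G v = {u \<in> verts G. {u, v} \<in> edges G}"

definition closed_nbhd :: "'a ugraph \<Rightarrow> 'a \<Rightarrow> 'a set" where
  "closed_nbhd G v = insert v (nbhd G v)"

definition twins :: "'a ugraph \<Rightarrow> 'a \<Rightarrow> 'a \<Rightarrow> bool" where
  "twins G u v \<longleftrightarrow> nbhd G u = nbhd G v \<or> closed_nbhd G u = closed_nbhd G v"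

definition twin_set :: "'a ugraph \<Rightarrow> 'a set \<Rightarrow> bool" where
  "twin_set G C \<longleftrightarrow> C \<subseteq> verts G \<and> C \<noteq> {} \<and> (\<forall>u \<in> C. \<forall>v \<in> C. twins G u v)"

definition neighborhood_diversity :: "'a ugraph \<Rightarrow> nat" where
  "neighborhood_diversity G = card {C. twin_set G C \<and> (\<forall>D. twin_set G D \<and> C \<subseteq> D \<longrightarrow> D = C)}"


section \<open>MSO2 formulas\<close>

text \<open>
  There are four sorts of variables (vertex, vertex set, edge, edge set), each indexed by the
  natural numbers. Suffixes: V, VS, E, ES.
\<close>

datatype fm =
    EqV nat nat
  | EqE nat nat
  | Adj nat nat
  | InVS nat nat  \<comment> \<open>vertex variable, vertex-set variable\<close>
  | InES nat nat  \<comment> \<open>edge variable, edge-set variable\<close>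
  | Inc nat nat   \<comment> \<open>edge variable, vertex variable\<close>
  | Neg fm
  | Conj fm fm
  | Disj fm fm
  | Imp fm fm
  | Iff fm fm
  | ExV nat fm | ExVS nat fm | ExE nat fm | ExES nat fm
  | AllV nat fm | AllVS nat fm | AllE nat fm | AllES nat fm

datatype var = VVar nat | VSVar nat | EVar nat | ESVar nat

primrec fv :: "fm \<Rightarrow> var set" where
  "fv (EqV x y) = {VVar x, VVar y}"
| "fv (EqE e e') = {EVar e, EVar e'}"
| "fv (Adj x y) = {VVar x, VVar y}"
| "fv (InVS x X) = {VVar x, VSVar X}"
| "fv (InES e F) = {EVar e, ESVar F}"
| "fv (Inc e x) = {EVar e, VVar x}"
| "fv (Neg \<phi>) = fv \<phi>"
| "fv (Conj \<phi> \<psi>) = fv \<phi> \<union> fv \<psi>"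
| "fv (Disj \<phi> \<psi>) = fv \<phi> \<union> fv \<psi>"
| "fv (Imp \<phi> \<psi>) = fv \<phi> \<union> fv \<psi>"
| "fv (Iff \<phi> \<psi>) = fv \<phi> \<union> fv \<psi>"
| "fv (ExV x \<phi>) = fv \<phi> - {VVar x}"
| "fv (ExVS X \<phi>) = fv \<phi> - {VSVar X}"
| "fv (ExE e \<phi>) = fv \<phi> - {EVar e}"
| "fv (ExES F \<phi>) = fv \<phi> - {ESVar F}"
| "fv (AllV x \<phi>) = fv \<phi> - {VVar x}"
| "fv (AllVS X \<phi>) = fv \<phi> - {VSVar X}"
| "fv (AllE e \<phi>) = fv \<phi> - {EVar e}"
| "fv (AllES F \<phi>) = fv \<phi> - {ESVar F}"

primrec sat :: "'a ugraph \<Rightarrow> fm \<Rightarrow> (nat \<Rightarrow> 'a) \<Rightarrow> (nat \<Rightarrow> 'a set) \<Rightarrow>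
    (nat \<Rightarrow> 'a set) \<Rightarrow> (nat \<Rightarrow> 'a set set) \<Rightarrow> bool" where
  "sat G (EqV x y) v vs e es \<longleftrightarrow> v x = v y"
| "sat G (EqE x y) v vs e es \<longleftrightarrow> e x = e y"
| "sat G (Adj x y) v vs e es \<longleftrightarrow> {v x, v y} \<in> edges G"
| "sat G (InVS x X) v vs e es \<longleftrightarrow> v x \<in> vs X"
| "sat G (InES x F) v vs e es \<longleftrightarrow> e x \<in> es F"
| "sat G (Inc x y) v vs e es \<longleftrightarrow> v y \<in> e x"
| "sat G (Neg \<phi>) v vs e es \<longleftrightarrow> \<not> sat G \<phi> v vs e es"
| "sat G (Conj \<phi> \<psi>) v vs e es \<longleftrightarrow> sat G \<phi> v vs e es \<and> sat G \<psi> v vs e es"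
| "sat G (Disj \<phi> \<psi>) v vs e es \<longleftrightarrow> sat G \<phi> v vs e es \<or> sat G \<psi> v vs e es"
| "sat G (Imp \<phi> \<psi>) v vs e es \<longleftrightarrow> (sat G \<phi> v vs e es \<longrightarrow> sat G \<psi> v vs e es)"
| "sat G (Iff \<phi> \<psi>) v vs e es \<longleftrightarrow> (sat G \<phi> v vs e es \<longleftrightarrow> sat G \<psi> v vs e es)"
| "sat G (ExV x \<phi>) v vs e es \<longleftrightarrow> (\<exists>a \<in> verts G. sat G \<phi> (v(x := a)) vs e es)"
| "sat G (ExVS X \<phi>) v vs e es \<longleftrightarrow> (\<exists>A. A \<subseteq> verts G \<and> sat G \<phi> v (vs(X := A)) e es)"
| "sat G (ExE x \<phi>) v vs e es \<longleftrightarrow> (\<exists>a \<in> edges G. sat G \<phi> v vs (e(x := a)) es)"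
| "sat G (ExES F \<phi>) v vs e es \<longleftrightarrow> (\<exists>A. A \<subseteq> edges G \<and> sat G \<phi> v vs e (es(F := A)))"
| "sat G (AllV x \<phi>) v vs e es \<longleftrightarrow> (\<forall>a \<in> verts G. sat G \<phi> (v(x := a)) vs e es)"
| "sat G (AllVS X \<phi>) v vs e es \<longleftrightarrow> (\<forall>A. A \<subseteq> verts G \<longrightarrow> sat G \<phi> v (vs(X := A)) e es)"
| "sat G (AllE x \<phi>) v vs e es \<longleftrightarrow> (\<forall>a \<in> edges G. sat G \<phi> v vs (e(x := a)) es)"
| "sat G (AllES F \<phi>) v vs e es \<longleftrightarrow> (\<forall>A. A \<subseteq> edges G \<longrightarrow> sat G \<phi> v vs e (es(F := A)))"

text \<open>
  The free variable \<open>X\<close> of \<open>\<phi>(X)\<close> is vertex-set variable 0. The values given to the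
  other variables are irrelevant when \<open>fv \<phi> = {VSVar 0}\<close>.
\<close>

definition models :: "'a ugraph \<Rightarrow> fm \<Rightarrow> 'a set \<Rightarrow> bool" where
  "models G \<phi> S \<longleftrightarrow> sat G \<phi> (\<lambda>_. undefined) (\<lambda>_. S) (\<lambda>_. {}) (\<lambda>_. {})"


section \<open>MSO2 reconfiguration\<close>

definition TJ_sequence :: "'a ugraph \<Rightarrow> fm \<Rightarrow> nat \<Rightarrow> (nat \<Rightarrow> 'a set) \<Rightarrow> bool" where
  "TJ_sequence G \<phi> l S \<longleftrightarrow>
     (\<forall>i \<le> l. S i \<subseteq> verts G \<and> models G \<phi> (S i)) \<and>
     (\<forall>i \<in> {1..l}. card (S (i - 1) - S i) = 1 \<and> card (S i - S (i - 1)) = 1)"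

definition MSOR2_instance :: "fm \<Rightarrow> 'a ugraph \<Rightarrow> 'a set \<Rightarrow> 'a set \<Rightarrow> bool" where
  "MSOR2_instance \<phi> G S S' \<longleftrightarrow> fv \<phi> = {VSVar 0} \<and> simple_graph G \<and>
     S \<subseteq> verts G \<and> S' \<subseteq> verts G \<and> card S = card S' \<and> models G \<phi> S \<and> models G \<phi> S'"

definition MSOR2_yes :: "fm \<Rightarrow> 'a ugraph \<Rightarrow> 'a set \<Rightarrow> 'a set \<Rightarrow> bool" where
  "MSOR2_yes \<phi> G S S' \<longleftrightarrow> (\<exists>l Sq. TJ_sequence G \<phi> l Sq \<and> Sq 0 = S \<and> Sq l = S')"


section \<open>Encoding of instances\<close>

text \<open>Numbers (constructor tags and variable indices) are written in unary, self-delimiting.\<close>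

definition enc_nat :: "nat \<Rightarrow> bool list" where
  "enc_nat n = replicate n True @ [False]"

primrec enc_fm :: "fm \<Rightarrow> bool list" where
  "enc_fm (EqV x y) = enc_nat 0 @ enc_nat x @ enc_nat y"
| "enc_fm (EqE x y) = enc_nat 1 @ enc_nat x @ enc_nat y"
| "enc_fm (Adj x y) = enc_nat 2 @ enc_nat x @ enc_nat y"
| "enc_fm (InVS x y) = enc_nat 3 @ enc_nat x @ enc_nat y"
| "enc_fm (InES x y) = enc_nat 4 @ enc_nat x @ enc_nat y"
| "enc_fm (Inc x y) = enc_nat 5 @ enc_nat x @ enc_nat y"
| "enc_fm (Neg \<phi>) = enc_nat 6 @ enc_fm \<phi>"
| "enc_fm (Conj \<phi> \<psi>) = enc_nat 7 @ enc_fm \<phi> @ enc_fm \<psi>"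
| "enc_fm (Disj \<phi> \<psi>) = enc_nat 8 @ enc_fm \<phi> @ enc_fm \<psi>"
| "enc_fm (Imp \<phi> \<psi>) = enc_nat 9 @ enc_fm \<phi> @ enc_fm \<psi>"
| "enc_fm (Iff \<phi> \<psi>) = enc_nat 10 @ enc_fm \<phi> @ enc_fm \<psi>"
| "enc_fm (ExV x \<phi>) = enc_nat 11 @ enc_nat x @ enc_fm \<phi>"
| "enc_fm (ExVS x \<phi>) = enc_nat 12 @ enc_nat x @ enc_fm \<phi>"
| "enc_fm (ExE x \<phi>) = enc_nat 13 @ enc_nat x @ enc_fm \<phi>"
| "enc_fm (ExES x \<phi>) = enc_nat 14 @ enc_nat x @ enc_fm \<phi>"
| "enc_fm (AllV x \<phi>) = enc_nat 15 @ enc_nat x @ enc_fm \<phi>"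
| "enc_fm (AllVS x \<phi>) = enc_nat 16 @ enc_nat x @ enc_fm \<phi>"
| "enc_fm (AllE x \<phi>) = enc_nat 17 @ enc_nat x @ enc_fm \<phi>"
| "enc_fm (AllES x \<phi>) = enc_nat 18 @ enc_nat x @ enc_fm \<phi>"

text \<open>
  The length of a formula is that of its written form over a fixed finite alphabet. Counting a
  variable as one symbol regardless of its index would not do: the input could then not even be
  read within a bound that depends on the formula length and the graph only.
\<close>

definition fm_length :: "fm \<Rightarrow> nat" where
  "fm_length \<phi> = length (enc_fm \<phi>)"

definition enc_vset :: "nat \<Rightarrow> nat set \<Rightarrow> bool list" where
  "enc_vset n S = map (\<lambda>i. i \<in> S) [0..<n]"

text \<open>Graphs with vertex set \<open>{..<n}\<close> are given by their adjacency matrix.\<close>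

definition enc_graph :: "nat \<Rightarrow> nat ugraph \<Rightarrow> bool list" where
  "enc_graph n G = enc_nat n @ concat (map (\<lambda>i. map (\<lambda>j. {i, j} \<in> edges G) [0..<n]) [0..<n])"

definition enc_instance :: "fm \<Rightarrow> nat \<Rightarrow> nat ugraph \<Rightarrow> nat set \<Rightarrow> nat set \<Rightarrow> bool list" where
  "enc_instance \<phi> n G S S' = enc_fm \<phi> @ enc_graph n G @ enc_vset n S @ enc_vset n S'"


section \<open>Solvability within a time bound\<close>

text \<open>
  \<open>MSOR2_solvable_in_time \<G> t\<close>: some deterministic machine solves MSOR2 on the graphs in
  \<open>\<G>\<close> in time \<open>O(t n |\<phi>|)\<close> for \<open>n\<close>-vertex graphs. Nothing is required of it on other inputs.
\<close>

definition MSOR2_solvable_in_time :: "nat ugraph set \<Rightarrow> (nat \<Rightarrow> nat \<Rightarrow> nat) \<Rightarrow> bool" where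
  "MSOR2_solvable_in_time \<G> t \<longleftrightarrow>
     (\<exists>M C. turing_machine M \<and> deterministic M \<and>
       (\<forall>\<phi> n G S S'. MSOR2_instance \<phi> G S S' \<and> G \<in> \<G> \<and> verts G = {..<n} \<longrightarrow>
          halts_within M (enc_instance \<phi> n G S S') (C * t n (fm_length \<phi>)) \<and>
          (accepts M (enc_instance \<phi> n G S S') \<longleftrightarrow> MSOR2_yes \<phi> G S S')))"

end

theory Submission
  imports Defs "HOL-Library.Countable"
begin

text \<open>
  Let \<open>L\<close> be decided by a nondeterministic machine in time \<open>2^(O(n))\<close>. A word \<open>x\<close> is coded by a
  number \<open>N\<close> of size \<open>2^(O(|x|))\<close> that exceeds the running time on \<open>x\<close> and has \<open>x\<close> among its
  binary digits. Edge sets of the complete bipartite graph with sides of size \<open>N\<close> are the binary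
  relations between the sides. A half graph orders both sides, and then rows (time) and columns
  (tape cells) carry a computation tableau; a binary counter run along the rows recovers \<open>x\<close> from
  \<open>N\<close>. So a fixed MSO2 sentence \<open>\<psi>\<close> says that \<open>x \<in> L\<close>. With \<open>\<phi>(X)\<close> stating that \<open>\<psi>\<close> holds or \<open>X\<close>
  is independent, two tokens can be moved from one side to the other iff \<open>\<psi>\<close> holds. As \<open>\<phi>\<close> does not
  depend on \<open>x\<close>, a solver with running time \<open>N^(f(|\<phi>|))\<close>, run after a program that writes down the
  instance, decides \<open>L\<close> deterministically in time \<open>2^(O(n))\<close>.
\<close>


text \<open>The graphs used here carry no information besides their size, so a word has to be read
  off from a number. To tell all words of length n apart takes 2^n sizes. This is why the
  exponential classes appear: N is exponential in the length of the word, and a fixed power of N is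
  again 2^(O(n)). The digits of N - 1 are, from the lowest up, those of x, a 1, zeros, and a 1. The
  top 1 makes N exceed the running time; the 1 below it marks the end of x, which the formula could
  not locate otherwise. Counter and heads start in the same column, so digit i of the last row
  stands in the column of tape cell i and the input condition compares entries of one column. This
  origin is guessed: heads may move left, so it cannot be the first column, and it must leave room
  for all digits on its right. Solvers are Turing machines with counted steps, so the reduction must
  be one too. The programs compute in unary: numbers up to N are then tapes to loop along, and N^2
  steps are affordable because N^2 is itself 2^(O(n)).\<close>

section \<open>Existential closure over edge-set variables\<close>

lemma finite_fv: "finite (fv \<phi>)"
  by (induction \<phi>) auto

lemma sat_cong_ES:
  "(\<And>k. ESVar k \<in> fv \<phi> \<Longrightarrow> es k = es' k) \<Longrightarrow> sat G \<phi> v vs e es \<longleftrightarrow> sat G \<phi> v vs e es'"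
proof (induction \<phi> arbitrary: v vs e es es')
  case (ExES F \<phi>)
  have "sat G \<phi> v vs e (es(F := A)) \<longleftrightarrow> sat G \<phi> v vs e (es'(F := A))" for A
    by (rule ExES.IH) (use ExES.prems in auto)
  then show ?case by simp
next
  case (AllES F \<phi>)
  have "sat G \<phi> v vs e (es(F := A)) \<longleftrightarrow> sat G \<phi> v vs e (es'(F := A))" for A
    by (rule AllES.IH) (use AllES.prems in auto)
  then show ?case by simp
next
  case (Conj \<phi> \<psi>)
  have "sat G \<phi> v vs e es \<longleftrightarrow> sat G \<phi> v vs e es'" "sat G \<psi> v vs e es \<longleftrightarrow> sat G \<psi> v vs e es'"
    by (rule Conj.IH; use Conj.prems in auto)+
  then show ?case by simp
next
  case (Disj \<phi> \<psi>)
  have "sat G \<phi> v vs e es \<longleftrightarrow> sat G \<phi> v vs e es'" "sat G \<psi> v vs e es \<longleftrightarrow> sat G \<psi> v vs e es'"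
    by (rule Disj.IH; use Disj.prems in auto)+
  then show ?case by simp
next
  case (Imp \<phi> \<psi>)
  have "sat G \<phi> v vs e es \<longleftrightarrow> sat G \<phi> v vs e es'" "sat G \<psi> v vs e es \<longleftrightarrow> sat G \<psi> v vs e es'"
    by (rule Imp.IH; use Imp.prems in auto)+
  then show ?case by simp
next
  case (Iff \<phi> \<psi>)
  have "sat G \<phi> v vs e es \<longleftrightarrow> sat G \<phi> v vs e es'" "sat G \<psi> v vs e es \<longleftrightarrow> sat G \<psi> v vs e es'"
    by (rule Iff.IH; use Iff.prems in auto)+
  then show ?case by simp
next
  case (ExV x \<phi>)
  have "sat G \<phi> v vs e es \<longleftrightarrow> sat G \<phi> v vs e es'" for v
    by (rule ExV.IH) (use ExV.prems in auto)
  then show ?case by simp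
next
  case (ExVS x \<phi>)
  have "sat G \<phi> v vs e es \<longleftrightarrow> sat G \<phi> v vs e es'" for vs
    by (rule ExVS.IH) (use ExVS.prems in auto)
  then show ?case by simp
next
  case (ExE x \<phi>)
  have "sat G \<phi> v vs e es \<longleftrightarrow> sat G \<phi> v vs e es'" for e
    by (rule ExE.IH) (use ExE.prems in auto)
  then show ?case by simp
next
  case (AllV x \<phi>)
  have "sat G \<phi> v vs e es \<longleftrightarrow> sat G \<phi> v vs e es'" for v
    by (rule AllV.IH) (use AllV.prems in auto)
  then show ?case by simp
next
  case (AllVS x \<phi>)
  have "sat G \<phi> v vs e es \<longleftrightarrow> sat G \<phi> v vs e es'" for vs
    by (rule AllVS.IH) (use AllVS.prems in auto)
  then show ?case by simp
next
  case (AllE x \<phi>)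
  have "sat G \<phi> v vs e es \<longleftrightarrow> sat G \<phi> v vs e es'" for e
    by (rule AllE.IH) (use AllE.prems in auto)
  then show ?case by simp
next
  case (Neg \<phi>)
  have "sat G \<phi> v vs e es \<longleftrightarrow> sat G \<phi> v vs e es'"
    by (rule Neg.IH) (use Neg.prems in auto)
  then show ?case by simp
qed simp_all

primrec ex_edge_sets :: "nat \<Rightarrow> fm \<Rightarrow> fm" where
  "ex_edge_sets 0 \<phi> = \<phi>"
| "ex_edge_sets (Suc m) \<phi> = ex_edge_sets m (ExES m \<phi>)"

lemma fv_ex_edge_sets: "fv (ex_edge_sets m \<phi>) = fv \<phi> - ESVar ` {..<m}"
  by (induction m arbitrary: \<phi>) (auto simp: less_Suc_eq)

lemma sat_ex_edge_sets:
  "sat G (ex_edge_sets m \<phi>) v vs e es \<longleftrightarrow>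
   (\<exists>es'. (\<forall>k<m. es' k \<subseteq> edges G) \<and> (\<forall>k\<ge>m. es' k = es k) \<and> sat G \<phi> v vs e es')"
proof (induction m arbitrary: \<phi>)
  case 0
  have "(\<forall>k\<ge>0. es' k = es k) \<longleftrightarrow> es' = es" for es' by auto
  then show ?case by auto
next
  case (Suc m)
  show ?case
  proof
    assume "sat G (ex_edge_sets (Suc m) \<phi>) v vs e es"
    then obtain es' A where *: "\<forall>k<m. es' k \<subseteq> edges G" "\<forall>k\<ge>m. es' k = es k" "A \<subseteq> edges G"
      "sat G \<phi> v vs e (es'(m := A))"
      by (auto simp: Suc)
    show "\<exists>es'. (\<forall>k<Suc m. es' k \<subseteq> edges G) \<and> (\<forall>k\<ge>Suc m. es' k = es k) \<and> sat G \<phi> v vs e es'"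
      by (rule exI[of _ "es'(m := A)"]) (use * in \<open>auto simp: less_Suc_eq\<close>)
  next
    assume "\<exists>es'. (\<forall>k<Suc m. es' k \<subseteq> edges G) \<and> (\<forall>k\<ge>Suc m. es' k = es k) \<and> sat G \<phi> v vs e es'"
    then obtain es' where *: "\<forall>k<Suc m. es' k \<subseteq> edges G" "\<forall>k\<ge>Suc m. es' k = es k"
      "sat G \<phi> v vs e es'" by blast
    show "sat G (ex_edge_sets (Suc m) \<phi>) v vs e es"
      unfolding ex_edge_sets.simps Suc sat.simps
      by (rule exI[of _ "es'(m := es m)"], intro conjI exI[of _ "es' m"])
        (use * in \<open>auto simp: le_Suc_eq Suc_le_eq less_le\<close>)
  qed
qed

text \<open>Only finitely many edge-set variables occur, so a finite block of quantifiers covers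
  them. The right-hand side speaks of a whole assignment, so that relation names can be coded as
  indices without a bound fixed beforehand.\<close>

lemma edge_set_closure:
  assumes "fv \<phi> \<subseteq> range ESVar"
  obtains \<psi> where "fv \<psi> = {}"
    "\<And>(G :: 'a ugraph) v vs e es. sat G \<psi> v vs e es \<longleftrightarrow>
       (\<exists>es'. (\<forall>k. es' k \<subseteq> edges G) \<and> sat G \<phi> v vs e es')"
proof -
  have "finite {k. ESVar k \<in> fv \<phi>}"
    using finite_vimageI[OF finite_fv, of ESVar \<phi>] by (simp add: inj_def vimage_def)
  then obtain m where m: "ESVar k \<in> fv \<phi> \<Longrightarrow> k < m" for k
    by (metis (mono_tags, lifting) finite_nat_set_iff_bounded mem_Collect_eq)
  have fv: "fv (ex_edge_sets m \<phi>) = {}"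
    using assms m by (auto simp: fv_ex_edge_sets)
  have "sat G (ex_edge_sets m \<phi>) v vs e es \<longleftrightarrow>
       (\<exists>es'. (\<forall>k. es' k \<subseteq> edges G) \<and> sat G \<phi> v vs e es')" (is "?L \<longleftrightarrow> ?R")
    for G :: "'a ugraph" and v vs e es
  proof
    assume ?L
    then obtain es' where *: "\<forall>k<m. es' k \<subseteq> edges G" "sat G \<phi> v vs e es'"
      by (auto simp: sat_ex_edge_sets)
    \<comment> \<open>Indices from \<open>m\<close> on do not occur in the formula;
      \<open>{}\<close> is a legal edge set for them in every graph.\<close>
    have "sat G \<phi> v vs e (\<lambda>k. if k < m then es' k else {})"
      using *(2) by (rule iffD1[OF sat_cong_ES, rotated]) (simp add: m)
    with * show ?R by (intro exI[of _ "\<lambda>k. if k < m then es' k else {}"]) auto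
  next
    assume ?R
    then obtain es' where *: "\<forall>k. es' k \<subseteq> edges G" "sat G \<phi> v vs e es'" by blast
    have "sat G \<phi> v vs e (\<lambda>k. if k < m then es' k else es k)"
      using *(2) by (rule iffD1[OF sat_cong_ES, rotated]) (simp add: m)
    with * show ?L unfolding sat_ex_edge_sets
      by (intro exI[of _ "\<lambda>k. if k < m then es' k else es k"]) auto
  qed
  then show thesis using fv that by blast
qed


section \<open>Logic on an ordered grid\<close>

datatype 'r grid_fm =
    GRel 'r nat nat
  | GLtR nat nat
  | GLtC nat nat
  | GNeg "'r grid_fm"
  | GConj "'r grid_fm" "'r grid_fm"
  | GExR nat "'r grid_fm"
  | GExC nat "'r grid_fm"

primrec grid_sat :: "nat \<Rightarrow> ('r \<Rightarrow> nat \<Rightarrow> nat \<Rightarrow> bool) \<Rightarrow> 'r grid_fm \<Rightarrow>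
    (nat \<Rightarrow> nat) \<Rightarrow> (nat \<Rightarrow> nat) \<Rightarrow> bool" where
  "grid_sat N R (GRel k x y) a b \<longleftrightarrow> R k (a x) (b y)"
| "grid_sat N R (GLtR x y) a b \<longleftrightarrow> a x < a y"
| "grid_sat N R (GLtC x y) a b \<longleftrightarrow> b x < b y"
| "grid_sat N R (GNeg \<phi>) a b \<longleftrightarrow> \<not> grid_sat N R \<phi> a b"
| "grid_sat N R (GConj \<phi> \<psi>) a b \<longleftrightarrow> grid_sat N R \<phi> a b \<and> grid_sat N R \<psi> a b"
| "grid_sat N R (GExR x \<phi>) a b \<longleftrightarrow> (\<exists>i<N. grid_sat N R \<phi> (a(x := i)) b)"
| "grid_sat N R (GExC y \<phi>) a b \<longleftrightarrow> (\<exists>i<N. grid_sat N R \<phi> a (b(y := i)))"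

text \<open>Vertex variable 0 holds a vertex whose side of the bipartite graph plays the rows; row
  variables become the even and column variables the odd vertex variables. Edge-set variable 0
  holds a half graph: rows are ordered by inclusion of their neighbourhoods in it, and so are
  columns.\<close>

definition row_var :: "nat \<Rightarrow> nat" where "row_var x = 2 * x + 2"
definition col_var :: "nat \<Rightarrow> nat" where "col_var y = 2 * y + 1"

lemma row_col_var_simps [simp]:
  "row_var x = row_var x' \<longleftrightarrow> x = x'" "col_var x = col_var x' \<longleftrightarrow> x = x'"
  "row_var x \<noteq> col_var y" "col_var y \<noteq> row_var x" "row_var x \<noteq> 0" "col_var x \<noteq> 0"
  "0 \<noteq> row_var x" "0 \<noteq> col_var x"
  by (auto simp: row_var_def col_var_def) presburger+

definition edge_in :: "nat \<Rightarrow> nat \<Rightarrow> nat \<Rightarrow> fm" where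
  "edge_in k x y = ExE 0 (Conj (InES 0 k) (Conj (Inc 0 x) (Inc 0 y)))"

definition ex_row :: "nat \<Rightarrow> fm \<Rightarrow> fm" where
  "ex_row x \<phi> = ExV (row_var x) (Conj (Neg (Adj (row_var x) 0)) \<phi>)"

definition ex_col :: "nat \<Rightarrow> fm \<Rightarrow> fm" where
  "ex_col y \<phi> = ExV (col_var y) (Conj (Adj (col_var y) 0) \<phi>)"

text \<open>A vertex precedes another one if a neighbourhood inclusion in the half graph fails; for
  nested, distinct neighbourhoods this is a strict order. The bound variable 0 is of the other sort
  than the arguments, so nothing is captured.\<close>

definition less_row :: "nat \<Rightarrow> nat \<Rightarrow> fm" where
  "less_row x x' = ex_col 0 (Conj (edge_in 0 (row_var x) (col_var 0))
     (Neg (edge_in 0 (row_var x') (col_var 0))))"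

definition less_col :: "nat \<Rightarrow> nat \<Rightarrow> fm" where
  "less_col y y' = ex_row 0 (Conj (edge_in 0 (row_var 0) (col_var y'))
     (Neg (edge_in 0 (row_var 0) (col_var y))))"

text \<open>The \<open>Suc\<close> reserves edge-set variable 0 for the half graph.\<close>

primrec grid_to_mso :: "'r::countable grid_fm \<Rightarrow> fm" where
  "grid_to_mso (GRel k x y) = edge_in (Suc (to_nat k)) (row_var x) (col_var y)"
| "grid_to_mso (GLtR x y) = less_row x y"
| "grid_to_mso (GLtC x y) = less_col x y"
| "grid_to_mso (GNeg \<phi>) = Neg (grid_to_mso \<phi>)"
| "grid_to_mso (GConj \<phi> \<psi>) = Conj (grid_to_mso \<phi>) (grid_to_mso \<psi>)"
| "grid_to_mso (GExR x \<phi>) = ex_row x (grid_to_mso \<phi>)"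
| "grid_to_mso (GExC y \<phi>) = ex_col y (grid_to_mso \<phi>)"

primrec grid_fv :: "'r grid_fm \<Rightarrow> nat set" where
  "grid_fv (GRel k x y) = {row_var x, col_var y}"
| "grid_fv (GLtR x y) = {row_var x, row_var y}"
| "grid_fv (GLtC x y) = {col_var x, col_var y}"
| "grid_fv (GNeg \<phi>) = grid_fv \<phi>"
| "grid_fv (GConj \<phi> \<psi>) = grid_fv \<phi> \<union> grid_fv \<psi>"
| "grid_fv (GExR x \<phi>) = grid_fv \<phi> - {row_var x}"
| "grid_fv (GExC y \<phi>) = grid_fv \<phi> - {col_var y}"

lemma fv_grid_to_mso: "fv (grid_to_mso \<phi>) \<subseteq> VVar ` (insert 0 (grid_fv \<phi>)) \<union> range ESVar"
  by (induction \<phi>)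
    (auto simp: edge_in_def less_row_def less_col_def ex_row_def ex_col_def)

text \<open>Exactly one of the two inclusions between neighbourhoods fails iff they are nested and
  different. So the formula says that on either side the neighbourhoods form a chain without
  repetition.\<close>

definition linear_orders :: fm where
  "linear_orders = Conj
     (Neg (ex_row 1 (ex_row 2 (Neg (Iff (Neg (EqV (row_var 1) (row_var 2)))
        (Iff (less_row 1 2) (Neg (less_row 2 1))))))))
     (Neg (ex_col 1 (ex_col 2 (Neg (Iff (Neg (EqV (col_var 1) (col_var 2)))
        (Iff (less_col 1 2) (Neg (less_col 2 1))))))))"

text \<open>The number of predecessors is strictly monotone, hence a bijection onto the indices; its
  inverse is the enumeration.\<close>

lemma finite_linear_order_enum:
  assumes "finite A" "card A = N"
    and irrefl: "\<And>x. x \<in> A \<Longrightarrow> \<not> r x x"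
    and trans: "\<And>x y z. x \<in> A \<Longrightarrow> y \<in> A \<Longrightarrow> z \<in> A \<Longrightarrow> r x y \<Longrightarrow> r y z \<Longrightarrow> r x z"
    and total: "\<And>x y. x \<in> A \<Longrightarrow> y \<in> A \<Longrightarrow> x \<noteq> y \<Longrightarrow> r x y \<or> r y x"
  obtains f where "bij_betw f {..<N} A" "\<And>i j. i < N \<Longrightarrow> j < N \<Longrightarrow> r (f i) (f j) \<longleftrightarrow> i < j"
proof -
  define rank where "rank x = card {y \<in> A. r y x}" for x
  have mono: "rank x < rank y" if "x \<in> A" "y \<in> A" "r x y" for x y
    unfolding rank_def
  proof (rule psubset_card_mono)
    have "{z \<in> A. r z x} \<subseteq> {z \<in> A. r z y}" using trans that by blast
    moreover have "x \<in> {z \<in> A. r z y}" "x \<notin> {z \<in> A. r z x}" using irrefl that by auto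
    ultimately show "{z \<in> A. r z x} \<subset> {z \<in> A. r z y}" by blast
  qed (use assms(1) in simp)
  have lt: "rank x < N" if "x \<in> A" for x
    unfolding rank_def assms(2)[symmetric]
    by (rule psubset_card_mono) (use assms(1) that irrefl in auto)
  have inj: "inj_on rank A"
    by (rule inj_onI) (metis mono total less_irrefl)
  have bij: "bij_betw rank A {..<N}"
    unfolding bij_betw_def
  proof (intro conjI inj card_subset_eq)
    show "card (rank ` A) = card {..<N}" using inj assms by (simp add: card_image)
  qed (use lt in auto)
  define f where "f = inv_into A rank"
  have f: "bij_betw f {..<N} A" unfolding f_def by (rule bij_betw_inv_into[OF bij])
  have rank_f: "rank (f i) = i" "f i \<in> A" if "i < N" for i
    using bij that unfolding f_def by (auto simp: bij_betw_def f_inv_into_f inv_into_into)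
  have "r (f i) (f j) \<longleftrightarrow> i < j" if "i < N" "j < N" for i j
    using mono[of "f i" "f j"] mono[of "f j" "f i"] total[of "f i" "f j"] rank_f that irrefl
    by (metis less_asym')
  then show thesis using that f by blast
qed

section \<open>Grid formulas on an enumerated complete bipartite graph\<close>

locale grid_enum =
  fixes G :: "'a ugraph" and N :: nat and \<alpha> \<beta> :: "nat \<Rightarrow> 'a"
  assumes inj_\<alpha>: "inj_on \<alpha> {..<N}" and inj_\<beta>: "inj_on \<beta> {..<N}"
    and disj: "\<alpha> ` {..<N} \<inter> \<beta> ` {..<N} = {}"
    and verts: "verts G = \<alpha> ` {..<N} \<union> \<beta> ` {..<N}"
    and edges: "edges G = {{\<alpha> i, \<beta> j} |i j. i < N \<and> j < N}"
begin

lemma neq: "i < N \<Longrightarrow> j < N \<Longrightarrow> \<alpha> i \<noteq> \<beta> j"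
  using disj by blast

lemma edge_eq: "i < N \<Longrightarrow> j < N \<Longrightarrow> i' < N \<Longrightarrow> j' < N \<Longrightarrow>
    {\<alpha> i, \<beta> j} = {\<alpha> i', \<beta> j'} \<longleftrightarrow> i = i' \<and> j = j'"
  using neq inj_\<alpha> inj_\<beta> by (auto simp: doubleton_eq_iff inj_on_def)

lemma adj [simp]:
  assumes "i < N" "j < N"
  shows "{\<alpha> i, \<beta> j} \<in> edges G" "{\<beta> j, \<alpha> i} \<in> edges G"
    "{\<alpha> i, \<alpha> j} \<notin> edges G" "{\<beta> i, \<beta> j} \<notin> edges G"
  using assms neq unfolding edges by (auto simp: doubleton_eq_iff insert_commute) metis+

lemma sat_ex_row:
  assumes "v 0 = \<alpha> i" "i < N"
  shows "sat G (ex_row x \<phi>) v vs e es \<longleftrightarrow> (\<exists>j<N. sat G \<phi> (v(row_var x := \<alpha> j)) vs e es)"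
  using assms unfolding ex_row_def by (auto simp: verts bex_Un)

lemma sat_ex_col:
  assumes "v 0 = \<alpha> i" "i < N"
  shows "sat G (ex_col x \<phi>) v vs e es \<longleftrightarrow> (\<exists>j<N. sat G \<phi> (v(col_var x := \<beta> j)) vs e es)"
  using assms unfolding ex_col_def by (auto simp: verts bex_Un)

text \<open>An edge that contains a given row and a given column is the pair of both, so the
  quantified edge is determined.\<close>

lemma sat_edge_in:
  assumes "v x = \<alpha> i" "v y = \<beta> j" "i < N" "j < N" "es k \<subseteq> edges G"
  shows "sat G (edge_in k x y) v vs e es \<longleftrightarrow> {\<alpha> i, \<beta> j} \<in> es k"
proof -
  have "u = {\<alpha> i, \<beta> j}" if u: "u \<in> edges G" "\<alpha> i \<in> u" "\<beta> j \<in> u" for u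
  proof -
    obtain i' j' where "u = {\<alpha> i', \<beta> j'}" "i' < N" "j' < N" using u(1) edges by auto
    with u neq assms(3,4) show ?thesis by auto metis
  qed
  then show ?thesis using assms by (auto simp: edge_in_def)
qed

definition lt_row :: "'a set set \<Rightarrow> 'a \<Rightarrow> 'a \<Rightarrow> bool" where
  "lt_row H x x' \<longleftrightarrow> (\<exists>j<N. {x, \<beta> j} \<in> H \<and> {x', \<beta> j} \<notin> H)"

definition lt_col :: "'a set set \<Rightarrow> 'a \<Rightarrow> 'a \<Rightarrow> bool" where
  "lt_col H y y' \<longleftrightarrow> (\<exists>i<N. {\<alpha> i, y'} \<in> H \<and> {\<alpha> i, y} \<notin> H)"

lemma sat_less_row:
  assumes "v 0 = \<alpha> i0" "i0 < N" "v (row_var x) = \<alpha> i" "v (row_var x') = \<alpha> i'" "i < N" "i' < N"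
    "es 0 \<subseteq> edges G"
  shows "sat G (less_row x x') v vs e es \<longleftrightarrow> lt_row (es 0) (\<alpha> i) (\<alpha> i')"
  unfolding less_row_def sat_ex_col[where v = v, OF assms(1,2)] lt_row_def sat.simps
  by (intro ex_cong1 conj_cong refl arg_cong[where f = Not] sat_edge_in) (use assms in auto)

lemma sat_less_col:
  assumes "v 0 = \<alpha> i0" "i0 < N" "v (col_var x) = \<beta> i" "v (col_var x') = \<beta> i'" "i < N" "i' < N"
    "es 0 \<subseteq> edges G"
  shows "sat G (less_col x x') v vs e es \<longleftrightarrow> lt_col (es 0) (\<beta> i) (\<beta> i')"
  unfolding less_col_def sat_ex_row[where v = v, OF assms(1,2)] lt_col_def sat.simps
  by (intro ex_cong1 conj_cong refl arg_cong[where f = Not] sat_edge_in) (use assms in auto)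

lemma sat_linear_orders:
  assumes "v 0 = \<alpha> i0" "i0 < N" "es 0 \<subseteq> edges G"
  shows "sat G linear_orders v vs e es \<longleftrightarrow>
    (\<forall>i<N. \<forall>j<N. i \<noteq> j \<longleftrightarrow> (lt_row (es 0) (\<alpha> i) (\<alpha> j) \<longleftrightarrow> \<not> lt_row (es 0) (\<alpha> j) (\<alpha> i))) \<and>
    (\<forall>i<N. \<forall>j<N. i \<noteq> j \<longleftrightarrow> (lt_col (es 0) (\<beta> i) (\<beta> j) \<longleftrightarrow> \<not> lt_col (es 0) (\<beta> j) (\<beta> i)))"
proof -
  have eqs: "\<alpha> i = \<alpha> j \<longleftrightarrow> i = j" "\<beta> i = \<beta> j \<longleftrightarrow> i = j" if "i < N" "j < N" for i j
    using inj_\<alpha> inj_\<beta> that by (auto simp: inj_on_def)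
  show ?thesis
    unfolding linear_orders_def
    using assms
    by (simp add: sat_ex_row[of _ i0] sat_ex_col[of _ i0] eqs
        sat_less_row[where ?i0.0 = i0] sat_less_col[where ?i0.0 = i0] cong: conj_cong)
qed

text \<open>Agreement of the assignments is asked for free variables only: the others receive their
  values from quantifiers, and \<open>v\<close> may be arbitrary on them.\<close>

lemma sat_grid_to_mso:
  fixes \<phi> :: "'r::countable grid_fm"
  assumes "v 0 = \<alpha> i0" "i0 < N" and es: "\<And>k. es k \<subseteq> edges G"
    and R: "\<And>k i j. i < N \<Longrightarrow> j < N \<Longrightarrow> R k i j \<longleftrightarrow> {\<alpha> i, \<beta> j} \<in> es (Suc (to_nat k))"
    and row: "\<And>i j. i < N \<Longrightarrow> j < N \<Longrightarrow> lt_row (es 0) (\<alpha> i) (\<alpha> j) \<longleftrightarrow> i < j"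
    and col: "\<And>i j. i < N \<Longrightarrow> j < N \<Longrightarrow> lt_col (es 0) (\<beta> i) (\<beta> j) \<longleftrightarrow> i < j"
    and "\<And>x. row_var x \<in> grid_fv \<phi> \<Longrightarrow> a x < N \<and> v (row_var x) = \<alpha> (a x)"
    and "\<And>y. col_var y \<in> grid_fv \<phi> \<Longrightarrow> b y < N \<and> v (col_var y) = \<beta> (b y)"
  shows "sat G (grid_to_mso \<phi>) v vs e es \<longleftrightarrow> grid_sat N R \<phi> a b"
  using assms(1,7,8)
proof (induction \<phi> arbitrary: v a b)
  case (GRel k x y)
  then show ?case
    using sat_edge_in[of v "row_var x" "a x" "col_var y" "b y" es "Suc (to_nat k)"] es R by simp
next
  case (GLtR x y)
  then show ?case
    using sat_less_row[of v i0 x "a x" y "a y" es] es row assms(2) by simp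
next
  case (GLtC x y)
  then show ?case
    using sat_less_col[of v i0 x "b x" y "b y" es] es col assms(2) by simp
next
  case (GExR x \<phi>)
  have "sat G (grid_to_mso \<phi>) (v(row_var x := \<alpha> j)) vs e es \<longleftrightarrow> grid_sat N R \<phi> (a(x := j)) b"
    if "j < N" for j
    by (rule GExR.IH) (use GExR.prems that in auto)
  then show ?case by (auto simp: sat_ex_row[of v i0, OF GExR.prems(1) assms(2)])
next
  case (GExC x \<phi>)
  have "sat G (grid_to_mso \<phi>) (v(col_var x := \<beta> j)) vs e es \<longleftrightarrow> grid_sat N R \<phi> a (b(x := j))"
    if "j < N" for j
    by (rule GExC.IH) (use GExC.prems that in auto)
  then show ?case by (auto simp: sat_ex_col[of v i0, OF GExC.prems(1) assms(2)])
next
  case (GConj \<phi> \<psi>)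
  have "sat G (grid_to_mso \<phi>) v vs e es \<longleftrightarrow> grid_sat N R \<phi> a b"
    by (rule GConj.IH(1)) (use GConj.prems in auto)
  moreover have "sat G (grid_to_mso \<psi>) v vs e es \<longleftrightarrow> grid_sat N R \<psi> a b"
    by (rule GConj.IH(2)) (use GConj.prems in auto)
  ultimately show ?case by simp
next
  case (GNeg \<phi>)
  have "sat G (grid_to_mso \<phi>) v vs e es \<longleftrightarrow> grid_sat N R \<phi> a b"
    by (rule GNeg.IH) (use GNeg.prems in auto)
  then show ?case by simp
qed

end

text \<open>The vertex guessed for variable 0 may lie on either side; this lets the sides exchange
  roles.\<close>

lemma grid_enum_commute:
  assumes "grid_enum G N \<alpha> \<beta>" shows "grid_enum G N \<beta> \<alpha>"
proof -
  interpret grid_enum G N \<alpha> \<beta> by fact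
  show ?thesis
    by unfold_locales (use inj_\<alpha> inj_\<beta> disj verts edges in \<open>auto simp: insert_commute\<close>)
qed

text \<open>A guessed order need not agree with the given numbering; renumbering both sides along it
  turns it into the order of the indices.\<close>

lemma grid_enum_permute:
  assumes "grid_enum G N \<alpha> \<beta>" "bij_betw \<alpha>' {..<N} (\<alpha> ` {..<N})" "bij_betw \<beta>' {..<N} (\<beta> ` {..<N})"
  shows "grid_enum G N \<alpha>' \<beta>'"
proof -
  interpret grid_enum G N \<alpha> \<beta> by fact
  have im: "\<alpha>' ` {..<N} = \<alpha> ` {..<N}" "\<beta>' ` {..<N} = \<beta> ` {..<N}"
    using assms(2,3) by (auto simp: bij_betw_def)
  have "edges G = (\<lambda>(x, y). {x, y}) ` ((\<alpha> ` {..<N}) \<times> (\<beta> ` {..<N}))"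
    unfolding edges by (auto simp: image_iff)
  also have "\<dots> = {{\<alpha>' i, \<beta>' j} |i j. i < N \<and> j < N}"
    unfolding im[symmetric] by (auto simp: image_iff)
  finally show ?thesis
    using assms(2,3) disj verts by unfold_locales (auto simp: im bij_betw_def)
qed

text \<open>\<open>\<psi>\<close> guesses the relations, an order and the side of the rows at once.
  The right-hand side mentions neither order nor side, since every guess that passes
  \<open>linear_orders\<close> yields the numbered grid up to renaming.\<close>

theorem grid_sentence_in_mso:
  fixes \<phi> :: "'r::countable grid_fm"
  assumes "grid_fv \<phi> = {}"
  obtains \<psi> where "fv \<psi> = {}"
    "\<And>(G :: 'a ugraph) N \<alpha> \<beta> v vs e es. grid_enum G N \<alpha> \<beta> \<Longrightarrow> N > 0 \<Longrightarrow>
       sat G \<psi> v vs e es \<longleftrightarrow> (\<exists>R. grid_sat N R \<phi> (\<lambda>_. 0) (\<lambda>_. 0))"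
proof -
  define \<psi>0 where "\<psi>0 = ExV 0 (Conj linear_orders (grid_to_mso \<phi>))"
  have "fv \<psi>0 \<subseteq> range ESVar"
    using fv_grid_to_mso[of \<phi>] assms
    by (auto simp: \<psi>0_def linear_orders_def edge_in_def less_row_def less_col_def ex_row_def ex_col_def)
  then obtain \<psi> where \<psi>: "fv \<psi> = {}"
    "\<And>(G :: 'a ugraph) v vs e es. sat G \<psi> v vs e es \<longleftrightarrow>
       (\<exists>es'. (\<forall>k. es' k \<subseteq> edges G) \<and> sat G \<psi>0 v vs e es')"
    by (rule edge_set_closure) blast
  have "sat G \<psi> v vs e es \<longleftrightarrow> (\<exists>R. grid_sat N R \<phi> (\<lambda>_. 0) (\<lambda>_. 0))" (is "?L \<longleftrightarrow> ?R")
    if GE: "grid_enum G N \<alpha> \<beta>" and N: "N > 0" for G :: "'a ugraph" and N \<alpha> \<beta> v vs e es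
  proof
    assume ?L
    then obtain es' a0 where es': "\<And>k. es' k \<subseteq> edges G" and a0: "a0 \<in> verts G"
      and sat: "sat G linear_orders (v(0 := a0)) vs e es'"
        "sat G (grid_to_mso \<phi>) (v(0 := a0)) vs e es'"
      unfolding \<psi>(2) \<psi>0_def by auto
    have "\<exists>\<alpha> \<beta>. grid_enum G N \<alpha> \<beta> \<and> a0 \<in> \<alpha> ` {..<N}"
      using GE grid_enum_commute[OF GE] a0 grid_enum.verts[OF GE] by blast
    then obtain \<alpha> \<beta> i0 where GE': "grid_enum G N \<alpha> \<beta>" and i0: "i0 < N" "a0 = \<alpha> i0" by blast
    interpret grid_enum G N \<alpha> \<beta> by (rule GE')
    have lin:
      "\<And>i j. i < N \<Longrightarrow> j < N \<Longrightarrow>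
        i \<noteq> j \<longleftrightarrow> (lt_row (es' 0) (\<alpha> i) (\<alpha> j) \<longleftrightarrow> \<not> lt_row (es' 0) (\<alpha> j) (\<alpha> i))"
      "\<And>i j. i < N \<Longrightarrow> j < N \<Longrightarrow>
        i \<noteq> j \<longleftrightarrow> (lt_col (es' 0) (\<beta> i) (\<beta> j) \<longleftrightarrow> \<not> lt_col (es' 0) (\<beta> j) (\<beta> i))"
      using sat(1) sat_linear_orders[of "v(0 := a0)" i0 es' vs e] i0 es' by (simp_all only: fun_upd_same) blast+
    obtain \<alpha>' where \<alpha>': "bij_betw \<alpha>' {..<N} (\<alpha> ` {..<N})"
      "\<And>i j. i < N \<Longrightarrow> j < N \<Longrightarrow> lt_row (es' 0) (\<alpha>' i) (\<alpha>' j) \<longleftrightarrow> i < j"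
    proof (rule finite_linear_order_enum[of "\<alpha> ` {..<N}" N "lt_row (es' 0)"])
      show "card (\<alpha> ` {..<N}) = N" using inj_\<alpha> by (simp add: card_image)
      show "\<not> lt_row (es' 0) x x" for x by (auto simp: lt_row_def)
      show "lt_row (es' 0) x z" if "x \<in> \<alpha> ` {..<N}" "y \<in> \<alpha> ` {..<N}" "z \<in> \<alpha> ` {..<N}"
        "lt_row (es' 0) x y" "lt_row (es' 0) y z" for x y z
      proof -
        from that obtain i j where ij: "x = \<alpha> i" "y = \<alpha> j" "i < N" "j < N" by blast
        \<comment> \<open>As \<open>x\<close> precedes \<open>y\<close>, the neighbourhood of
          \<open>y\<close> is contained in that of \<open>x\<close>; a column that separates
          \<open>y\<close> from \<open>z\<close> then separates \<open>x\<close> from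
          \<open>z\<close> as well.\<close>
        have "\<not> lt_row (es' 0) x x" by (simp add: lt_row_def)
        then have "\<not> lt_row (es' 0) y x" using lin(1)[OF ij(3,4)] that(4) ij by metis
        then show ?thesis using that(5) unfolding lt_row_def by blast
      qed
      show "lt_row (es' 0) x y \<or> lt_row (es' 0) y x" if "x \<in> \<alpha> ` {..<N}" "y \<in> \<alpha> ` {..<N}" "x \<noteq> y" for x y
        using that lin(1) by blast
    qed auto
    obtain \<beta>' where \<beta>': "bij_betw \<beta>' {..<N} (\<beta> ` {..<N})"
      "\<And>i j. i < N \<Longrightarrow> j < N \<Longrightarrow> lt_col (es' 0) (\<beta>' i) (\<beta>' j) \<longleftrightarrow> i < j"
    proof (rule finite_linear_order_enum[of "\<beta> ` {..<N}" N "lt_col (es' 0)"])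
      show "card (\<beta> ` {..<N}) = N" using inj_\<beta> by (simp add: card_image)
      show "\<not> lt_col (es' 0) x x" for x by (auto simp: lt_col_def)
      show "lt_col (es' 0) x z" if "x \<in> \<beta> ` {..<N}" "y \<in> \<beta> ` {..<N}" "z \<in> \<beta> ` {..<N}"
        "lt_col (es' 0) x y" "lt_col (es' 0) y z" for x y z
      proof -
        from that obtain i j where ij: "x = \<beta> i" "y = \<beta> j" "i < N" "j < N" by blast
        have "\<not> lt_col (es' 0) x x" by (simp add: lt_col_def)
        then have "\<not> lt_col (es' 0) y x" using lin(2)[OF ij(3,4)] that(4) ij by metis
        then show ?thesis using that(5) unfolding lt_col_def by blast
      qed
      show "lt_col (es' 0) x y \<or> lt_col (es' 0) y x" if "x \<in> \<beta> ` {..<N}" "y \<in> \<beta> ` {..<N}" "x \<noteq> y" for x y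
        using that lin(2) by blast
    qed auto
    have GE'': "grid_enum G N \<alpha>' \<beta>'"
      using grid_enum_permute[OF GE' \<alpha>'(1) \<beta>'(1)] .
    interpret P: grid_enum G N \<alpha>' \<beta>' by (rule GE'')
    have im: "\<alpha>' ` {..<N} = \<alpha> ` {..<N}" "\<beta>' ` {..<N} = \<beta> ` {..<N}"
      using \<alpha>'(1) \<beta>'(1) by (auto simp: bij_betw_def)
    \<comment> \<open>The order depends on the set of columns, not on their numbering.\<close>
    have "lt_row = P.lt_row"
    proof (intro ext)
      fix H x x'
      have "lt_row H x x' \<longleftrightarrow> (\<exists>y \<in> \<beta> ` {..<N}. {x, y} \<in> H \<and> {x', y} \<notin> H)"
        by (auto simp: lt_row_def)
      also have "\<dots> \<longleftrightarrow> P.lt_row H x x'" unfolding im(2)[symmetric] by (auto simp: P.lt_row_def)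
      finally show "lt_row H x x' = P.lt_row H x x'" .
    qed
    moreover have "lt_col = P.lt_col"
    proof (intro ext)
      fix H x x'
      have "lt_col H x x' \<longleftrightarrow> (\<exists>y \<in> \<alpha> ` {..<N}. {y, x'} \<in> H \<and> {y, x} \<notin> H)"
        by (auto simp: lt_col_def)
      also have "\<dots> \<longleftrightarrow> P.lt_col H x x'" unfolding im(1)[symmetric] by (auto simp: P.lt_col_def)
      finally show "lt_col H x x' = P.lt_col H x x'" .
    qed
    moreover obtain i1 where i1: "i1 < N" "a0 = \<alpha>' i1" using i0 im(1) by blast
    ultimately have "grid_sat N (\<lambda>k i j. {\<alpha>' i, \<beta>' j} \<in> es' (Suc (to_nat k))) \<phi> (\<lambda>_. 0) (\<lambda>_. 0)"
      using sat(2) assms \<alpha>'(2) \<beta>'(2) es'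
      by (subst P.sat_grid_to_mso[symmetric, of "v(0 := a0)" i1 es' _ \<phi> _ _ vs e]) auto
    then show ?R by blast
  next
    assume ?R
    then obtain R where R: "grid_sat N R \<phi> (\<lambda>_. 0) (\<lambda>_. 0)" by blast
    interpret grid_enum G N \<alpha> \<beta> by (rule GE)
    \<comment> \<open>Index 0 receives the half graph: row \<open>i\<close> is told from a later row
      by column \<open>i\<close>, and column \<open>j\<close> from an earlier column by row
      \<open>j\<close>.\<close>
    define es' where "es' k = (case k of 0 \<Rightarrow> {{\<alpha> i, \<beta> j} |i j. i < N \<and> j < N \<and> i \<le> j}
      | Suc k' \<Rightarrow> {{\<alpha> i, \<beta> j} |i j. i < N \<and> j < N \<and> R (from_nat k') i j})" for k
    have es'_edges: "es' k \<subseteq> edges G" for k by (auto simp: es'_def edges split: nat.splits)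
    have es'0: "{\<alpha> i, \<beta> j} \<in> es' 0 \<longleftrightarrow> i \<le> j" if "i < N" "j < N" for i j
      using that edge_eq by (auto simp: es'_def)
    have es'R: "{\<alpha> i, \<beta> j} \<in> es' (Suc (to_nat k)) \<longleftrightarrow> R k i j" if "i < N" "j < N" for i j k
      using that edge_eq by (auto simp: es'_def)
    have row: "lt_row (es' 0) (\<alpha> i) (\<alpha> j) \<longleftrightarrow> i < j" if "i < N" "j < N" for i j
      using that by (auto simp: lt_row_def es'0 cong: conj_cong intro!: exI[of _ i])
    have col: "lt_col (es' 0) (\<beta> i) (\<beta> j) \<longleftrightarrow> i < j" if "i < N" "j < N" for i j
      using that by (auto simp: lt_col_def es'0 cong: conj_cong intro!: exI[of _ j])
    have "sat G linear_orders (v(0 := \<alpha> 0)) vs e es'"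
      by (subst sat_linear_orders[of _ 0]) (use N es'_edges in \<open>auto simp: row col\<close>)
    moreover have "sat G (grid_to_mso \<phi>) (v(0 := \<alpha> 0)) vs e es'"
      using R by (subst sat_grid_to_mso[of _ 0 _ R]) (use N es'_edges es'R row col assms in auto)
    moreover have "\<alpha> 0 \<in> verts G" using N verts by auto
    ultimately show ?L unfolding \<psi>(2) \<psi>0_def using es'_edges by auto
  qed
  then show thesis using \<psi>(1) that by blast
qed


section \<open>Derived connectives on the grid\<close>

text \<open>No atom is closed, so the truth constants are obtained by quantifying a comparison of a
  row with itself.\<close>

definition gtrue :: "'r grid_fm" where "gtrue = GNeg (GExR 0 (GLtR 0 0))"
definition gfalse :: "'r grid_fm" where "gfalse = GExR 0 (GLtR 0 0)"
definition gdisj :: "'r grid_fm \<Rightarrow> 'r grid_fm \<Rightarrow> 'r grid_fm" where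
  "gdisj \<phi> \<psi> = GNeg (GConj (GNeg \<phi>) (GNeg \<psi>))"
definition gimp :: "'r grid_fm \<Rightarrow> 'r grid_fm \<Rightarrow> 'r grid_fm" where
  "gimp \<phi> \<psi> = GNeg (GConj \<phi> (GNeg \<psi>))"
definition giff :: "'r grid_fm \<Rightarrow> 'r grid_fm \<Rightarrow> 'r grid_fm" where
  "giff \<phi> \<psi> = GConj (gimp \<phi> \<psi>) (gimp \<psi> \<phi>)"
definition gite :: "'r grid_fm \<Rightarrow> 'r grid_fm \<Rightarrow> 'r grid_fm \<Rightarrow> 'r grid_fm" where
  "gite \<chi> \<phi> \<psi> = GConj (gimp \<chi> \<phi>) (gimp (GNeg \<chi>) \<psi>)"
definition gbool :: "bool \<Rightarrow> 'r grid_fm" where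
  "gbool P = (if P then gtrue else gfalse)"
definition gallR :: "nat \<Rightarrow> 'r grid_fm \<Rightarrow> 'r grid_fm" where
  "gallR x \<phi> = GNeg (GExR x (GNeg \<phi>))"
definition gallC :: "nat \<Rightarrow> 'r grid_fm \<Rightarrow> 'r grid_fm" where
  "gallC x \<phi> = GNeg (GExC x (GNeg \<phi>))"
definition gconjs :: "'r grid_fm list \<Rightarrow> 'r grid_fm" where
  "gconjs \<phi>s = foldr GConj \<phi>s gtrue"
definition gdisjs :: "'r grid_fm list \<Rightarrow> 'r grid_fm" where
  "gdisjs \<phi>s = foldr gdisj \<phi>s gfalse"
definition gleC :: "nat \<Rightarrow> nat \<Rightarrow> 'r grid_fm" where
  "gleC x y = GNeg (GLtC y x)"
definition geqC :: "nat \<Rightarrow> nat \<Rightarrow> 'r grid_fm" where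
  "geqC x y = GConj (gleC x y) (gleC y x)"
text \<open>\<open>Suc (x + y)\<close> serves as a variable different from both arguments.\<close>

definition gsucR :: "nat \<Rightarrow> nat \<Rightarrow> 'r grid_fm" where
  "gsucR x y = GConj (GLtR x y)
     (gallR (Suc (x + y)) (GNeg (GConj (GLtR x (Suc (x + y))) (GLtR (Suc (x + y)) y))))"
definition gsucC :: "nat \<Rightarrow> nat \<Rightarrow> 'r grid_fm" where
  "gsucC x y = GConj (GLtC x y)
     (gallC (Suc (x + y)) (GNeg (GConj (GLtC x (Suc (x + y))) (GLtC (Suc (x + y)) y))))"
definition gfirstR :: "nat \<Rightarrow> 'r grid_fm" where
  "gfirstR x = gallR (Suc x) (GNeg (GLtR (Suc x) x))"
definition glastR :: "nat \<Rightarrow> 'r grid_fm" where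
  "glastR x = gallR (Suc x) (GNeg (GLtR x (Suc x)))"

lemma grid_sat_derived [simp]:
  "grid_sat N R gtrue a b" "\<not> grid_sat N R gfalse a b"
  "grid_sat N R (gdisj \<phi> \<psi>) a b \<longleftrightarrow> grid_sat N R \<phi> a b \<or> grid_sat N R \<psi> a b"
  "grid_sat N R (gimp \<phi> \<psi>) a b \<longleftrightarrow> (grid_sat N R \<phi> a b \<longrightarrow> grid_sat N R \<psi> a b)"
  "grid_sat N R (giff \<phi> \<psi>) a b \<longleftrightarrow> (grid_sat N R \<phi> a b \<longleftrightarrow> grid_sat N R \<psi> a b)"
  "grid_sat N R (gite \<chi> \<phi> \<psi>) a b \<longleftrightarrow>
    (if grid_sat N R \<chi> a b then grid_sat N R \<phi> a b else grid_sat N R \<psi> a b)"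
  "grid_sat N R (gbool P) a b \<longleftrightarrow> P"
  "grid_sat N R (gallR x \<phi>) a b \<longleftrightarrow> (\<forall>i<N. grid_sat N R \<phi> (a(x := i)) b)"
  "grid_sat N R (gallC x \<phi>) a b \<longleftrightarrow> (\<forall>i<N. grid_sat N R \<phi> a (b(x := i)))"
  "grid_sat N R (gleC x y) a b \<longleftrightarrow> b x \<le> b y"
  "grid_sat N R (geqC x y) a b \<longleftrightarrow> b x = b y"
  by (auto simp: gtrue_def gfalse_def gdisj_def gimp_def giff_def gite_def gbool_def gallR_def gallC_def
      gleC_def geqC_def)

lemma grid_sat_lists [simp]:
  "grid_sat N R (gconjs \<phi>s) a b \<longleftrightarrow> (\<forall>\<phi>\<in>set \<phi>s. grid_sat N R \<phi> a b)"
  "grid_sat N R (gdisjs \<phi>s) a b \<longleftrightarrow> (\<exists>\<phi>\<in>set \<phi>s. grid_sat N R \<phi> a b)"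
  by (induction \<phi>s) (auto simp: gconjs_def gdisjs_def)

lemma grid_sat_suc [simp]:
  "a y < N \<Longrightarrow> grid_sat N R (gsucR x y) a b \<longleftrightarrow> a y = Suc (a x)"
  "b y < N \<Longrightarrow> grid_sat N R (gsucC x y) a b \<longleftrightarrow> b y = Suc (b x)"
proof -
  \<comment> \<open>If \<open>n\<close> lay further up, \<open>Suc m\<close> would be strictly
    between and, being below \<open>n\<close>, inside the grid.\<close>
  have *: "(m < n \<and> (\<forall>i<N. \<not> (m < i \<and> i < n))) \<longleftrightarrow> n = Suc m" if "n < N" for m n :: nat
    using that by (auto dest: spec[of _ "Suc m"])
  show "a y < N \<Longrightarrow> grid_sat N R (gsucR x y) a b \<longleftrightarrow> a y = Suc (a x)"
    "b y < N \<Longrightarrow> grid_sat N R (gsucC x y) a b \<longleftrightarrow> b y = Suc (b x)"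
    unfolding *[symmetric] by (simp_all add: gsucR_def gsucC_def)
qed

lemma grid_sat_first_last [simp]:
  "a x < N \<Longrightarrow> grid_sat N R (gfirstR x) a b \<longleftrightarrow> a x = 0"
  "a x < N \<Longrightarrow> grid_sat N R (glastR x) a b \<longleftrightarrow> Suc (a x) = N"
  by (auto simp: gfirstR_def glastR_def dest: spec[of _ "Suc (a x)"])

lemma grid_fv_derived [simp]:
  "grid_fv gtrue = {}" "grid_fv gfalse = {}"
  "grid_fv (gdisj \<phi> \<psi>) = grid_fv \<phi> \<union> grid_fv \<psi>"
  "grid_fv (gimp \<phi> \<psi>) = grid_fv \<phi> \<union> grid_fv \<psi>"
  "grid_fv (giff \<phi> \<psi>) = grid_fv \<phi> \<union> grid_fv \<psi>"
  "grid_fv (gite \<chi> \<phi> \<psi>) = grid_fv \<chi> \<union> grid_fv \<phi> \<union> grid_fv \<psi>"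
  "grid_fv (gbool P) = {}"
  "grid_fv (gallR x \<phi>) = grid_fv \<phi> - {row_var x}"
  "grid_fv (gallC x \<phi>) = grid_fv \<phi> - {col_var x}"
  "grid_fv (gleC x y) = {col_var x, col_var y}"
  "grid_fv (geqC x y) = {col_var x, col_var y}"
  "grid_fv (gsucR x y) = {row_var x, row_var y}"
  "grid_fv (gsucC x y) = {col_var x, col_var y}"
  "grid_fv (gfirstR x) = {row_var x}"
  "grid_fv (glastR x) = {row_var x}"
  by (auto simp: gtrue_def gfalse_def gdisj_def gimp_def giff_def gite_def gbool_def gallR_def gallC_def
      gleC_def geqC_def gsucR_def gsucC_def gfirstR_def glastR_def)

lemma grid_fv_lists [simp]:
  "grid_fv (gconjs \<phi>s) = (\<Union>\<phi>\<in>set \<phi>s. grid_fv \<phi>)"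
  "grid_fv (gdisjs \<phi>s) = (\<Union>\<phi>\<in>set \<phi>s. grid_fv \<phi>)"
  by (induction \<phi>s) (auto simp: gconjs_def gdisjs_def)


section \<open>Computation tableaux\<close>

text \<open>All relations are binary, although a state belongs to a row alone: \<open>St q\<close>
  is consulted only in the column where the heads start.\<close>

datatype cell_rel = Cnt | St nat | Hd nat | Sym nat nat

instance cell_rel :: countable
  by countable_datatype

text \<open>Numbers with binary representation \<open>x\<close>, least significant bit first, followed by that
  of \<open>m\<close>.\<close>

primrec bits_value :: "bool list \<Rightarrow> nat \<Rightarrow> nat" where
  "bits_value [] m = m"
| "bits_value (b # x) m = 2 * bits_value x m + of_bool b"

lemma bit_bits_value:
  "bit (bits_value x m) i \<longleftrightarrow> (if i < length x then x ! i else bit m (i - length x))"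
proof (induction x arbitrary: i)
  case (Cons b x)
  then show ?case by (cases i) (auto simp: bit_0 bit_Suc)
qed simp

lemma bits_value_bounds:
  "2 ^ length x * m \<le> bits_value x m" "bits_value x m < 2 ^ length x * Suc m"
  by (induction x) auto

lemma bit_Suc_exp_iff:
  assumes "0 < h"
  shows "bit (1 + 2 ^ h :: nat) i \<longleftrightarrow> i = 0 \<or> i = h"
proof -
  obtain h' where h: "h = Suc h'" using assms by (cases h) auto
  show ?thesis by (cases i) (auto simp: h bit_0 bit_Suc bit_exp_iff)
qed

text \<open>Adding 1 flips digit \<open>i\<close> iff the carry reaches it, that is, iff all lower
  digits are 1. This is the rule that \<open>counter_fm\<close> imposes on consecutive rows.\<close>

lemma bit_Suc_iff: "bit (Suc t) i \<longleftrightarrow> \<not> (bit t i \<longleftrightarrow> (\<forall>j<i. bit t j))"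
proof (induction i arbitrary: t)
  case 0
  then show ?case by (simp add: bit_0)
next
  case (Suc i)
  show ?case
  proof (cases "odd t")
    case True
    then have "Suc t div 2 = Suc (t div 2)" by presburger
    moreover have "(\<forall>j<Suc i. bit t j) \<longleftrightarrow> (\<forall>j<i. bit (t div 2) j)"
      using True by (auto simp: All_less_Suc2 bit_0 bit_Suc)
    ultimately show ?thesis using Suc by (simp add: bit_Suc)
  next
    case False
    then have "Suc t div 2 = t div 2" by presburger
    moreover have "\<not> (\<forall>j<Suc i. bit t j)" using False by (auto simp: All_less_Suc2 bit_0)
    ultimately show ?thesis by (simp add: bit_Suc)
  qed
qed

text \<open>Lists, because the formulas are finite conjunctions and disjunctions over them. The
  initial state, the accepting state and the input symbols are added explicitly, as no transition
  need mention them.\<close>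

locale tableau =
  fixes M :: tm and ts :: "transition list" and qs ss :: "nat list"
  assumes tm: "turing_machine M" and ts: "set ts = trans M"
    and qs0: "0 \<in> set qs" "1 \<in> set qs" and ss0: "0 \<in> set ss" "1 \<in> set ss" "2 \<in> set ss"
    and qs: "((q, rs), (q', ws, ds)) \<in> trans M \<Longrightarrow> q \<in> set qs \<and> q' \<in> set qs"
    and ss: "((q, rs), (q', ws, ds)) \<in> trans M \<Longrightarrow> set rs \<subseteq> set ss \<and> set ws \<subseteq> set ss"
begin

abbreviation "k \<equiv> num_tapes M"

lemma trans_lengths:
  assumes "((q, rs), (q', ws, ds)) \<in> trans M"
  shows "length rs = k" "length ws = k" "length ds = k"
  using tm assms unfolding turing_machine_def by fastforce+

lemma trans_moves:
  assumes "((q, rs), (q', ws, ds)) \<in> trans M" "j < k"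
  shows "ds ! j \<in> {-1, 0, 1}"
proof -
  have "length ds = k" "set ds \<subseteq> {-1, 0, 1}"
    using tm assms(1) unfolding turing_machine_def by fastforce+
  then show ?thesis using assms(2) by (metis nth_mem subsetD)
qed

text \<open>Rows are time steps and columns are tape cells; column variable 0 is the cell on which all
  heads start, 1 and 2 are the columns of the second highest and the highest bit that are set in
  the last row of the counter. Row variable 2 is the last row.\<close>

definition counter_fm :: "cell_rel grid_fm" where
  "counter_fm = gconjs [
     gallR 0 (gimp (gfirstR 0) (gallC 3 (GNeg (GRel Cnt 0 3)))),
     gallR 0 (gallR 1 (gimp (gsucR 0 1) (gallC 3 (giff (GRel Cnt 1 3) (GConj (gleC 0 3)
       (GNeg (giff (GRel Cnt 0 3)
         (gallC 4 (gimp (GConj (gleC 0 4) (GLtC 4 3)) (GRel Cnt 0 4)))))))))),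
     gallR 0 (gallC 3 (gimp (GRel Cnt 0 3) (GExC 4 (GLtC 3 4))))]"

definition decode_fm :: "cell_rel grid_fm" where
  "decode_fm = gconjs [gleC 0 1, GLtC 1 2, gallR 0 (gimp (glastR 0) (gconjs [GRel Cnt 0 1,
     GRel Cnt 0 2, gallC 3 (gimp (GLtC 1 3) (gimp (GRel Cnt 0 3) (geqC 3 2)))]))]"

text \<open>Row variable 2 is the last row. The initial symbol in column 3 of tape 0 is dictated by
  the counter digit that this column holds there: symbol 2 for a set digit, 1 for an unset one,
  between the origin and the end mark.\<close>

definition init_sym_fm :: "nat \<Rightarrow> nat \<Rightarrow> cell_rel grid_fm" where
  "init_sym_fm j s =
     (if j = 0 then
        if s = 0 then GNeg (GConj (gleC 0 3) (GLtC 3 1))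
        else if s = 1 then GConj (GConj (gleC 0 3) (GLtC 3 1)) (GNeg (GRel Cnt 2 3))
        else if s = 2 then GConj (GConj (gleC 0 3) (GLtC 3 1)) (GRel Cnt 2 3)
        else gfalse
      else gbool (s = 0))"

definition state_fm :: "nat \<Rightarrow> nat \<Rightarrow> cell_rel grid_fm" where
  "state_fm x q = gconjs (map (\<lambda>r. giff (GRel (St r) x 0) (gbool (r = q))) qs)"

definition init_fm :: "cell_rel grid_fm" where
  "init_fm = gallR 0 (gallR 2 (gimp (GConj (gfirstR 0) (glastR 2)) (GConj (state_fm 0 0)
     (gallC 3 (gconjs (map (\<lambda>j. GConj (giff (GRel (Hd j) 0 3) (geqC 3 0))
       (gconjs (map (\<lambda>s. giff (GRel (Sym j s) 0 3) (init_sym_fm j s)) ss))) [0..<k]))))))"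

text \<open>The number of rows is dictated by the code of the word and exceeds the running time, so
  rows must be allowed to repeat. A repeated row stands for the same configuration, and only the
  last row is asked to be halting.\<close>

definition stutter_fm :: "cell_rel grid_fm" where
  "stutter_fm = GConj (gconjs (map (\<lambda>q. giff (GRel (St q) 1 0) (GRel (St q) 0 0)) qs))
     (gallC 3 (gconjs (map (\<lambda>j. GConj (giff (GRel (Hd j) 1 3) (GRel (Hd j) 0 3))
       (gconjs (map (\<lambda>s. giff (GRel (Sym j s) 1 3) (GRel (Sym j s) 0 3)) ss))) [0..<k])))"

definition move_fm :: "int \<Rightarrow> cell_rel grid_fm" where
  "move_fm d = (if d = 1 then gsucC 3 4 else if d = -1 then gsucC 4 3 else geqC 3 4)"

text \<open>Column variables 3 and 4 are the head positions before and after the step, 5 is an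
  arbitrary cell. As 4 is quantified over the grid, no head can leave it.\<close>

definition tape_fm :: "nat list \<Rightarrow> nat list \<Rightarrow> int list \<Rightarrow> nat \<Rightarrow> cell_rel grid_fm" where
  "tape_fm rs ws ds j = GExC 3 (GExC 4 (gconjs [GRel (Hd j) 0 3, GRel (Sym j (rs ! j)) 0 3,
     move_fm (ds ! j),
     gallC 5 (GConj (giff (GRel (Hd j) 1 5) (geqC 5 4))
       (gconjs (map (\<lambda>s. giff (GRel (Sym j s) 1 5)
          (gite (geqC 5 3) (gbool (s = ws ! j)) (GRel (Sym j s) 0 5))) ss)))]))"

definition trans_fm :: "transition \<Rightarrow> cell_rel grid_fm" where
  "trans_fm = (\<lambda>((q, rs), (q', ws, ds)).
     gconjs [GRel (St q) 0 0, state_fm 1 q', gconjs (map (tape_fm rs ws ds) [0..<k])])"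

definition step_fm :: "cell_rel grid_fm" where
  "step_fm = gallR 0 (gallR 1 (gimp (gsucR 0 1) (gdisj stutter_fm (gdisjs (map trans_fm ts)))))"

text \<open>A transition is blocked if some tape shows a symbol other than the one it reads. Only
  transitions from state 1 matter, because \<open>final_fm\<close> prescribes that state.\<close>

definition halt_fm :: "transition \<Rightarrow> cell_rel grid_fm" where
  "halt_fm = (\<lambda>((q, rs), _). if q = 1 then gdisjs (map (\<lambda>j. GExC 3
     (GConj (GRel (Hd j) 0 3) (GNeg (GRel (Sym j (rs ! j)) 0 3)))) [0..<k]) else gtrue)"

definition final_fm :: "cell_rel grid_fm" where
  "final_fm = gallR 0 (gimp (glastR 0) (GConj (GRel (St 1) 0 0) (gconjs (map halt_fm ts))))"

definition accept_fm :: "cell_rel grid_fm" where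
  "accept_fm = GExC 0 (GExC 1 (GExC 2 (gconjs [counter_fm, decode_fm, init_fm, step_fm, final_fm])))"

lemma grid_fv_accept_fm: "grid_fv accept_fm = {}"
proof -
  have 1: "grid_fv counter_fm \<subseteq> {col_var 0}" by (auto simp: counter_fm_def)
  have 2: "grid_fv decode_fm \<subseteq> {col_var 0, col_var 1, col_var 2}" by (auto simp: decode_fm_def)
  have st: "v \<in> grid_fv (state_fm x q) \<Longrightarrow> v = row_var x \<or> v = col_var 0" for v x q
    by (auto simp: state_fm_def split: if_splits)
  have sy: "v \<in> grid_fv (init_sym_fm j s) \<Longrightarrow>
      v = row_var 2 \<or> v = col_var 0 \<or> v = col_var 1 \<or> v = col_var 3" for v j s
    by (auto simp: init_sym_fm_def split: if_splits)
  have 3: "grid_fv init_fm \<subseteq> {col_var 0, col_var 1}"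
    by (auto simp: init_fm_def dest: st sy)
  have sf: "grid_fv stutter_fm \<subseteq> {row_var 0, row_var 1, col_var 0}" by (auto simp: stutter_fm_def)
  have mv: "v \<in> grid_fv (move_fm d) \<Longrightarrow> v = col_var 3 \<or> v = col_var 4" for v d
    by (auto simp: move_fm_def split: if_splits)
  have tf: "v \<in> grid_fv (tape_fm rs ws ds j) \<Longrightarrow> v = row_var 0 \<or> v = row_var 1" for v rs ws ds j
    by (auto simp: tape_fm_def split: if_splits dest: mv)
  have tr: "v \<in> grid_fv (trans_fm \<delta>) \<Longrightarrow> v = row_var 0 \<or> v = row_var 1 \<or> v = col_var 0" for v \<delta>
    by (auto simp: trans_fm_def split: prod.splits dest: st tf)
  have 4: "grid_fv step_fm \<subseteq> {col_var 0}" using sf by (auto simp: step_fm_def dest: tr)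
  have ha: "v \<in> grid_fv (halt_fm \<delta>) \<Longrightarrow> v = row_var 0" for v \<delta>
    by (auto simp: halt_fm_def split: prod.splits if_splits)
  have 5: "grid_fv final_fm \<subseteq> {col_var 0}" by (auto simp: final_fm_def dest: ha)
  show ?thesis using 1 2 3 4 5 by (auto simp: accept_fm_def)
qed

section \<open>Tableaux as conditions on relations\<close>

context
  fixes N :: nat and R :: "cell_rel \<Rightarrow> nat \<Rightarrow> nat \<Rightarrow> bool"
begin

definition counter_ok :: "nat \<Rightarrow> bool" where
  "counter_ok o' \<longleftrightarrow> (\<forall>t<N. t = 0 \<longrightarrow> (\<forall>p<N. \<not> R Cnt t p)) \<and>
     (\<forall>t<N. \<forall>t'<N. t' = Suc t \<longrightarrow> (\<forall>p<N. R Cnt t' p \<longleftrightarrow>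
        o' \<le> p \<and> \<not> (R Cnt t p \<longleftrightarrow> (\<forall>p'<N. o' \<le> p' \<and> p' < p \<longrightarrow> R Cnt t p')))) \<and>
     (\<forall>t<N. \<forall>p<N. R Cnt t p \<longrightarrow> (\<exists>p'<N. p < p'))"

definition decode_ok :: "nat \<Rightarrow> nat \<Rightarrow> nat \<Rightarrow> bool" where
  "decode_ok o' e g \<longleftrightarrow> o' \<le> e \<and> e < g \<and> (\<forall>t<N. Suc t = N \<longrightarrow> R Cnt t e \<and> R Cnt t g \<and>
     (\<forall>p<N. e < p \<longrightarrow> R Cnt t p \<longrightarrow> p = g))"

definition init_sym :: "nat \<Rightarrow> nat \<Rightarrow> nat \<Rightarrow> nat \<Rightarrow> nat \<Rightarrow> nat" where
  "init_sym o' e l j p = (if j = 0 \<and> o' \<le> p \<and> p < e then if R Cnt l p then 2 else 1 else 0)"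

definition init_ok :: "nat \<Rightarrow> nat \<Rightarrow> bool" where
  "init_ok o' e \<longleftrightarrow> (\<forall>t<N. \<forall>l<N. t = 0 \<and> Suc l = N \<longrightarrow> (\<forall>r\<in>set qs. R (St r) t o' \<longleftrightarrow> r = 0) \<and>
     (\<forall>p<N. \<forall>j<k. (R (Hd j) t p \<longleftrightarrow> p = o') \<and>
        (\<forall>s\<in>set ss. R (Sym j s) t p \<longleftrightarrow> s = init_sym o' e l j p)))"

definition stutter :: "nat \<Rightarrow> nat \<Rightarrow> nat \<Rightarrow> bool" where
  "stutter o' t t' \<longleftrightarrow> (\<forall>q\<in>set qs. R (St q) t' o' \<longleftrightarrow> R (St q) t o') \<and>
     (\<forall>p<N. \<forall>j<k. (R (Hd j) t' p \<longleftrightarrow> R (Hd j) t p) \<and>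
        (\<forall>s\<in>set ss. R (Sym j s) t' p \<longleftrightarrow> R (Sym j s) t p))"

definition follows :: "nat \<Rightarrow> nat \<Rightarrow> nat \<Rightarrow> transition \<Rightarrow> bool" where
  "follows o' t t' = (\<lambda>((q, rs), (q', ws, ds)).
     R (St q) t o' \<and> (\<forall>r\<in>set qs. R (St r) t' o' \<longleftrightarrow> r = q') \<and>
     (\<forall>j<k. \<exists>p<N. \<exists>p'<N. R (Hd j) t p \<and> R (Sym j (rs ! j)) t p \<and> int p' = int p + ds ! j \<and>
        (\<forall>p''<N. (R (Hd j) t' p'' \<longleftrightarrow> p'' = p') \<and>
          (\<forall>s\<in>set ss. R (Sym j s) t' p'' \<longleftrightarrow> (if p'' = p then s = ws ! j else R (Sym j s) t p'')))))"

definition final_ok :: "nat \<Rightarrow> bool" where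
  "final_ok o' \<longleftrightarrow> (\<forall>t<N. Suc t = N \<longrightarrow> R (St 1) t o' \<and>
     (\<forall>((q, rs), _) \<in> trans M. q = 1 \<longrightarrow>
        (\<exists>j<k. \<exists>p<N. R (Hd j) t p \<and> \<not> R (Sym j (rs ! j)) t p)))"

definition tableau_ok :: "nat \<Rightarrow> nat \<Rightarrow> nat \<Rightarrow> bool" where
  "tableau_ok o' e g \<longleftrightarrow> counter_ok o' \<and> decode_ok o' e g \<and> init_ok o' e \<and>
     (\<forall>t<N. \<forall>t'<N. t' = Suc t \<longrightarrow> stutter o' t t' \<or> (\<exists>\<delta>\<in>trans M. follows o' t t' \<delta>)) \<and>
     final_ok o'"

lemma grid_sat_state_fm:
  "grid_sat N R (state_fm x q) a b \<longleftrightarrow> (\<forall>r\<in>set qs. R (St r) (a x) (b 0) \<longleftrightarrow> r = q)"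
  by (auto simp: state_fm_def)

lemma grid_sat_init_sym_fm:
  "grid_sat N R (init_sym_fm j s) a b \<longleftrightarrow> s = init_sym (b 0) (b 1) (a 2) j (b 3)"
  by (auto simp: init_sym_fm_def init_sym_def)

lemma grid_sat_move_fm:
  "b 3 < N \<Longrightarrow> b 4 < N \<Longrightarrow> d \<in> {-1, 0, 1} \<Longrightarrow>
    grid_sat N R (move_fm d) a b \<longleftrightarrow> int (b 4) = int (b 3) + d"
  by (auto simp: move_fm_def)

lemma grid_sat_trans_fm:
  assumes "\<delta> \<in> trans M"
  shows "grid_sat N R (trans_fm \<delta>) a b \<longleftrightarrow> follows (b 0) (a 0) (a 1) \<delta>"
proof -
  obtain q rs q' ws ds where \<delta>: "\<delta> = ((q, rs), (q', ws, ds))" by (metis surj_pair)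
  note ds = trans_moves[OF assms[unfolded \<delta>]]
  have "grid_sat N R (tape_fm rs ws ds j) a b \<longleftrightarrow>
    (\<exists>p<N. \<exists>p'<N. R (Hd j) (a 0) p \<and> R (Sym j (rs ! j)) (a 0) p \<and> int p' = int p + ds ! j \<and>
        (\<forall>p''<N. (R (Hd j) (a 1) p'' \<longleftrightarrow> p'' = p') \<and>
          (\<forall>s\<in>set ss. R (Sym j s) (a 1) p'' \<longleftrightarrow>
             (if p'' = p then s = ws ! j else R (Sym j s) (a 0) p''))))" if "j < k" for j
  proof -
    have "grid_sat N R (move_fm (ds ! j)) a (b(3 := p, 4 := p')) \<longleftrightarrow> int p' = int p + ds ! j"
      if "p < N" "p' < N" for p p'
      using grid_sat_move_fm[of "b(3 := p, 4 := p')" "ds ! j"] ds[OF \<open>j < k\<close>] that by simp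
    then show ?thesis unfolding tape_fm_def by (simp cong: conj_cong)
  qed
  then show ?thesis by (auto simp: \<delta> trans_fm_def follows_def grid_sat_state_fm)
qed

lemma grid_sat_accept_fm:
  "grid_sat N R accept_fm a b \<longleftrightarrow> (\<exists>o'<N. \<exists>e<N. \<exists>g<N. tableau_ok o' e g)"
proof -
  have ball_upt: "(\<forall>j\<in>{0..<n}. P j) \<longleftrightarrow> (\<forall>j<n. P j)" for P and n :: nat by auto
  have 1: "grid_sat N R counter_fm a b \<longleftrightarrow> counter_ok (b 0)" for a b
    by (simp add: counter_fm_def counter_ok_def)
  have 2: "grid_sat N R decode_fm a b \<longleftrightarrow> decode_ok (b 0) (b 1) (b 2)" for a b
    by (simp add: decode_fm_def decode_ok_def)
  have 3: "grid_sat N R init_fm a b \<longleftrightarrow> init_ok (b 0) (b 1)" for a b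
    by (simp add: init_fm_def init_ok_def grid_sat_state_fm grid_sat_init_sym_fm ball_upt)
  have "grid_sat N R stutter_fm a b \<longleftrightarrow> stutter (b 0) (a 0) (a 1)" for a b
    by (simp add: stutter_fm_def stutter_def ball_upt)
  then have 4: "grid_sat N R step_fm a b \<longleftrightarrow> (\<forall>t<N. \<forall>t'<N. t' = Suc t \<longrightarrow>
      stutter (b 0) t t' \<or> (\<exists>\<delta>\<in>trans M. follows (b 0) t t' \<delta>))" for a b
    by (simp add: step_fm_def ts grid_sat_trans_fm)
  have 5: "grid_sat N R final_fm a b \<longleftrightarrow> final_ok (b 0)" for a b
    by (fastforce simp: final_fm_def final_ok_def ts halt_fm_def Ball_def)
  show ?thesis by (simp add: accept_fm_def tableau_ok_def 1 2 3 4 5)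
qed

text \<open>Cell \<open>i\<close> of a tape sits in column \<open>i + o'\<close>. Cells outside the
  grid are left open; this suffices because the heads are inside and a step touches only the scanned
  cells.\<close>

definition rep :: "nat \<Rightarrow> nat \<Rightarrow> config \<Rightarrow> bool" where
  "rep o' t = (\<lambda>(q, T, h). (\<forall>r\<in>set qs. R (St r) t o' \<longleftrightarrow> r = q) \<and>
     (\<forall>j<k. 0 \<le> h j + int o' \<and> h j + int o' < int N \<and>
        (\<forall>p<N. R (Hd j) t p \<longleftrightarrow> int p = h j + int o') \<and>
        (\<forall>s\<in>set ss. \<forall>p<N. R (Sym j s) t p \<longleftrightarrow> T j (int p - int o') = s)))"

lemma rep_stutter: "stutter o' t t' \<Longrightarrow> rep o' t c \<Longrightarrow> rep o' t' c"
  by (cases c) (auto simp: rep_def stutter_def)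

lemma stutter_rep: "rep o' t c \<Longrightarrow> rep o' t' c \<Longrightarrow> stutter o' t t'"
  by (cases c) (auto simp: rep_def stutter_def)

text \<open>The transition determines all entries of the next row, so it suffices to exhibit the
  configuration they describe; its heads are in the grid because \<open>follows\<close> supplies
  their columns.\<close>

lemma rep_follows:
  assumes "\<delta> \<in> trans M" "follows o' t t' \<delta>" "rep o' t c"
  shows "\<exists>c'. tm_step M c c' \<and> rep o' t' c'"
proof -
  obtain q rs q' ws ds where \<delta>: "\<delta> = ((q, rs), (q', ws, ds))" by (metis surj_pair)
  obtain q0 T h where c: "c = (q0, T, h)" by (metis surj_pair)
  note in_ss = ss[OF assms(1)[unfolded \<delta>]] and in_qs = qs[OF assms(1)[unfolded \<delta>]]
    and len = trans_lengths[OF assms(1)[unfolded \<delta>]]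
  have q0: "q0 = q" using assms(2,3) in_qs by (auto simp: c \<delta> rep_def follows_def)
  have tape: "T j (h j) = rs ! j \<and> 0 \<le> h j + ds ! j + int o' \<and> h j + ds ! j + int o' < int N \<and>
      (\<forall>p<N. (R (Hd j) t' p \<longleftrightarrow> int p = h j + ds ! j + int o') \<and>
        (\<forall>s\<in>set ss. R (Sym j s) t' p \<longleftrightarrow>
          (if int p = h j + int o' then s = ws ! j else T j (int p - int o') = s)))"
    if j: "j < k" for j
  proof -
    have rsj: "rs ! j \<in> set ss" using j len in_ss by (auto dest: nth_mem)
    obtain p p' where p: "p < N" "p' < N" "R (Hd j) t p" "R (Sym j (rs ! j)) t p"
      "int p' = int p + ds ! j"
      "\<And>p''. p'' < N \<Longrightarrow> (R (Hd j) t' p'' \<longleftrightarrow> p'' = p') \<and>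
          (\<forall>s\<in>set ss. R (Sym j s) t' p'' \<longleftrightarrow> (if p'' = p then s = ws ! j else R (Sym j s) t p''))"
      using assms(2) j unfolding \<delta> follows_def by auto
    have hp: "int p = h j + int o'" using assms(3) j p unfolding c rep_def by auto
    have "T j (int p - int o') = rs ! j" using assms(3) j p rsj unfolding c rep_def by auto
    then have "T j (h j) = rs ! j" using hp by simp
    moreover have "R (Sym j s) t p'' \<longleftrightarrow> T j (int p'' - int o') = s" if "s \<in> set ss" "p'' < N" for s p''
      using assms(3) j that unfolding c rep_def by auto
    moreover have "p'' = p \<longleftrightarrow> int p'' = h j + int o'" for p'' using hp by linarith
    moreover have "p'' = p' \<longleftrightarrow> int p'' = h j + ds ! j + int o'" for p'' using hp p(5) by linarith
    ultimately show ?thesis using p(2,5,6) hp by auto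
  qed
  have "map (\<lambda>j. T j (h j)) [0..<k] = rs"
    using tape len by (auto intro: nth_equalityI)
  then have step: "tm_step M c (q', (\<lambda>j. if j < k then (T j)(h j := ws ! j) else T j),
      (\<lambda>j. if j < k then h j + ds ! j else h j))" (is "tm_step M c ?c'")
    unfolding c q0 using assms(1) \<delta> by (intro tm_step.intros) simp
  have "rep o' t' ?c'"
    unfolding rep_def prod.case
  proof (intro conjI allI impI ballI)
    fix r assume "r \<in> set qs"
    then show "R (St r) t' o' \<longleftrightarrow> r = q'" using assms(2) by (auto simp: \<delta> follows_def)
  next
    fix j s p assume *: "j < k" "s \<in> set ss" "p < N"
    have "int p = h j + int o' \<longleftrightarrow> int p - int o' = h j" by linarith
    then show "R (Sym j s) t' p \<longleftrightarrow> (if j < k then (T j)(h j := ws ! j) else T j) (int p - int o') = s"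
      using tape[OF *(1)] * by auto
  qed (use tape in auto)
  with step show ?thesis by blast
qed

lemma follows_rep:
  assumes "tm_step M c c'" "rep o' t c" "rep o' t' c'"
  shows "\<exists>\<delta>\<in>trans M. follows o' t t' \<delta>"
  using assms(1)
proof cases
  case (1 q T h q' ws ds)
  let ?rs = "map (\<lambda>j. T j (h j)) [0..<k]"
  have rsj: "?rs ! j \<in> set ss" if "j < k" for j using that ss[OF 1(3)] by (auto dest: nth_mem)
  have "follows o' t t' ((q, ?rs), (q', ws, ds))"
    unfolding follows_def prod.case
  proof (intro conjI allI impI)
    show "R (St q) t o'" using assms(2) qs[OF 1(3)] by (auto simp: 1 rep_def)
    show "\<forall>r\<in>set qs. R (St r) t' o' \<longleftrightarrow> r = q'" using assms(3) by (auto simp: 1 rep_def)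
    fix j assume j: "j < k"
    have a: "0 \<le> h j + int o'" "h j + int o' < int N"
      "\<And>p. p < N \<Longrightarrow> R (Hd j) t p \<longleftrightarrow> int p = h j + int o'"
      "\<And>s p. s \<in> set ss \<Longrightarrow> p < N \<Longrightarrow> R (Sym j s) t p \<longleftrightarrow> T j (int p - int o') = s"
      using assms(2) j by (auto simp: 1 rep_def)
    have b: "0 \<le> h j + ds ! j + int o'" "h j + ds ! j + int o' < int N"
      "\<And>p. p < N \<Longrightarrow> R (Hd j) t' p \<longleftrightarrow> int p = h j + ds ! j + int o'"
      "\<And>s p. s \<in> set ss \<Longrightarrow> p < N \<Longrightarrow>
         R (Sym j s) t' p \<longleftrightarrow> ((T j)(h j := ws ! j)) (int p - int o') = s"
      using assms(3) j by (auto simp: 1 rep_def)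
    let ?p = "nat (h j + int o')" and ?p' = "nat (h j + ds ! j + int o')"
    have "?p < N \<and> ?p' < N \<and> R (Hd j) t ?p \<and> R (Sym j (?rs ! j)) t ?p \<and> int ?p' = int ?p + ds ! j \<and>
        (\<forall>p''<N. (R (Hd j) t' p'' \<longleftrightarrow> p'' = ?p') \<and>
          (\<forall>s\<in>set ss. R (Sym j s) t' p'' \<longleftrightarrow> (if p'' = ?p then s = ws ! j else R (Sym j s) t p'')))"
    proof (intro conjI allI impI ballI)
      fix p'' s assume *: "p'' < N" "s \<in> set ss"
      have "p'' = ?p \<longleftrightarrow> int p'' - int o' = h j" using a by linarith
      then show "R (Sym j s) t' p'' \<longleftrightarrow> (if p'' = ?p then s = ws ! j else R (Sym j s) t p'')"
        using a(4) b(4) * by auto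
    qed (use a b j rsj in auto)
    then show "\<exists>p<N. \<exists>p'<N. R (Hd j) t p \<and> R (Sym j (?rs ! j)) t p \<and> int p' = int p + ds ! j \<and>
        (\<forall>p''<N. (R (Hd j) t' p'' \<longleftrightarrow> p'' = p') \<and>
          (\<forall>s\<in>set ss. R (Sym j s) t' p'' \<longleftrightarrow> (if p'' = p then s = ws ! j else R (Sym j s) t p'')))"
      by blast
  qed
  with 1(3) show ?thesis by blast
qed

text \<open>Induction on the row by \<open>bit_Suc_iff\<close>. The right edge of the grid does no
  harm, since a digit depends on lower digits only.\<close>

lemma counter_bit:
  assumes "counter_ok o'" "t < N" "p < N"
  shows "R Cnt t p \<longleftrightarrow> o' \<le> p \<and> bit t (p - o')"
  using assms(2,3)
proof (induction t arbitrary: p)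
  case 0
  then show ?case using assms(1) by (simp add: counter_ok_def)
next
  case (Suc t)
  have "R Cnt (Suc t) p \<longleftrightarrow>
      o' \<le> p \<and> \<not> (R Cnt t p \<longleftrightarrow> (\<forall>p'<N. o' \<le> p' \<and> p' < p \<longrightarrow> R Cnt t p'))"
    by (rule assms(1)[unfolded counter_ok_def, THEN conjunct2, THEN conjunct1, rule_format])
      (use Suc.prems in auto)
  also have "(\<forall>p'<N. o' \<le> p' \<and> p' < p \<longrightarrow> R Cnt t p') \<longleftrightarrow> (\<forall>j<p - o'. bit t j)"
  proof (intro iffI allI impI)
    fix j assume *: "\<forall>p'<N. o' \<le> p' \<and> p' < p \<longrightarrow> R Cnt t p'" "j < p - o'"
    then have "R Cnt t (o' + j)" using Suc.prems by auto
    then show "bit t j" using Suc.IH[of "o' + j"] Suc.prems * by auto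
  next
    fix p' assume "\<forall>j<p - o'. bit t j" "p' < N" "o' \<le> p' \<and> p' < p"
    then show "R Cnt t p'" using Suc.IH[of p'] Suc.prems by auto
  qed
  finally show ?case using Suc.IH[of p] Suc.prems by (auto simp: bit_Suc_iff)
qed

text \<open>An origin guessed too far to the right would cut off high digits. But then the counter
  would pass through the power of two whose only digit lies in the last column, where no digit may
  be set.\<close>

lemma counter_no_overflow:
  assumes "counter_ok o'" "o' < N"
  shows "N - 1 < 2 ^ (N - 1 - o')"
proof (rule ccontr)
  assume "\<not> ?thesis"
  then have *: "2 ^ (N - 1 - o') < N" using assms(2) by linarith
  then have "R Cnt (2 ^ (N - 1 - o')) (N - 1)"
    using counter_bit[OF assms(1) *, of "N - 1"] assms(2) by (auto simp: bit_exp_iff)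
  moreover have "N - 1 < N" using assms(2) by simp
  ultimately have "\<exists>p'<N. N - 1 < p'"
    using assms(1)[unfolded counter_ok_def, THEN conjunct2, THEN conjunct2, rule_format, OF *] by blast
  then show False by auto
qed

text \<open>From position \<open>length x\<close> on, the set digits of \<open>N - 1\<close> are
  those at \<open>length x\<close> and \<open>length x + h\<close>, different as \<open>h\<close> is
  positive. All of them fit into the grid, so the second highest one is the end mark.\<close>

lemma decode_end:
  assumes "counter_ok o'" "decode_ok o' e g" "o' < N" "e < N" "g < N"
    and N: "N = Suc (bits_value x (1 + 2 ^ h))" and h: "0 < h"
  shows "e = o' + length x"
proof -
  have bits: "bit (N - 1) i \<longleftrightarrow> (if i < length x then x ! i else i = length x \<or> i = length x + h)" for i
    by (auto simp: N bit_bits_value bit_Suc_exp_iff[OF h, simplified])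
  have small: "i < N - 1 - o'" if "bit (N - 1) i" for i
  proof (rule ccontr)
    assume "\<not> ?thesis"
    then have "(2::nat) ^ (N - 1 - o') \<le> 2 ^ i" by (intro power_increasing) auto
    then have "N - 1 < 2 ^ i" using counter_no_overflow[OF assms(1,3)] by linarith
    then show False using that by (simp add: bit_iff_odd)
  qed
  have cnt: "R Cnt (N - 1) p \<longleftrightarrow> o' \<le> p \<and> bit (N - 1) (p - o')" if "p < N" for p
    using counter_bit[OF assms(1), of "N - 1" p] that assms(3) by simp
  have D: "R Cnt (N - 1) e \<and> R Cnt (N - 1) g \<and> (\<forall>p<N. e < p \<longrightarrow> R Cnt (N - 1) p \<longrightarrow> p = g)"
    by (rule assms(2)[unfolded decode_ok_def, THEN conjunct2, THEN conjunct2, rule_format])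
      (use assms(3) in auto)
  have d: "o' \<le> e" "e < g" "bit (N - 1) (e - o')" "bit (N - 1) (g - o')"
    using assms(2) D cnt[OF assms(4)] cnt[OF assms(5)] by (simp_all add: decode_ok_def)
  have last: "i = g - o'" if "bit (N - 1) i" "e - o' < i" for i
  proof -
    have "o' + i < N" using small[OF that(1)] by linarith
    then have "R Cnt (N - 1) (o' + i)" using cnt that by simp
    moreover have "e < o' + i" using that(2) d(1) by linarith
    ultimately have "o' + i = g" using D \<open>o' + i < N\<close> by blast
    then show ?thesis by simp
  qed
  have L: "bit (N - 1) (length x)" "bit (N - 1) (length x + h)" using bits by auto
  \<comment> \<open>An \<open>e\<close> below the end mark would have two set digits above it, where
    only \<open>g\<close> may be set. An \<open>e\<close> above the end mark would be the top digit,
    leaving none for \<open>g\<close>.\<close>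
  have "\<not> e - o' < length x" using last[OF L(1)] last[OF L(2)] h by auto
  moreover have "\<not> length x < e - o'"
  proof
    assume "length x < e - o'"
    then have "e - o' = length x + h" "g - o' = length x \<or> g - o' = length x + h"
      using d bits by (auto split: if_splits)
    then show False using d \<open>length x < e - o'\<close> by linarith
  qed
  ultimately show ?thesis using d(1) by linarith
qed

text \<open>The rows are guessed relations. Going down from the first row, each is found to
  represent a reachable configuration, and the conditions on the last row make its configuration
  halting and accepting.\<close>

lemma tableau_sound:
  assumes tab: "tableau_ok o' e g" and b: "o' < N" "e < N" "g < N"
    and N: "N = Suc (bits_value x (1 + 2 ^ h))" and h: "0 < h"
  shows "accepts M x"
proof -
  have ok: "counter_ok o'" "decode_ok o' e g" "init_ok o' e" "final_ok o'"
    and step: "\<And>t. Suc t < N \<Longrightarrow>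
      stutter o' t (Suc t) \<or> (\<exists>\<delta>\<in>trans M. follows o' t (Suc t) \<delta>)"
    using tab by (auto simp: tableau_ok_def)
  have e: "e = o' + length x" by (rule decode_end[OF ok(1,2) b N h])
  \<comment> \<open>The last row counts to \<open>N - 1\<close>, whose lowest digits spell the input
    in just the columns of the input cells.\<close>
  have sym: "init_sym o' e (N - 1) j p = fst (snd (initial_config x)) j (int p - int o')" if "p < N" for j p
  proof -
    have "R Cnt (N - 1) p \<longleftrightarrow> x ! (p - o')" if "o' \<le> p" "p < e"
      using counter_bit[OF ok(1), of "N - 1" p] b that e by (auto simp: N bit_bits_value)
    moreover have "nat (int p - int o') = p - o'" by simp
    ultimately show ?thesis
      by (auto simp: init_sym_def initial_config_def input_tape_def bit_symbol_def e)
  qed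
  have "(\<forall>r\<in>set qs. R (St r) 0 o' \<longleftrightarrow> r = 0) \<and> (\<forall>p<N. \<forall>j<k. (R (Hd j) 0 p \<longleftrightarrow> p = o') \<and>
        (\<forall>s\<in>set ss. R (Sym j s) 0 p \<longleftrightarrow> s = init_sym o' e (N - 1) j p))"
    by (rule ok(3)[unfolded init_ok_def, rule_format]) (use b in auto)
  then have init: "rep o' 0 (initial_config x)"
    using b sym by (auto simp: rep_def initial_config_def)
  have "\<exists>c. (tm_step M)\<^sup>*\<^sup>* (initial_config x) c \<and> rep o' t c" if "t < N" for t
    using that
  proof (induction t)
    case 0
    then show ?case using init by blast
  next
    case (Suc t)
    then obtain c where c: "(tm_step M)\<^sup>*\<^sup>* (initial_config x) c" "rep o' t c" by auto
    show ?case using step[OF Suc.prems] c rep_stutter rep_follows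
      by (meson rtranclp.rtrancl_into_rtrancl)
  qed
  then obtain c where c: "(tm_step M)\<^sup>*\<^sup>* (initial_config x) c" "rep o' (N - 1) c"
    using N by (metis diff_Suc_1 lessI)
  obtain q T hd where qTh: "c = (q, T, hd)" by (metis surj_pair)
  have fin: "R (St 1) (N - 1) o'" "\<And>rs \<delta>. ((1, rs), \<delta>) \<in> trans M \<Longrightarrow>
      \<exists>j<k. \<exists>p<N. R (Hd j) (N - 1) p \<and> \<not> R (Sym j (rs ! j)) (N - 1) p"
  proof -
    have "N - 1 < N" "Suc (N - 1) = N" using b by auto
    then have *: "R (St 1) (N - 1) o' \<and> (\<forall>((q, rs), _) \<in> trans M. q = 1 \<longrightarrow>
        (\<exists>j<k. \<exists>p<N. R (Hd j) (N - 1) p \<and> \<not> R (Sym j (rs ! j)) (N - 1) p))"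
      using ok(4) unfolding final_ok_def by blast
    then show "R (St 1) (N - 1) o'" by blast
    show "\<exists>j<k. \<exists>p<N. R (Hd j) (N - 1) p \<and> \<not> R (Sym j (rs ! j)) (N - 1) p"
      if "((1, rs), \<delta>) \<in> trans M" for rs \<delta> using * that by auto
  qed
  have q: "q = 1" using c(2) fin(1) qs0 by (auto simp: rep_def qTh)
  have "\<not> tm_step M c c'" for c'
  proof
    assume "tm_step M c c'"
    then obtain \<delta> where d: "((1, map (\<lambda>j. T j (hd j)) [0..<k]), \<delta>) \<in> trans M"
      unfolding qTh q by cases blast
    then obtain j p where j: "j < k" "p < N" "R (Hd j) (N - 1) p"
      "\<not> R (Sym j (T j (hd j))) (N - 1) p"
      using fin(2) by fastforce
    \<comment> \<open>\<open>rep\<close> is silent on symbols outside \<open>ss\<close>; this one is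
      read by a transition and so belongs to \<open>ss\<close>.\<close>
    have "T j (hd j) \<in> set ss" using d ss j(1) by (cases \<delta>) fastforce
    then show False using c(2) j unfolding qTh rep_def by auto
  qed
  then show ?thesis unfolding accepts_def using c(1) q qTh by auto
qed

end

lemma head_bound:
  assumes "(tm_step M ^^ n) (initial_config x) (q, T, h)"
  shows "\<bar>h j\<bar> \<le> int n"
  using assms
proof (induction n arbitrary: q T h)
  case 0
  then show ?case by (auto simp: initial_config_def)
next
  case (Suc n)
  then obtain c where c: "(tm_step M ^^ n) (initial_config x) c" "tm_step M c (q, T, h)" by auto
  from c(2) show ?case
  proof cases
    case (1 q0 T0 h0 ws ds)
    have "\<bar>h0 j\<bar> \<le> int n" using Suc.IH c(1) 1 by blast
    moreover have "j < k \<Longrightarrow> ds ! j \<in> {-1, 0, 1}" using trans_moves 1 by blast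
    ultimately show ?thesis using 1 by auto
  qed
qed

text \<open>The run fills the first rows, and its last configuration is repeated in the others. With
  origin \<open>T\<close> the heads, which get at most \<open>T\<close> cells away from it, stay in
  columns 0 to \<open>2 * T\<close>.\<close>

lemma tableau_complete:
  assumes acc: "accepts M x" and halts: "halts_within M x T"
    and N: "N = Suc (bits_value x (1 + 2 ^ h))" and h: "0 < h"
    and large: "2 * T + 2 \<le> N" "7 \<le> N"
  shows "\<exists>R. \<exists>o'<N. \<exists>e<N. \<exists>g<N. tableau_ok N R o' e g"
proof -
  obtain c where c: "(tm_step M)\<^sup>*\<^sup>* (initial_config x) c" "\<nexists>c'. tm_step M c c'" "fst c = 1"
    using acc unfolding accepts_def by blast
  obtain n where n: "(tm_step M ^^ n) (initial_config x) c"
    using c(1) by (meson rtranclp_power)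
  have nT: "n \<le> T" using halts n unfolding halts_within_def by blast
  obtain f where f: "f 0 = initial_config x" "f n = c" "\<forall>i<n. tm_step M (f i) (f (Suc i))"
    using n by (auto simp: relpowp_fun_conv)
  define cs where "cs t = f (min t n)" for t
  have cs_step: "cs (Suc t) = cs t \<or> tm_step M (cs t) (cs (Suc t))" for t
    using f(3) by (cases "t < n") (auto simp: cs_def min_def)
  have run: "(tm_step M ^^ i) (initial_config x) (f i)" if "i \<le> n" for i
    using that
  proof (induction i)
    case (Suc i)
    then show ?case using f(3) by (auto intro: relcomppI)
  qed (use f in simp)
  define R where "R r t p = (case r of
      Cnt \<Rightarrow> T \<le> p \<and> bit t (p - T)
    | St q \<Rightarrow> q = fst (cs t)
    | Hd j \<Rightarrow> int p = snd (snd (cs t)) j + int T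
    | Sym j s \<Rightarrow> fst (snd (cs t)) j (int p - int T) = s)" for r t p
  have rep: "rep N R T t (cs t)" for t
  proof -
    obtain q Tp hd where cst: "cs t = (q, Tp, hd)" by (metis surj_pair)
    have hd: "\<bar>hd j\<bar> \<le> int T" for j
      using head_bound[of "min t n" x q Tp hd j] run[of "min t n"] cst nT by (simp add: cs_def)
    have "2 * int T + 2 \<le> int N" using large(1) by linarith
    then have "0 \<le> hd j + int T \<and> hd j + int T < int N" for j using hd[of j] by linarith
    then show ?thesis by (auto simp: rep_def cst R_def)
  qed
  \<comment> \<open>\<open>T\<close> is less than half of \<open>N\<close>, so the columns to the
    right of the origin are at least half of \<open>N - 1\<close>. The bound 7 on \<open>N\<close>
    makes them at least 3, from where on \<open>2 * i < 2 ^ i\<close>.\<close>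
  have overflow: "N - 1 < 2 ^ (N - 1 - T)"
  proof -
    have *: "2 * i < 2 ^ i" if "3 \<le> i" for i :: nat
      using that by (induction i rule: nat_induct_at_least) auto
    have "N - 1 \<le> 2 * (N - 1 - T)" "3 \<le> N - 1 - T" using large by linarith+
    then show ?thesis using *[of "N - 1 - T"] by linarith
  qed
  have small: "i < N - 1 - T" if "bit t i" "t < N" for t i
  proof (rule ccontr)
    assume "\<not> ?thesis"
    then have "(2::nat) ^ (N - 1 - T) \<le> 2 ^ i" by (intro power_increasing) auto
    then have "t < 2 ^ i" using overflow that(2) by linarith
    then show False using that(1) by (simp add: bit_iff_odd)
  qed
  have bits: "bit (N - 1) i \<longleftrightarrow> (if i < length x then x ! i else i = length x \<or> i = length x + h)" for i
    by (auto simp: N bit_bits_value bit_Suc_exp_iff[OF h, simplified])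
  let ?e = "T + length x" and ?g = "T + length x + h"
  have eg: "?e < N" "?g < N"
    using small[of "N - 1" "length x"] small[of "N - 1" "length x + h"] bits N by auto
  have "counter_ok N R T"
    unfolding counter_ok_def
  proof (intro conjI allI impI)
    fix t p assume "t < N" "t = 0" "p < N" then show "\<not> R Cnt t p" by (simp add: R_def)
  next
    fix t t' p assume *: "t < N" "t' < N" "t' = Suc t" "p < N"
    have "(\<forall>p'<N. T \<le> p' \<and> p' < p \<longrightarrow> R Cnt t p') \<longleftrightarrow> (\<forall>j<p - T. bit t j)"
    proof (intro iffI allI impI)
      fix j assume a: "\<forall>p'<N. T \<le> p' \<and> p' < p \<longrightarrow> R Cnt t p'" "j < p - T"
      then have "R Cnt t (T + j)" using * by auto
      then show "bit t j" by (simp add: R_def)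
    qed (auto simp: R_def)
    then show "R Cnt t' p \<longleftrightarrow>
        T \<le> p \<and> \<not> (R Cnt t p \<longleftrightarrow> (\<forall>p'<N. T \<le> p' \<and> p' < p \<longrightarrow> R Cnt t p'))"
      by (auto simp: R_def * bit_Suc_iff)
  next
    fix t p assume *: "t < N" "p < N" "R Cnt t p"
    then have "p - T < N - 1 - T" using small[of t "p - T"] by (simp add: R_def)
    then show "\<exists>p'<N. p < p'" by (intro exI[of _ "N - 1"]) linarith
  qed
  moreover have "decode_ok N R T ?e ?g"
    unfolding decode_ok_def using h N bits[unfolded N] by (auto simp: R_def split: if_splits)
  moreover have "init_ok N R T ?e"
    unfolding init_ok_def
  proof (intro allI impI conjI ballI)
    fix t l p j s :: nat assume "l < N" "t = 0 \<and> Suc l = N" "p < N" "j < k" "s \<in> set ss"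
    then have l: "l = N - 1" "t = 0" "p < N" by auto
    have "bit (N - 1) (p - T) \<longleftrightarrow> x ! (p - T)" if "T \<le> p" "p < ?e"
      using that bits by auto
    moreover have "nat (int p - int T) = p - T" by simp
    ultimately show "R (Sym j s) t p \<longleftrightarrow> s = init_sym R T ?e l j p"
      unfolding l
      by (auto simp: init_sym_def R_def cs_def f initial_config_def input_tape_def bit_symbol_def)
  qed (auto simp: R_def cs_def f initial_config_def)
  moreover have "stutter N R T t (Suc t) \<or> (\<exists>\<delta>\<in>trans M. follows N R T t (Suc t) \<delta>)" for t
    using cs_step[of t] stutter_rep[of N R T t "cs t"] follows_rep[of "cs t" _ N R T t] rep
    by metis
  moreover have "final_ok N R T"
    unfolding final_ok_def
  proof (intro allI impI conjI)
    fix t assume t: "t < N" "Suc t = N"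
    have ct: "cs t = c" using nT large t f by (simp add: cs_def min_def)
    then show "R (St 1) t T" using c(3) by (simp add: R_def)
    obtain Tp hd where cst: "c = (1, Tp, hd)" using c(3) by (metis prod.collapse)
    have "\<exists>j<k. \<exists>p<N. R (Hd j) t p \<and> \<not> R (Sym j (rs ! j)) t p"
      if d: "((1, rs), (q', ws, ds)) \<in> trans M" for rs q' ws ds
    proof -
      have "rs \<noteq> map (\<lambda>j. Tp j (hd j)) [0..<k]"
        using c(2) d cst tm_step.intros[of 1 Tp hd M q' ws ds] by metis
      then obtain j where j: "j < k" "rs ! j \<noteq> Tp j (hd j)"
        using trans_lengths[OF d] by (auto simp: list_eq_iff_nth_eq)
      have "0 \<le> hd j + int T" "hd j + int T < int N"
        using rep[of t] j(1) unfolding ct cst rep_def by auto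
      then have "nat (hd j + int T) < N \<and> R (Hd j) t (nat (hd j + int T)) \<and>
          \<not> R (Sym j (rs ! j)) t (nat (hd j + int T))"
        using j by (auto simp: R_def ct cst)
      then show ?thesis using j(1) by blast
    qed
    then show "\<forall>((q, rs), _)\<in>trans M. q = 1 \<longrightarrow>
        (\<exists>j<k. \<exists>p<N. R (Hd j) t p \<and> \<not> R (Sym j (rs ! j)) t p)" by fastforce
  qed
  ultimately have "tableau_ok N R T ?e ?g" unfolding tableau_ok_def by blast
  moreover have "T < N" using large(1) by linarith
  ultimately show ?thesis using eg by blast
qed

theorem accepts_iff_grid_sat:
  assumes "halts_within M x T" "N = Suc (bits_value x (1 + 2 ^ h))" "0 < h" "2 * T + 2 \<le> N" "7 \<le> N"
  shows "accepts M x \<longleftrightarrow> (\<exists>R. grid_sat N R accept_fm a b)"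
  unfolding grid_sat_accept_fm
  using tableau_sound[OF _ _ _ _ assms(2,3)] tableau_complete[OF _ assms] by blast

end

lemma tableau_exists:
  assumes "turing_machine M"
  obtains ts qs ss where "tableau M ts qs ss"
proof -
  have fin: "finite (trans M)" using assms by (simp add: turing_machine_def)
  then obtain ts where ts: "set ts = trans M" using finite_list by blast
  have "finite ({0, 1} \<union> (\<lambda>\<delta>. fst (fst \<delta>)) ` trans M \<union> (\<lambda>\<delta>. fst (snd \<delta>)) ` trans M)"
    using fin by simp
  from finite_list[OF this] obtain qs where
    qs: "set qs = {0, 1} \<union> (\<lambda>\<delta>. fst (fst \<delta>)) ` trans M \<union> (\<lambda>\<delta>. fst (snd \<delta>)) ` trans M"
    ..
  have "finite ({0, 1, 2} \<union> (\<Union>\<delta>\<in>trans M. set (snd (fst \<delta>)) \<union> set (fst (snd (snd \<delta>)))))"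
    using fin by simp
  from finite_list[OF this] obtain ss where
    ss: "set ss = {0, 1, 2} \<union> (\<Union>\<delta>\<in>trans M. set (snd (fst \<delta>)) \<union> set (fst (snd (snd \<delta>))))"
    ..
  have "tableau M ts qs ss"
    by unfold_locales (use assms in \<open>force simp: ts qs ss\<close>)+
  then show thesis using that by blast
qed


section \<open>Reconfiguration on balanced complete bipartite graphs\<close>

text \<open>Taking the parities as sides makes the adjacency matrix alternate between two periodic
  rows, which a program can write with unary counters.\<close>

definition bipartite_graph :: "nat \<Rightarrow> nat ugraph" where
  "bipartite_graph N = \<lparr>verts = {..<2 * N},
     edges = {{i, j} |i j. i < 2 * N \<and> j < 2 * N \<and> odd (i + j)}\<rparr>"

lemma verts_bipartite_graph [simp]: "verts (bipartite_graph N) = {..<2 * N}"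
  by (simp add: bipartite_graph_def)

lemma edge_bipartite_graph:
  "{i, j} \<in> edges (bipartite_graph N) \<longleftrightarrow> i < 2 * N \<and> j < 2 * N \<and> odd (i + j)"
proof -
  have "odd (i + j) \<longleftrightarrow> odd (j + i)" by (simp add: add.commute)
  then show ?thesis by (auto simp: bipartite_graph_def doubleton_eq_iff)
qed

lemma simple_bipartite_graph: "simple_graph (bipartite_graph N)"
  unfolding simple_graph_def
proof (intro conjI ballI)
  fix u assume "u \<in> edges (bipartite_graph N)"
  then obtain i j where "u = {i, j}" "i < 2 * N" "j < 2 * N" "odd (i + j)"
    by (auto simp: bipartite_graph_def)
  moreover from this have "i \<noteq> j" by auto
  ultimately show "\<exists>i\<in>verts (bipartite_graph N). \<exists>j\<in>verts (bipartite_graph N). i \<noteq> j \<and> u = {i, j}"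
    by auto
qed simp

lemma grid_enum_bipartite_graph: "grid_enum (bipartite_graph N) N (\<lambda>i. 2 * i) (\<lambda>i. 2 * i + 1)"
proof
  show "(\<lambda>i. 2 * i) ` {..<N} \<inter> (\<lambda>i. 2 * i + 1) ` {..<N} = {}" by auto presburger
  have "i \<in> (\<lambda>i. 2 * i) ` {..<N} \<union> (\<lambda>i. 2 * i + 1) ` {..<N}" if "i < 2 * N" for i
    using that by (cases "even i") (auto elim!: evenE oddE)
  then show "verts (bipartite_graph N) = (\<lambda>i. 2 * i) ` {..<N} \<union> (\<lambda>i. 2 * i + 1) ` {..<N}"
    by auto
  show "edges (bipartite_graph N) = {{2 * i, 2 * j + 1} |i j. i < N \<and> j < N}" (is "_ = ?E")
  proof
    show "edges (bipartite_graph N) \<subseteq> ?E"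
    proof
      fix u assume "u \<in> edges (bipartite_graph N)"
      then obtain i j where u: "u = {i, j}" "i < 2 * N" "j < 2 * N" "odd (i + j)"
        by (auto simp: bipartite_graph_def)
      show "u \<in> ?E"
      proof (cases "even i")
        case True
        then obtain i' j' where "i = 2 * i'" "j = 2 * j' + 1" using u(4) by (auto elim!: evenE oddE)
        then have "u = {2 * i', 2 * j' + 1}" "i' < N" "j' < N" using u by auto
        then show ?thesis by blast
      next
        case False
        then obtain i' j' where "j = 2 * i'" "i = 2 * j' + 1" using u(4) by (auto elim!: evenE oddE)
        then have "u = {2 * i', 2 * j' + 1}" "i' < N" "j' < N" using u by auto
        then show ?thesis by blast
      qed
    qed
    show "?E \<subseteq> edges (bipartite_graph N)" by (auto simp: edge_bipartite_graph)
  qed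
qed (auto simp: inj_on_def)

lemma neighborhood_diversity_bipartite_graph:
  assumes "2 \<le> N"
  shows "neighborhood_diversity (bipartite_graph N) = 2"
proof -
  let ?G = "bipartite_graph N"
  define A where "A = {i. i < 2 * N \<and> even i}"
  define B where "B = {i. i < 2 * N \<and> odd i}"
  have nb: "nbhd ?G v = (if even v then B else A)" if "v < 2 * N" for v
    using that by (auto simp: nbhd_def edge_bipartite_graph A_def B_def)
  have mem: "0 \<in> A" "2 \<in> A" "1 \<in> B" "0 \<notin> B" "1 \<notin> A" "2 \<notin> B"
    using assms by (auto simp: A_def B_def)
  \<comment> \<open>These are closed neighbourhoods of vertices on different sides. One inserted
    vertex cannot supply both 0 and 2; with a single vertex per side the two sets would
    agree.\<close>
  have ne: "insert u A \<noteq> insert v B" for u v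
  proof
    assume "insert u A = insert v B"
    then have "0 \<in> insert v B" "2 \<in> insert v B" using mem by blast+
    then show False using mem by simp
  qed
  have AB: "A \<noteq> B" using mem by blast
  have tw: "twins ?G u v \<longleftrightarrow> (even u \<longleftrightarrow> even v)" if "u < 2 * N" "v < 2 * N" for u v
    unfolding twins_def closed_nbhd_def nb[OF that(1)] nb[OF that(2)]
    by (cases "even u"; cases "even v") (simp_all add: AB AB[symmetric] ne ne[symmetric])
  have ts: "twin_set ?G C \<longleftrightarrow> C \<noteq> {} \<and> (C \<subseteq> A \<or> C \<subseteq> B)" for C
  proof
    assume C: "twin_set ?G C"
    then obtain w where w: "w \<in> C" by (auto simp: twin_set_def)
    have lt: "u < 2 * N" if "u \<in> C" for u using C that by (auto simp: twin_set_def)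
    have "even u \<longleftrightarrow> even w" if "u \<in> C" for u
      using C that w tw[OF lt[OF that] lt[OF w]] unfolding twin_set_def by simp
    then show "C \<noteq> {} \<and> (C \<subseteq> A \<or> C \<subseteq> B)" using w lt by (auto simp: A_def B_def)
  next
    assume "C \<noteq> {} \<and> (C \<subseteq> A \<or> C \<subseteq> B)"
    then show "twin_set ?G C" by (auto simp: twin_set_def subset_iff tw A_def B_def)
  qed
  have max: "C \<noteq> {} \<and> (C \<subseteq> A \<or> C \<subseteq> B) \<and> (\<forall>D. (D \<noteq> {} \<and> (D \<subseteq> A \<or> D \<subseteq> B)) \<and> C \<subseteq> D \<longrightarrow> D = C)
      \<longleftrightarrow> C = A \<or> C = B" for C
    using mem by blast
  have "{C. twin_set ?G C \<and> (\<forall>D. twin_set ?G D \<and> C \<subseteq> D \<longrightarrow> D = C)} = {A, B}"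
    by (rule set_eqI)
      (simp only: mem_Collect_eq insert_iff empty_iff ts conj_assoc simp_thms max[unfolded conj_assoc])
  then show ?thesis unfolding neighborhood_diversity_def using AB by simp
qed

text \<open>The second disjunct keeps both ends legal when \<open>\<psi>\<close> fails, as an
  instance must satisfy the formula at its ends in any case.\<close>

definition reconf_fm :: "fm \<Rightarrow> fm" where
  "reconf_fm \<psi> = Disj \<psi>
     (AllV 0 (AllV 1 (Imp (Conj (InVS 0 0) (InVS 1 0)) (Neg (Adj 0 1)))))"

lemma fv_reconf_fm: "fv \<psi> = {} \<Longrightarrow> fv (reconf_fm \<psi>) = {VSVar 0}"
  by (auto simp: reconf_fm_def)

lemma models_reconf_fm:
  assumes "\<And>v vs e es. sat (bipartite_graph N) \<psi> v vs e es \<longleftrightarrow> P" and "X \<subseteq> {..<2 * N}"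
  shows "models (bipartite_graph N) (reconf_fm \<psi>) X \<longleftrightarrow> P \<or> (\<forall>u\<in>X. \<forall>v\<in>X. even u \<longleftrightarrow> even v)"
  using assms(2) unfolding models_def reconf_fm_def
  by (auto simp: assms(1) edge_bipartite_graph subset_iff)

text \<open>A token has to change sides, and right after the first such jump the set is not independent.\<close>

lemma MSOR2_bipartite_graph:
  assumes N: "2 \<le> N" and fv: "fv \<psi> = {}"
    and P: "\<And>v vs e es. sat (bipartite_graph N) \<psi> v vs e es \<longleftrightarrow> P"
  shows "MSOR2_instance (reconf_fm \<psi>) (bipartite_graph N) {0, 2} {1, 3}"
    and "MSOR2_yes (reconf_fm \<psi>) (bipartite_graph N) {0, 2} {1, 3} \<longleftrightarrow> P"
proof -
  note models = models_reconf_fm[OF P]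
  have sub: "{0, 2} \<subseteq> {..<2 * N}" "{1, 3} \<subseteq> {..<2 * N}" "{0, 1} \<subseteq> {..<2 * N}" using N by auto
  show "MSOR2_instance (reconf_fm \<psi>) (bipartite_graph N) {0, 2} {1, 3}"
    unfolding MSOR2_instance_def using N
    by (auto simp: fv_reconf_fm[OF fv] simple_bipartite_graph models)
  show "MSOR2_yes (reconf_fm \<psi>) (bipartite_graph N) {0, 2} {1, 3} \<longleftrightarrow> P"
  proof
    assume "P"
    \<comment> \<open>The middle set has a token on either side; it is legal because
      \<open>P\<close> makes every set legal.\<close>
    let ?S = "\<lambda>i::nat. if i = 0 then {0, 2} else if i = 1 then {0, 1} else {1, 3 :: nat}"
    have "?S i \<subseteq> {..<2 * N}" for i using sub by auto
    then have "TJ_sequence (bipartite_graph N) (reconf_fm \<psi>) 2 ?S"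
      unfolding TJ_sequence_def using models \<open>P\<close>
      by (auto simp: numeral_2_eq_2 le_Suc_eq insert_Diff_if)
    then show "MSOR2_yes (reconf_fm \<psi>) (bipartite_graph N) {0, 2} {1, 3}"
      unfolding MSOR2_yes_def by (intro exI[of _ 2] exI[of _ ?S]) auto
  next
    assume "MSOR2_yes (reconf_fm \<psi>) (bipartite_graph N) {0, 2} {1, 3}"
    then obtain l Sq where TJ: "TJ_sequence (bipartite_graph N) (reconf_fm \<psi>) l Sq"
      and ends: "Sq 0 = {0, 2}" "Sq l = {1, 3}"
      unfolding MSOR2_yes_def by blast
    show P
    proof (rule ccontr)
      assume "\<not> P"
      \<comment> \<open>One of the two tokens stays in place, and without \<open>P\<close> the set
        must be independent, so the moved token has the parity of the one that stays.\<close>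
      have inv: "i \<le> l \<Longrightarrow> card (Sq i) = 2 \<and> (\<forall>u\<in>Sq i. even u)" for i
      proof (induction i)
        case 0
        then show ?case by (simp add: ends)
      next
        case (Suc i)
        then have IH: "card (Sq i) = 2" "\<forall>u\<in>Sq i. even u" by auto
        have fin: "finite (Sq i)" "finite (Sq (Suc i))"
          using IH(1) TJ Suc.prems unfolding TJ_sequence_def
          by (auto intro: card_ge_0_finite finite_subset[of _ "{..<2 * N}"])
        have "Suc i \<in> {1..l}" using Suc.prems by simp
        with TJ have "card (Sq (Suc i - 1) - Sq (Suc i)) = 1 \<and> card (Sq (Suc i) - Sq (Suc i - 1)) = 1"
          unfolding TJ_sequence_def by blast
        then have d: "card (Sq i - Sq (Suc i)) = 1" "card (Sq (Suc i) - Sq i) = 1" by simp_all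
        have split: "card A = card (A - B) + card (A \<inter> B)" if "finite A" for A B :: "nat set"
          using that by (metis card_Diff_subset_Int card_mono finite_Int inf_le1 le_add_diff_inverse2)
        have i1: "card (Sq i \<inter> Sq (Suc i)) = 1" using split[OF fin(1), of "Sq (Suc i)"] d IH by linarith
        then have "card (Sq (Suc i)) = 2"
          using split[OF fin(2), of "Sq i"] d by (simp add: Int_commute)
        moreover obtain w where w: "w \<in> Sq i" "w \<in> Sq (Suc i)" using i1 by (auto simp: card_1_singleton_iff)
        moreover have "even u \<longleftrightarrow> even w" if "u \<in> Sq (Suc i)" for u
        proof -
          have "Sq (Suc i) \<subseteq> {..<2 * N}" "models (bipartite_graph N) (reconf_fm \<psi>) (Sq (Suc i))"
            using TJ Suc.prems unfolding TJ_sequence_def by auto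
          then show ?thesis using models[of "Sq (Suc i)"] \<open>\<not> P\<close> that w by blast
        qed
        ultimately show ?case using IH(2) by blast
      qed
      show False using inv[of l] ends by simp
    qed
  qed
qed


section \<open>Structured programs as a preprocessing phase of a Turing machine\<close>

text \<open>Programs work on four tapes, each of which always holds a bit string in cells
  \<open>0, 1, \<dots>\<close>; bits are only appended. \<open>While j\<close> loops while the cell scanned on tape \<open>j\<close> is not
  blank.\<close>

datatype prog =
    Write nat bool
  | MoveL nat
  | MoveR nat
  | Skip
  | Seq prog prog
  | While nat prog
  | IfOne nat prog prog

instance prog :: countable
  by countable_datatype

type_synonym bit_tapes = "nat \<Rightarrow> bool list \<times> int"

definition on_bit :: "bit_tapes \<Rightarrow> nat \<Rightarrow> bool" where
  "on_bit f j \<longleftrightarrow> 0 \<le> snd (f j) \<and> snd (f j) < int (length (fst (f j)))"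

text \<open>The count is the exact number of machine steps: every construct pays one step for its
  own change of the stack. \<open>Write\<close> is possible only right behind the string.\<close>

inductive exec :: "prog \<Rightarrow> bit_tapes \<Rightarrow> nat \<Rightarrow> bit_tapes \<Rightarrow> bool" where
  exec_Write: "j < 4 \<Longrightarrow> f j = (ys, int (length ys)) \<Longrightarrow>
     exec (Write j b) f 1 (f(j := (ys @ [b], int (length ys) + 1)))"
| exec_MoveL: "j < 4 \<Longrightarrow> exec (MoveL j) f 1 (f(j := (fst (f j), snd (f j) - 1)))"
| exec_MoveR: "j < 4 \<Longrightarrow> exec (MoveR j) f 1 (f(j := (fst (f j), snd (f j) + 1)))"
| exec_Skip: "exec Skip f 1 f"
| exec_Seq: "exec p f s g \<Longrightarrow> exec q g t h \<Longrightarrow> exec (Seq p q) f (Suc (s + t)) h"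
| exec_While_False: "j < 4 \<Longrightarrow> \<not> on_bit f j \<Longrightarrow> exec (While j p) f 1 f"
| exec_While_True: "j < 4 \<Longrightarrow> on_bit f j \<Longrightarrow> exec p f s g \<Longrightarrow> exec (While j p) g t h \<Longrightarrow>
     exec (While j p) f (Suc (s + t)) h"
| exec_IfOne_True: "j < 4 \<Longrightarrow> on_bit f j \<and> fst (f j) ! nat (snd (f j)) \<Longrightarrow> exec p f s g \<Longrightarrow>
     exec (IfOne j p q) f (Suc s) g"
| exec_IfOne_False: "j < 4 \<Longrightarrow> \<not> (on_bit f j \<and> fst (f j) ! nat (snd (f j))) \<Longrightarrow> exec q f s g \<Longrightarrow>
     exec (IfOne j p q) f (Suc s) g"

text \<open>A program is compiled to a machine whose states are the stacks of programs still to be run.\<close>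

fun stack_step :: "nat \<Rightarrow> prog list \<Rightarrow> nat list \<Rightarrow> prog list \<times> nat list \<times> int list" where
  "stack_step K (Write j b # ks) r = (ks, r[j := bit_symbol b], (replicate K 0)[j := 1])"
| "stack_step K (MoveL j # ks) r = (ks, r, (replicate K 0)[j := -1])"
| "stack_step K (MoveR j # ks) r = (ks, r, (replicate K 0)[j := 1])"
| "stack_step K (Skip # ks) r = (ks, r, replicate K 0)"
| "stack_step K (Seq p q # ks) r = (p # q # ks, r, replicate K 0)"
| "stack_step K (While j p # ks) r = (if r ! j \<noteq> 0 then p # While j p # ks else ks, r, replicate K 0)"
| "stack_step K (IfOne j p q # ks) r = ((if r ! j = 2 then p else q) # ks, r, replicate K 0)"
| "stack_step K [] r = ([], r, replicate K 0)"

text \<open>The stacks met while \<open>p\<close> runs on top of \<open>ks\<close>. A loop puts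
  itself back under its body, so unfolding it creates no new stacks and the set of states is
  finite.\<close>

primrec stacks :: "prog \<Rightarrow> prog list \<Rightarrow> prog list set" where
  "stacks (Write j b) ks = {Write j b # ks}"
| "stacks (MoveL j) ks = {MoveL j # ks}"
| "stacks (MoveR j) ks = {MoveR j # ks}"
| "stacks Skip ks = {Skip # ks}"
| "stacks (Seq p q) ks = {Seq p q # ks} \<union> stacks p (q # ks) \<union> stacks q ks"
| "stacks (While j p) ks = {While j p # ks} \<union> stacks p (While j p # ks)"
| "stacks (IfOne j p q) ks = {IfOne j p q # ks} \<union> stacks p ks \<union> stacks q ks"

lemma finite_stacks: "finite (stacks p ks)"
  by (induction p arbitrary: ks) auto

lemma stacks_self: "p # ks \<in> stacks p ks"
  by (cases p) auto

lemma length_stack_step: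
  "length r = K \<Longrightarrow> stack_step K s r = (s', ws, ds) \<Longrightarrow>
    length ws = K \<and> length ds = K \<and> set ds \<subseteq> {-1, 0, 1}"
  by (induction K s r rule: stack_step.induct)
    (auto dest!: subsetD[OF set_update_subset_insert])

locale preprocessed =
  fixes M :: tm and prg :: prog
  assumes tm: "turing_machine M" and det: "deterministic M"
begin

abbreviation "K \<equiv> num_tapes M + 3"

text \<open>Running out of programs means entering the start state of \<open>M\<close>, which is renumbered to 2.\<close>

definition main_state :: "nat \<Rightarrow> nat" where
  "main_state q = (if q = 1 then 1 else 2 * q + 2)"

definition pre_state :: "prog list \<Rightarrow> nat" where
  "pre_state s = (if s = [] then 2 else if s = [prg] then 0 else 2 * to_nat s + 3)"

lemma main_state_inj: "main_state q = main_state q' \<longleftrightarrow> q = q'"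
  unfolding main_state_def by (cases "q = 1"; cases "q' = 1") auto

lemma pre_state_inj: "s \<noteq> [] \<Longrightarrow> s' \<noteq> [] \<Longrightarrow> pre_state s = pre_state s' \<longleftrightarrow> s = s'"
  unfolding pre_state_def by auto

text \<open>By parity: a nonempty stack is numbered 0 or odd and at least 3, a state of
  \<open>M\<close> is numbered 1 or even and at least 2.\<close>

lemma pre_neq_main: "s \<noteq> [] \<Longrightarrow> pre_state s \<noteq> main_state q"
  unfolding pre_state_def main_state_def by (auto split: if_splits) presburger+

definition reads :: "nat \<Rightarrow> nat list set" where
  "reads n = {r. set r \<subseteq> {0, 1, 2} \<and> length r = n}"

definition pre_trans :: "transition set" where
  "pre_trans = (\<lambda>(s, r). case stack_step K s r of (s', ws, ds) \<Rightarrow>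
     ((pre_state s, r), (pre_state s', ws, ds))) ` (stacks prg [] \<times> reads K)"

text \<open>\<open>M\<close> works on the tapes from 3 on, with tape 3 as its input tape. The three
  work tapes of the program keep their leftovers, so each transition is repeated for every triple
  that may be scanned there and rewrites it unchanged.\<close>

definition main_trans :: "transition set" where
  "main_trans = (\<lambda>(((q, rs), (q', ws, ds)), r).
     ((main_state q, r @ rs), (main_state q', r @ ws, [0, 0, 0] @ ds))) ` (trans M \<times> reads 3)"

definition machine :: tm where
  "machine = \<lparr>num_tapes = K, trans = pre_trans \<union> main_trans\<rparr>"

lemma trans_lengths:
  assumes "((q, rs), (q', ws, ds)) \<in> trans M"
  shows "length rs = num_tapes M" "length ws = num_tapes M" "length ds = num_tapes M"
    "set ds \<subseteq> {-1, 0, 1}"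
  using tm assms unfolding turing_machine_def by fastforce+

lemma pre_transE:
  assumes "(x, y) \<in> pre_trans"
  obtains s r s' ws ds where "s \<in> stacks prg []" "r \<in> reads K" "stack_step K s r = (s', ws, ds)"
    "x = (pre_state s, r)" "y = (pre_state s', ws, ds)"
proof -
  obtain z where z: "z \<in> stacks prg [] \<times> reads K" "(x, y) = (case z of (s, r) \<Rightarrow>
      case stack_step K s r of (s', ws, ds) \<Rightarrow> ((pre_state s, r), (pre_state s', ws, ds)))"
    using assms unfolding pre_trans_def by blast
  obtain s r where sr: "z = (s, r)" by (cases z)
  obtain s' ws ds where step: "stack_step K s r = (s', ws, ds)" by (cases "stack_step K s r")
  show thesis by (rule that[OF _ _ step]) (use z in \<open>simp_all add: sr step\<close>)
qed

lemma stacks_nonempty: "s \<in> stacks p ks \<Longrightarrow> s \<noteq> []"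
  by (induction p arbitrary: ks) auto

lemma turing_machine_machine: "turing_machine machine"
proof -
  have "finite (reads n)" for n
    unfolding reads_def by (rule finite_lists_length_eq) simp
  then have fin: "finite pre_trans" "finite main_trans"
    using tm finite_stacks by (auto simp: pre_trans_def main_trans_def turing_machine_def)
  have p: "length rs = K \<and> length ws = K \<and> length ds = K \<and> set ds \<subseteq> {-1, 0, 1}"
    if pt: "((q, rs), (q', ws, ds)) \<in> pre_trans" for q rs q' ws ds
  proof -
    obtain s r s' vs es where *: "r \<in> reads K" "stack_step K s r = (s', vs, es)"
      "(q, rs) = (pre_state s, r)" "(q', ws, ds) = (pre_state s', vs, es)"
      using pt by (rule pre_transE) blast
    show ?thesis using length_stack_step[OF _ *(2)] * by (simp add: reads_def)
  qed
  have m: "length rs = K \<and> length ws = K \<and> length ds = K \<and> set ds \<subseteq> {-1, 0, 1}"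
    if mt: "((q, rs), (q', ws, ds)) \<in> main_trans" for q rs q' ws ds
  proof -
    obtain q0 rs0 q0' ws0 ds0 r where "((q0, rs0), (q0', ws0, ds0)) \<in> trans M" "r \<in> reads 3"
      "rs = r @ rs0" "ws = r @ ws0" "ds = [0, 0, 0] @ ds0"
      using mt by (auto simp: main_trans_def)
    then show ?thesis using trans_lengths[of q0 rs0 q0' ws0 ds0] by (auto simp: reads_def)
  qed
  have "\<forall>((q, rs), (q', ws, ds)) \<in> pre_trans \<union> main_trans.
      length rs = K \<and> length ws = K \<and> length ds = K \<and> set ds \<subseteq> {-1, 0, 1}"
  proof
    fix \<delta> assume \<delta>: "\<delta> \<in> pre_trans \<union> main_trans"
    obtain q rs q' ws ds where "\<delta> = ((q, rs), (q', ws, ds))" by (metis surj_pair)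
    then show "case \<delta> of (x, y) \<Rightarrow> (case x of (q, rs) \<Rightarrow> \<lambda>(q', ws, ds).
        length rs = K \<and> length ws = K \<and> length ds = K \<and> set ds \<subseteq> {-1, 0, 1}) y"
      using \<delta> p[of q rs q' ws ds] m[of q rs q' ws ds] by (simp only: prod.case) blast
  qed
  then show ?thesis
    unfolding turing_machine_def machine_def tm.simps using fin by simp
qed

lemma deterministic_machine: "deterministic machine"
proof -
  have PP: "y = z" if xy: "(x, y) \<in> pre_trans" and xz: "(x, z) \<in> pre_trans" for x y z
  proof -
    obtain s r s1 ws ds where 1: "s \<in> stacks prg []" "stack_step K s r = (s1, ws, ds)"
      "x = (pre_state s, r)" "y = (pre_state s1, ws, ds)"
      using xy by (rule pre_transE) blast
    obtain s' r' s2 ws' ds' where 2: "s' \<in> stacks prg []" "stack_step K s' r' = (s2, ws', ds')"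
      "x = (pre_state s', r')" "z = (pre_state s2, ws', ds')"
      using xz by (rule pre_transE) blast
    have "pre_state s = pre_state s'" "r = r'" using 1(3) 2(3) by simp_all
    moreover from this have "s = s'"
      using pre_state_inj[OF stacks_nonempty[OF 1(1)] stacks_nonempty[OF 2(1)]] by simp
    ultimately show ?thesis using 1(2,4) 2(2,4) by simp
  qed
  have MM: "y = z" if xy: "(x, y) \<in> main_trans" and xz: "(x, z) \<in> main_trans" for x y z
  proof -
    obtain q rs q' ws ds r where 1: "((q, rs), (q', ws, ds)) \<in> trans M" "r \<in> reads 3"
      "x = (main_state q, r @ rs)" "y = (main_state q', r @ ws, [0, 0, 0] @ ds)"
      using xy by (auto simp: main_trans_def)
    obtain p us p' vs es u where 2: "((p, us), (p', vs, es)) \<in> trans M" "u \<in> reads 3"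
      "x = (main_state p, u @ us)" "z = (main_state p', u @ vs, [0, 0, 0] @ es)"
      using xz by (auto simp: main_trans_def)
    have "q = p" "r = u" "rs = us" using 1 2 by (auto simp: main_state_inj reads_def)
    moreover from this have "(q', ws, ds) = (p', vs, es)"
      using det 1(1) 2(1) unfolding deterministic_def by (blast dest: single_valuedD)
    ultimately show ?thesis using 1 2 by simp
  qed
  have PM: False if xy: "(x, y) \<in> pre_trans" and xz: "(x, z) \<in> main_trans" for x y z
  proof -
    obtain s r where "s \<in> stacks prg []" "x = (pre_state s, r)" using xy by (rule pre_transE) blast
    moreover obtain q rs where "x = (main_state q, rs)" using xz by (auto simp: main_trans_def)
    ultimately show ?thesis using pre_neq_main stacks_nonempty by blast
  qed
  show ?thesis
    unfolding deterministic_def machine_def tm.simps single_valued_def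
    by (intro allI impI, elim UnE) (rule PP MM, assumption+ | rule FalseE, rule PM, assumption+)+
qed

section \<open>Simulation of the program\<close>

definition pre_config :: "prog list \<Rightarrow> bit_tapes \<Rightarrow> config" where
  "pre_config s f = (pre_state s, (\<lambda>j. input_tape (fst (f j))), (\<lambda>j. snd (f j)))"

lemma input_tape_symbol: "input_tape ys i \<in> {0, 1, 2}"
  by (auto simp: input_tape_def bit_symbol_def)

lemma input_tape_append:
  "(input_tape ys)(int (length ys) := bit_symbol b) = input_tape (ys @ [b])"
  by (auto simp: input_tape_def nth_append fun_eq_iff)

lemma pre_step:
  assumes "s \<in> stacks prg []"
    and step: "stack_step K s (map (\<lambda>j. input_tape (fst (f j)) (snd (f j))) [0..<K]) = (s', ws, ds)"
    and tapes: "\<And>j. j < K \<Longrightarrow> (input_tape (fst (f j)))(snd (f j) := ws ! j) = input_tape (fst (g j))"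
    and heads: "\<And>j. j < K \<Longrightarrow> snd (g j) = snd (f j) + ds ! j"
    and rest: "\<And>j. j \<ge> K \<Longrightarrow> g j = f j"
  shows "tm_step machine (pre_config s f) (pre_config s' g)"
proof -
  let ?r = "map (\<lambda>j. input_tape (fst (f j)) (snd (f j))) [0..<K]"
  have "set ?r \<subseteq> {0, 1, 2}" unfolding set_map image_subset_iff using input_tape_symbol by blast
  then have "?r \<in> reads K" unfolding reads_def by simp
  then have "((pre_state s, ?r), (pre_state s', ws, ds)) \<in> pre_trans"
    unfolding pre_trans_def using assms(1) step by (intro image_eqI[of _ _ "(s, ?r)"]) auto
  then have "((pre_state s, map (\<lambda>j. input_tape (fst (f j)) (snd (f j))) [0..<num_tapes machine]),
      (pre_state s', ws, ds)) \<in> trans machine"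
    by (simp add: machine_def)
  from tm_step.intros[where T = "\<lambda>j. input_tape (fst (f j))" and h = "\<lambda>j. snd (f j)", OF this]
  have "tm_step machine (pre_config s f) (pre_state s',
      (\<lambda>j. if j < K then (input_tape (fst (f j)))(snd (f j) := ws ! j) else input_tape (fst (f j))),
      (\<lambda>j. if j < K then snd (f j) + ds ! j else snd (f j)))"
    by (simp add: pre_config_def machine_def)
  also have "(\<lambda>j. if j < K then (input_tape (fst (f j)))(snd (f j) := ws ! j)
      else input_tape (fst (f j))) = (\<lambda>j. input_tape (fst (g j)))"
    using tapes rest by (intro ext) simp
  also have "(\<lambda>j. if j < K then snd (f j) + ds ! j else snd (f j)) = (\<lambda>j. snd (g j))"
    using heads rest by (intro ext) simp
  finally show ?thesis unfolding pre_config_def .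
qed

lemma K_ge: "4 \<le> K" using tm by (simp add: turing_machine_def)

lemma pre_step_idle:
  assumes "s \<in> stacks prg []"
    and "stack_step K s (map (\<lambda>j. input_tape (fst (f j)) (snd (f j))) [0..<K]) =
      (s', map (\<lambda>j. input_tape (fst (f j)) (snd (f j))) [0..<K], replicate K 0)"
  shows "tm_step machine (pre_config s f) (pre_config s' f)"
  by (rule pre_step[OF assms]) auto

lemma on_bit_iff: "on_bit f j \<longleftrightarrow> input_tape (fst (f j)) (snd (f j)) \<noteq> 0"
  by (auto simp: on_bit_def input_tape_def bit_symbol_def)

lemma one_bit_iff: "on_bit f j \<and> fst (f j) ! nat (snd (f j)) \<longleftrightarrow>
    input_tape (fst (f j)) (snd (f j)) = 2"
  by (auto simp: on_bit_def input_tape_def bit_symbol_def)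

lemma steps_append:
  "tm_step machine c c1 \<Longrightarrow> (tm_step machine ^^ s) c1 c2 \<Longrightarrow> (tm_step machine ^^ t) c2 c3 \<Longrightarrow>
    (tm_step machine ^^ Suc (s + t)) c c3"
  by (rule relpowp_Suc_I2, assumption, subst relpowp_add, rule relcomppI)

text \<open>The rest \<open>ks\<close> of the stack is arbitrary, since \<open>Seq\<close> and
  \<open>While\<close> run their parts on a larger stack. The conditions on stacks ensure that every
  stack met has its transitions in the machine.\<close>

lemma exec_steps:
  assumes "exec p f t g" "stacks p ks \<subseteq> stacks prg []"
    and "ks \<noteq> [] \<Longrightarrow> ks \<in> stacks prg []"
  shows "(tm_step machine ^^ t) (pre_config (p # ks) f) (pre_config ks g)"
  using assms
proof (induction arbitrary: ks rule: exec.induct)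
  case (exec_Write j f ys b)
  have "tm_step machine (pre_config (Write j b # ks) f)
      (pre_config ks (f(j := (ys @ [b], int (length ys) + 1))))"
    by (rule pre_step)
      (use exec_Write K_ge in \<open>auto simp: nth_list_update input_tape_append\<close>)
  then show ?case by (simp only: relpowp_1)
next
  case (exec_MoveL j f)
  have "tm_step machine (pre_config (MoveL j # ks) f)
      (pre_config ks (f(j := (fst (f j), snd (f j) - 1))))"
    by (rule pre_step) (use exec_MoveL K_ge in \<open>auto simp: nth_list_update\<close>)
  then show ?case by (simp only: relpowp_1)
next
  case (exec_MoveR j f)
  have "tm_step machine (pre_config (MoveR j # ks) f)
      (pre_config ks (f(j := (fst (f j), snd (f j) + 1))))"
    by (rule pre_step) (use exec_MoveR K_ge in \<open>auto simp: nth_list_update\<close>)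
  then show ?case by (simp only: relpowp_1)
next
  case (exec_Skip f)
  have "tm_step machine (pre_config (Skip # ks) f) (pre_config ks f)"
    by (rule pre_step_idle) (use exec_Skip in auto)
  then show ?case by (simp only: relpowp_1)
next
  case (exec_Seq p f s g q t h)
  have "tm_step machine (pre_config (Seq p q # ks) f) (pre_config (p # q # ks) f)"
    by (rule pre_step_idle) (use exec_Seq in auto)
  moreover have "(tm_step machine ^^ s) (pre_config (p # q # ks) f) (pre_config (q # ks) g)"
    by (rule exec_Seq.IH(1)) (use exec_Seq.prems stacks_self[of q ks] in auto)
  moreover have "(tm_step machine ^^ t) (pre_config (q # ks) g) (pre_config ks h)"
    by (rule exec_Seq.IH(2)) (use exec_Seq.prems in auto)
  ultimately show ?case by (rule steps_append)
next
  case (exec_While_False j f p)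
  have "tm_step machine (pre_config (While j p # ks) f) (pre_config ks f)"
    by (rule pre_step_idle) (use exec_While_False K_ge in \<open>auto simp: on_bit_iff\<close>)
  then show ?case by (simp only: relpowp_1)
next
  case (exec_While_True j f p s g t h)
  have "tm_step machine (pre_config (While j p # ks) f) (pre_config (p # While j p # ks) f)"
    by (rule pre_step_idle) (use exec_While_True K_ge in \<open>auto simp: on_bit_iff\<close>)
  moreover have "(tm_step machine ^^ s) (pre_config (p # While j p # ks) f)
      (pre_config (While j p # ks) g)"
    by (rule exec_While_True.IH(1)) (use exec_While_True.prems in auto)
  moreover have "(tm_step machine ^^ t) (pre_config (While j p # ks) g) (pre_config ks h)"
    by (rule exec_While_True.IH(2)) (use exec_While_True.prems in auto)
  ultimately show ?case by (rule steps_append)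
next
  case (exec_IfOne_True j f p s g q)
  have "tm_step machine (pre_config (IfOne j p q # ks) f) (pre_config (p # ks) f)"
    by (rule pre_step_idle) (use exec_IfOne_True K_ge in \<open>auto simp: one_bit_iff\<close>)
  moreover have "(tm_step machine ^^ s) (pre_config (p # ks) f) (pre_config ks g)"
    by (rule exec_IfOne_True.IH) (use exec_IfOne_True.prems in auto)
  ultimately show ?case by (rule relpowp_Suc_I2)
next
  case (exec_IfOne_False j f q s g p)
  have "tm_step machine (pre_config (IfOne j p q # ks) f) (pre_config (q # ks) f)"
    by (rule pre_step_idle) (use exec_IfOne_False K_ge in \<open>auto simp: one_bit_iff\<close>)
  moreover have "(tm_step machine ^^ s) (pre_config (q # ks) f) (pre_config ks g)"
    by (rule exec_IfOne_False.IH) (use exec_IfOne_False.prems in auto)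
  ultimately show ?case by (rule relpowp_Suc_I2)
qed

section \<open>Simulation of the solver behind the program\<close>

definition main_config :: "bit_tapes \<Rightarrow> config \<Rightarrow> config" where
  "main_config g = (\<lambda>(q, T, h). (main_state q,
     (\<lambda>j. if j < 3 then input_tape (fst (g j)) else T (j - 3)),
     (\<lambda>j. if j < 3 then snd (g j) else h (j - 3))))"

lemma map_upt_add: "map F [0..<n + 3] = [F 0, F 1, F 2] @ map (\<lambda>j. F (j + 3)) [0..<n]"
  by (rule nth_equalityI) (auto simp: nth_append nth_Cons' le_Suc_eq numeral_2_eq_2 simp del: upt_Suc)

text \<open>Both directions matter: halting bounds and rejection speak of all runs of the combined
  machine.\<close>

lemma main_step_iff:
  "tm_step machine (main_config g c) c'' \<longleftrightarrow> (\<exists>c'. tm_step M c c' \<and> c'' = main_config g c')"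
proof -
  obtain q T h where c: "c = (q, T, h)" by (metis surj_pair)
  let ?T = "\<lambda>j. if j < 3 then input_tape (fst (g j)) else T (j - 3)"
  let ?h = "\<lambda>j. if j < 3 then snd (g j) else h (j - 3)"
  let ?r = "[?T 0 (?h 0), ?T 1 (?h 1), ?T 2 (?h 2)]"
  have rd: "map (\<lambda>j. ?T j (?h j)) [0..<K] = ?r @ map (\<lambda>j. T j (h j)) [0..<num_tapes M]"
    unfolding map_upt_add by simp
  have r: "?r \<in> reads 3" using input_tape_symbol by (auto simp: reads_def)
  have upd: "(main_state q',
        (\<lambda>j. if j < K then (?T j)(?h j := (?r @ ws) ! j) else ?T j),
        (\<lambda>j. if j < K then ?h j + ([0, 0, 0] @ ds) ! j else ?h j)) =
      main_config g (q', (\<lambda>j. if j < num_tapes M then (T j)(h j := ws ! j) else T j),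
        (\<lambda>j. if j < num_tapes M then h j + ds ! j else h j))" for q' ws ds
  proof -
    have lt3: "j = 0 \<or> j = 1 \<or> j = 2" if "j < 3" for j :: nat using that by auto
    have nth3: "([x, y, z] @ xs) ! j = (if j < 3 then [x, y, z] ! j else xs ! (j - 3))"
      for x y z :: 'a and xs j
      by (auto simp: nth_Cons' less_Suc_eq numeral_3_eq_3)
    have "(if j < K then (?T j)(?h j := (?r @ ws) ! j) else ?T j) =
      (if j < 3 then input_tape (fst (g j)) else
        (if j - 3 < num_tapes M then (T (j - 3))(h (j - 3) := ws ! (j - 3)) else T (j - 3)))" for j
      using lt3[of j] by (auto simp: nth3 simp del: append_Cons append_Nil)
    moreover have "(if j < K then ?h j + ([0, 0, 0] @ ds) ! j else ?h j) =
      (if j < 3 then snd (g j) else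
        (if j - 3 < num_tapes M then h (j - 3) + ds ! (j - 3) else h (j - 3)))" for j
      using lt3[of j] by (auto simp: nth3 simp del: append_Cons append_Nil)
    ultimately show ?thesis unfolding main_config_def prod.case by presburger
  qed
  show ?thesis
  proof
    assume "tm_step machine (main_config g c) c''"
    then obtain q1 ws1 ds1 where t:
      "((main_state q, map (\<lambda>j. ?T j (?h j)) [0..<K]), (q1, ws1, ds1)) \<in> trans machine"
      and c'': "c'' = (q1, (\<lambda>j. if j < K then (?T j)(?h j := ws1 ! j) else ?T j),
        (\<lambda>j. if j < K then ?h j + ds1 ! j else ?h j))"
      unfolding c main_config_def prod.case by cases (simp add: machine_def)
    have "((main_state q, map (\<lambda>j. ?T j (?h j)) [0..<K]), (q1, ws1, ds1)) \<notin> pre_trans"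
    proof
      assume "((main_state q, map (\<lambda>j. ?T j (?h j)) [0..<K]), (q1, ws1, ds1)) \<in> pre_trans"
      then obtain s r where s: "s \<in> stacks prg []"
        "(main_state q, map (\<lambda>j. ?T j (?h j)) [0..<K]) = (pre_state s, r)"
        by (rule pre_transE) blast
      then have "main_state q = pre_state s" by (simp only: prod.inject)
      then show False using pre_neq_main[OF stacks_nonempty[OF s(1)], of q] by simp
    qed
    then have "((main_state q, map (\<lambda>j. ?T j (?h j)) [0..<K]), (q1, ws1, ds1)) \<in> main_trans"
      using t by (simp add: machine_def)
    then obtain q0 rs q' ws ds r where m: "((q0, rs), (q', ws, ds)) \<in> trans M" "r \<in> reads 3"
      "main_state q = main_state q0" "map (\<lambda>j. ?T j (?h j)) [0..<K] = r @ rs"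
      "q1 = main_state q'" "ws1 = r @ ws" "ds1 = [0, 0, 0] @ ds"
      unfolding main_trans_def by auto
    have "r = ?r \<and> rs = map (\<lambda>j. T j (h j)) [0..<num_tapes M]"
      using m(2) m(4)[symmetric] unfolding rd reads_def by (subst append_eq_append_conv[symmetric]) auto
    then have "((q, map (\<lambda>j. T j (h j)) [0..<num_tapes M]), (q', ws, ds)) \<in> trans M" "r = ?r"
      using m(1,3) main_state_inj by auto
    then show "\<exists>c'. tm_step M c c' \<and> c'' = main_config g c'"
      unfolding c'' m(5-7) c using upd[of q' ws ds] tm_step.intros by blast
  next
    assume "\<exists>c'. tm_step M c c' \<and> c'' = main_config g c'"
    then obtain c' where "tm_step M c c'" and c'': "c'' = main_config g c'" by blast
    from this(1)[unfolded c] show "tm_step machine (main_config g c) c''"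
    proof cases
      case (1 q' ws ds)
      have "((main_state q, map (\<lambda>j. ?T j (?h j)) [0..<num_tapes machine]),
          (main_state q', ?r @ ws, [0, 0, 0] @ ds)) \<in> trans machine"
        unfolding machine_def tm.simps rd
        by (rule UnI2, unfold main_trans_def, rule image_eqI[of _ _ "(_, ?r)"])
          (use 1(2) r in auto)
      from tm_step.intros[where T = ?T and h = ?h, OF this] show ?thesis
        unfolding c'' 1(1) upd[symmetric] c by (simp only: main_config_def prod.case machine_def tm.simps)
    qed
  qed
qed

lemma main_steps_iff:
  "(tm_step machine ^^ n) (main_config g c) c'' \<longleftrightarrow>
   (\<exists>c'. (tm_step M ^^ n) c c' \<and> c'' = main_config g c')"
proof (induction n arbitrary: c'')
  case (Suc n)
  show ?case unfolding relpowp.simps relcompp_apply Suc using main_step_iff by blast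
qed auto

lemma step_unique:
  assumes "tm_step machine c c1" "tm_step machine c c2" shows "c1 = c2"
proof -
  obtain q T h where c: "c = (q, T, h)" by (metis surj_pair)
  obtain q1 ws1 ds1 where 1: "((q, map (\<lambda>j. T j (h j)) [0..<num_tapes machine]), (q1, ws1, ds1)) \<in> trans machine"
    "c1 = (q1, (\<lambda>j. if j < num_tapes machine then (T j)(h j := ws1 ! j) else T j),
      (\<lambda>j. if j < num_tapes machine then h j + ds1 ! j else h j))"
    using assms(1) unfolding c by cases blast
  obtain q2 ws2 ds2 where 2: "((q, map (\<lambda>j. T j (h j)) [0..<num_tapes machine]), (q2, ws2, ds2)) \<in> trans machine"
    "c2 = (q2, (\<lambda>j. if j < num_tapes machine then (T j)(h j := ws2 ! j) else T j),
      (\<lambda>j. if j < num_tapes machine then h j + ds2 ! j else h j))"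
    using assms(2) unfolding c by cases blast
  have "(q1, ws1, ds1) = (q2, ws2, ds2)"
    using single_valuedD[OF deterministic_machine[unfolded deterministic_def] 1(1) 2(1)] .
  then have eqs: "q1 = q2" "ws1 = ws2" "ds1 = ds2" by simp_all
  show ?thesis unfolding 1(2) 2(2) eqs ..
qed

text \<open>Determinism leaves no branches: a shorter run is a proper prefix of the given one and
  can be continued, a longer one passes through its end.\<close>

lemma steps_split:
  assumes "(tm_step machine ^^ t) c c1" "(tm_step machine ^^ m) c c2"
  shows "if m < t then \<exists>c3. tm_step machine c2 c3 else (tm_step machine ^^ (m - t)) c1 c2"
  using assms
proof (induction t arbitrary: c m)
  case (Suc t)
  obtain c' where c': "tm_step machine c c'" "(tm_step machine ^^ t) c' c1"
    using Suc.prems(1) by (meson relpowp_Suc_E2)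
  show ?case
  proof (cases m)
    case 0
    then have "c2 = c" using Suc.prems(2) by simp
    then show ?thesis using c'(1) 0 by (auto simp del: split_paired_Ex)
  next
    case (Suc m')
    then obtain c'' where "tm_step machine c c''" "(tm_step machine ^^ m') c'' c2"
      using Suc.prems(2) by (meson relpowp_Suc_E2)
    then have "(tm_step machine ^^ m') c' c2" using step_unique[OF c'(1)] by blast
    from Suc.IH[OF c'(2) this] show ?thesis
      unfolding Suc by (simp split: if_splits del: split_paired_Ex)
  qed
qed simp

text \<open>During the first \<open>t\<close> steps the machine is never stuck, so every halting
  configuration stems from \<open>M\<close>, and the number 1 is kept for its accepting
  state.\<close>

theorem machine_correct:
  assumes exec: "exec prg (\<lambda>j. if j = 0 then (x, 0) else ([], 0)) t g"
    and out: "g 3 = (y, 0)" "\<And>j. 3 < j \<Longrightarrow> g j = ([], 0)"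
  shows "halts_within M y u \<Longrightarrow> halts_within machine x (t + u)"
    and "accepts machine x \<longleftrightarrow> accepts M y"
proof -
  let ?c1 = "main_config g (initial_config y)"
  have empty: "input_tape [] = (\<lambda>_. 0)" by (simp add: input_tape_def fun_eq_iff)
  have "pre_config [prg] (\<lambda>j. if j = 0 then (x, 0) else ([], 0)) = initial_config x"
    by (auto simp: pre_config_def initial_config_def pre_state_def empty fun_eq_iff)
  moreover have "g j = (if j - 3 = 0 then (y, 0) else ([], 0))" if "\<not> j < 3" for j
    using out that by (cases "j = 3") auto
  \<comment> \<open>The empty stack and the start state of \<open>M\<close> share the number 2, so
    the end of the program is the start of \<open>M\<close> on the word left on tape 3.\<close>
  then have "pre_config [] g = ?c1"
    by (auto simp: pre_config_def initial_config_def pre_state_def main_config_def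
        main_state_def empty fun_eq_iff)
  ultimately have start: "(tm_step machine ^^ t) (initial_config x) ?c1"
    using exec_steps[OF exec, of "[]"] by simp
  have split: "(m < t \<and> (\<exists>c3. tm_step machine c c3)) \<or>
      (t \<le> m \<and> (\<exists>c'. (tm_step M ^^ (m - t)) (initial_config y) c' \<and> c = main_config g c'))"
    if "(tm_step machine ^^ m) (initial_config x) c" for m c
    using steps_split[OF start that] main_steps_iff by (auto split: if_splits)
  show "halts_within machine x (t + u)" if "halts_within M y u"
    unfolding halts_within_def
  proof (intro allI impI)
    fix m c assume "(tm_step machine ^^ m) (initial_config x) c"
    then show "m \<le> t + u" using split that unfolding halts_within_def by fastforce
  qed
  show "accepts machine x \<longleftrightarrow> accepts M y"
  proof
    assume "accepts machine x"
    then obtain m c where c: "(tm_step machine ^^ m) (initial_config x) c"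
      "\<nexists>c'. tm_step machine c c'" "fst c = 1"
      unfolding accepts_def by (metis rtranclp_power)
    then obtain c' where c': "(tm_step M ^^ (m - t)) (initial_config y) c'" "c = main_config g c'"
      using split by blast
    have "\<nexists>c''. tm_step M c' c''" using c(2) main_step_iff c'(2) by blast
    moreover have "main_state (fst c') = main_state 1"
      using c(3) unfolding c'(2) by (cases c') (simp add: main_config_def main_state_def)
    ultimately show "accepts M y"
      unfolding accepts_def main_state_inj using c'(1) by (metis relpowp_imp_rtranclp)
  next
    assume "accepts M y"
    then obtain m c where c: "(tm_step M ^^ m) (initial_config y) c" "\<nexists>c'. tm_step M c c'" "fst c = 1"
      unfolding accepts_def by (metis rtranclp_power)
    have "(tm_step machine ^^ m) ?c1 (main_config g c)" using c(1) main_steps_iff by blast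
    with start have "(tm_step machine)\<^sup>*\<^sup>* (initial_config x) (main_config g c)"
      by (meson relpowp_imp_rtranclp rtranclp_trans)
    moreover have "\<nexists>c'. tm_step machine (main_config g c) c'" using c(2) main_step_iff by blast
    moreover have "fst (main_config g c) = 1"
      using c(3) by (cases c) (simp add: main_config_def main_state_def)
    ultimately show "accepts machine x" unfolding accepts_def by blast
  qed
qed

end


section \<open>A program that writes the instance\<close>

definition runs :: "prog \<Rightarrow> bit_tapes \<Rightarrow> nat \<Rightarrow> bit_tapes \<Rightarrow> bool" where
  "runs p f t g \<longleftrightarrow> (\<exists>s\<le>t. exec p f s g)"

notation Seq (infixr ";;" 60)

definition full :: "bool list \<Rightarrow> bool list \<times> int" where
  "full ys = (ys, int (length ys))"

definition mk :: "bool list \<times> int \<Rightarrow> bool list \<times> int \<Rightarrow> bool list \<times> int \<Rightarrow> bool list \<times> int \<Rightarrow> bit_tapes" where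
  "mk a b c d = (\<lambda>j. if j = 0 then a else if j = 1 then b else if j = 2 then c
     else if j = 3 then d else ([], 0))"

lemma mk_simps [simp]:
  "mk a b c d 0 = a" "mk a b c d 1 = b" "mk a b c d (Suc 0) = b" "mk a b c d 2 = c" "mk a b c d 3 = d"
  "(mk a b c d)(0 := e) = mk e b c d" "(mk a b c d)(1 := e) = mk a e c d"
  "(mk a b c d)(Suc 0 := e) = mk a e c d"
  "(mk a b c d)(2 := e) = mk a b e d" "(mk a b c d)(3 := e) = mk a b c e"
  by (auto simp: mk_def fun_eq_iff)

lemma runs_mono: "runs p f t g \<Longrightarrow> t \<le> t' \<Longrightarrow> runs p f t' g"
  unfolding runs_def by (meson le_trans)

lemma runs_Skip: "runs Skip f 1 f"
  unfolding runs_def using exec_Skip by blast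

lemma runs_Write:
  "j < 4 \<Longrightarrow> f j = full ys \<Longrightarrow> g = f(j := full (ys @ [b])) \<Longrightarrow> runs (Write j b) f 1 g"
  unfolding runs_def full_def using exec_Write[of j f ys b] by (auto simp: add.commute)

lemma runs_MoveL: "j < 4 \<Longrightarrow> f j = (ys, h) \<Longrightarrow> g = f(j := (ys, h - 1)) \<Longrightarrow> runs (MoveL j) f 1 g"
  unfolding runs_def using exec_MoveL[of j f] by auto

lemma runs_MoveR: "j < 4 \<Longrightarrow> f j = (ys, h) \<Longrightarrow> g = f(j := (ys, h + 1)) \<Longrightarrow> runs (MoveR j) f 1 g"
  unfolding runs_def using exec_MoveR[of j f] by auto

lemma runs_Seq: "runs p f s g \<Longrightarrow> runs q g t h \<Longrightarrow> runs (p ;; q) f (Suc (s + t)) h"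
  unfolding runs_def by (meson exec_Seq add_mono Suc_le_mono)

lemma runs_IfOne:
  assumes "j < 4" "f j = (ys, h)" "0 \<le> h" "h < int (length ys)"
    and "runs (if ys ! nat h then p else q) f t g"
  shows "runs (IfOne j p q) f (Suc t) g"
proof -
  obtain s where s: "s \<le> t" "exec (if ys ! nat h then p else q) f s g"
    using assms(5) unfolding runs_def by blast
  have on: "on_bit f j" using assms by (simp add: on_bit_def)
  have "exec (IfOne j p q) f (Suc s) g"
  proof (cases "ys ! nat h")
    case True
    then show ?thesis using s(2) on assms(1,2) by (intro exec_IfOne_True) auto
  next
    case False
    then show ?thesis using s(2) on assms(1,2) by (intro exec_IfOne_False) auto
  qed
  then show ?thesis using s(1) unfolding runs_def by (meson Suc_le_mono)
qed

text \<open>The sequence \<open>D\<close> is the loop invariant, giving the tapes before each round;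
  every round costs one step more than its body.\<close>

lemma runs_While:
  assumes "j < 4" "\<And>i. i < n \<Longrightarrow> on_bit (D i) j" "\<not> on_bit (D n) j"
    and "\<And>i. i < n \<Longrightarrow> runs p (D i) b (D (Suc i))"
  shows "runs (While j p) (D 0) (n * Suc b + 1) (D n)"
  using assms(2-4)
proof (induction n arbitrary: D)
  case 0
  then show ?case using exec_While_False[OF assms(1)] unfolding runs_def by fastforce
next
  case (Suc n)
  obtain s where s: "s \<le> b" "exec p (D 0) s (D 1)"
    using Suc.prems(3)[of 0] unfolding runs_def by auto
  have "runs (While j p) (D (Suc 0)) (n * Suc b + 1) (D (Suc n))"
    by (rule Suc.IH[of "\<lambda>i. D (Suc i)"]) (use Suc.prems in auto)
  then obtain t where t: "t \<le> n * Suc b + 1" "exec (While j p) (D 1) t (D (Suc n))"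
    unfolding runs_def by auto
  have "exec (While j p) (D 0) (Suc (s + t)) (D (Suc n))"
    using exec_While_True[OF assms(1) _ s(2) t(2)] Suc.prems(1) by blast
  then show ?case using s(1) t(1) unfolding runs_def by (intro exI[of _ "Suc (s + t)"]) simp
qed

text \<open>The head starts on the blank behind the string, where the loop would stop at once, hence
  the first move; the last one returns from cell -1.\<close>

definition rewind :: "nat \<Rightarrow> prog" where
  "rewind j = MoveL j ;; While j (MoveL j) ;; MoveR j"

lemma runs_rewind:
  assumes j: "j < 4" and fj: "f j = full ys"
  shows "runs (rewind j) f (2 * length ys + 5) (f(j := (ys, 0)))"
proof -
  define D where "D i = f(j := (ys, int (length ys) - 1 - int i))" for i
  have "runs (MoveL j) f 1 (D 0)"
    by (rule runs_MoveL[OF j]) (use fj in \<open>simp_all add: full_def D_def\<close>)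
  moreover have "runs (While j (MoveL j)) (D 0) (length ys * Suc 1 + 1) (D (length ys))"
  proof (rule runs_While[OF j])
    show "on_bit (D i) j" if "i < length ys" for i using that by (auto simp: on_bit_def D_def)
    show "\<not> on_bit (D (length ys)) j" by (simp add: on_bit_def D_def)
    show "runs (MoveL j) (D i) 1 (D (Suc i))" for i
      by (rule runs_MoveL[OF j, where ys = ys and h = "int (length ys) - 1 - int i"]) (simp_all add: D_def)
  qed
  moreover have "runs (MoveR j) (D (length ys)) 1 (f(j := (ys, 0)))"
    by (rule runs_MoveR[OF j], simp add: D_def, simp add: D_def)
  ultimately have "runs (rewind j) f (Suc (1 + Suc (length ys * Suc 1 + 1 + 1))) (f(j := (ys, 0)))"
    unfolding rewind_def by (intro runs_Seq)
  then show ?thesis by (rule runs_mono) simp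
qed

primrec write_out :: "bool list \<Rightarrow> prog" where
  "write_out [] = Skip"
| "write_out (b # bs) = Write 3 b ;; write_out bs"

lemma runs_write_out:
  "f 3 = full ys \<Longrightarrow> runs (write_out bs) f (2 * length bs + 1) (f(3 := full (ys @ bs)))"
proof (induction bs arbitrary: f ys)
  case Nil
  then have "f(3 := full ys) = f" by auto
  then show ?case using runs_Skip by simp
next
  case (Cons b bs)
  let ?f = "f(3 := full (ys @ [b]))"
  have 1: "runs (Write 3 b) f 1 ?f" by (rule runs_Write) (use Cons.prems in simp_all)
  have 2: "runs (write_out bs) ?f (2 * length bs + 1) (?f(3 := full ((ys @ [b]) @ bs)))"
    by (rule Cons.IH) simp
  have eq: "?f(3 := full ((ys @ [b]) @ bs)) = f(3 := full (ys @ b # bs))" by simp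
  show ?case unfolding write_out.simps by (rule runs_mono[OF runs_Seq[OF 1 2[unfolded eq]]]) simp
qed

lemma concat_replicate_snoc: "concat (replicate i bs) @ bs = concat (replicate (Suc i) bs)"
  by (induction i) auto

lemma runs_write_loop_right:
  assumes j: "j < 3" and fj: "f j = (ys, h)" "0 \<le> h" "h + int n = int (length ys)" and f3: "f 3 = full zs"
  shows "runs (While j (write_out bs ;; MoveR j)) f (n * (2 * length bs + 4) + 1)
    (f(j := full ys, 3 := full (zs @ concat (replicate n bs))))"
proof -
  define D where "D i = f(j := (ys, h + int i), 3 := full (zs @ concat (replicate i bs)))" for i
  have "runs (While j (write_out bs ;; MoveR j)) (D 0) (n * Suc (2 * length bs + 3) + 1) (D n)"
  proof (rule runs_While)
    fix i assume "i < n"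
    have "runs (write_out bs) (D i) (2 * length bs + 1)
        ((D i)(3 := full ((zs @ concat (replicate i bs)) @ bs)))"
      by (rule runs_write_out) (simp add: D_def)
    moreover have "runs (MoveR j) ((D i)(3 := full ((zs @ concat (replicate i bs)) @ bs))) 1 (D (Suc i))"
    proof (rule runs_MoveR)
      show "((D i)(3 := full ((zs @ concat (replicate i bs)) @ bs))) j = (ys, h + int i)"
        using j by (simp add: D_def)
      show "D (Suc i) = (D i)(3 := full ((zs @ concat (replicate i bs)) @ bs), j := (ys, h + int i + 1))"
        unfolding D_def append_assoc concat_replicate_snoc using j by (auto simp: fun_eq_iff)
    qed (use j in simp)
    ultimately show "runs (write_out bs ;; MoveR j) (D i) (2 * length bs + 3) (D (Suc i))"
      by (rule runs_mono[OF runs_Seq]) simp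
  qed (use j fj in \<open>auto simp: D_def on_bit_def\<close>)
  moreover have "D 0 = f" using fj f3 j by (auto simp: D_def fun_eq_iff)
  moreover have "D n = f(j := full ys, 3 := full (zs @ concat (replicate n bs)))"
    using fj by (simp add: D_def full_def)
  ultimately have "runs (While j (write_out bs ;; MoveR j)) f (n * Suc (2 * length bs + 3) + 1)
      (f(j := full ys, 3 := full (zs @ concat (replicate n bs))))" by (simp only:)
  then show ?thesis by (rule runs_mono) simp
qed

lemma runs_write_loop_left:
  assumes j: "j < 3" and fj: "f j = (ys, int n - 1)" "n \<le> length ys" and f3: "f 3 = full zs"
  shows "runs (While j (write_out bs ;; MoveL j)) f (n * (2 * length bs + 4) + 1)
    (f(j := (ys, -1), 3 := full (zs @ concat (replicate n bs))))"
proof -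
  define D where "D i = f(j := (ys, int n - 1 - int i), 3 := full (zs @ concat (replicate i bs)))" for i
  have "runs (While j (write_out bs ;; MoveL j)) (D 0) (n * Suc (2 * length bs + 3) + 1) (D n)"
  proof (rule runs_While)
    fix i assume "i < n"
    have "runs (write_out bs) (D i) (2 * length bs + 1)
        ((D i)(3 := full ((zs @ concat (replicate i bs)) @ bs)))"
      by (rule runs_write_out) (simp add: D_def)
    moreover have "runs (MoveL j) ((D i)(3 := full ((zs @ concat (replicate i bs)) @ bs))) 1 (D (Suc i))"
    proof (rule runs_MoveL)
      show "((D i)(3 := full ((zs @ concat (replicate i bs)) @ bs))) j = (ys, int n - 1 - int i)"
        using j by (simp add: D_def)
      show "D (Suc i) = (D i)(3 := full ((zs @ concat (replicate i bs)) @ bs), j := (ys, int n - 1 - int i - 1))"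
        unfolding D_def append_assoc concat_replicate_snoc using j by (auto simp: fun_eq_iff)
    qed (use j in simp)
    ultimately show "runs (write_out bs ;; MoveL j) (D i) (2 * length bs + 3) (D (Suc i))"
      by (rule runs_mono[OF runs_Seq]) simp
  qed (use j fj in \<open>auto simp: D_def on_bit_def\<close>)
  moreover have "D 0 = f" using fj f3 j by (auto simp: D_def fun_eq_iff)
  moreover have "D n = f(j := (ys, -1), 3 := full (zs @ concat (replicate n bs)))"
    by (simp add: D_def)
  ultimately have "runs (While j (write_out bs ;; MoveL j)) f (n * Suc (2 * length bs + 3) + 1)
      (f(j := (ys, -1), 3 := full (zs @ concat (replicate n bs))))" by (simp only:)
  then show ?thesis by (rule runs_mono) simp
qed

text \<open>Tapes 1 and 2 hold the same number in unary, with the heads behind the last mark.\<close>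

abbreviation ones :: "nat \<Rightarrow> bool list" where "ones n \<equiv> replicate n False"

lemma full_ones_Suc: "full (ones n @ [False]) = full (ones (Suc n))"
  by (simp add: replicate_append_same)

section \<open>Unary arithmetic\<close>

definition inc :: prog where
  "inc = Write 1 False ;; Write 2 False"

lemma runs_inc: "runs inc (mk x (full (ones n)) (full (ones n)) y) 3
    (mk x (full (ones (Suc n))) (full (ones (Suc n))) y)"
proof -
  have "runs (Write 1 False) (mk x (full (ones n)) (full (ones n)) y) 1
      (mk x (full (ones (Suc n))) (full (ones n)) y)"
    by (rule runs_Write[where ys = "ones n"]) (simp_all add: full_ones_Suc del: replicate.simps)
  moreover have "runs (Write 2 False) (mk x (full (ones (Suc n))) (full (ones n)) y) 1
      (mk x (full (ones (Suc n))) (full (ones (Suc n))) y)"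
    by (rule runs_Write[where ys = "ones n"]) (simp_all add: full_ones_Suc del: replicate.simps)
  ultimately show ?thesis unfolding inc_def by (rule runs_mono[OF runs_Seq]) simp
qed

text \<open>Appending requires the head behind the string, so a loop cannot run along the tape it
  extends. Tape 2 therefore counts the marks appended to tape 1. Then both heads advance by the old
  value, and the second half of tape 1 counts the marks appended to tape 2.\<close>

definition double :: prog where
  "double = rewind 2 ;; While 2 (Write 1 False ;; MoveR 2) ;; rewind 2 ;; rewind 1 ;;
     While 2 (MoveR 1 ;; MoveR 2) ;; While 1 (Write 2 False ;; MoveR 1)"

lemma runs_double: "runs double (mk x (full (ones n)) (full (ones n)) y) (20 * n + 30)
    (mk x (full (ones (2 * n))) (full (ones (2 * n))) y)"
proof -
  have 1: "runs (rewind 2) (mk x (full (ones n)) (full (ones n)) y) (2 * n + 5)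
      (mk x (full (ones n)) (ones n, 0) y)"
    using runs_rewind[of 2 "mk x (full (ones n)) (full (ones n)) y" "ones n"] by simp
  define D where "D i = mk x (full (ones (n + i))) (ones n, int i) y" for i
  have 2: "runs (While 2 (Write 1 False ;; MoveR 2)) (D 0) (n * Suc 3 + 1) (D n)"
  proof (rule runs_While)
    fix i
    have "runs (Write 1 False) (D i) 1 (mk x (full (ones (Suc (n + i)))) (ones n, int i) y)"
      by (rule runs_Write[where ys = "ones (n + i)"]) (simp_all add: D_def full_ones_Suc del: replicate.simps)
    moreover have "runs (MoveR 2) (mk x (full (ones (Suc (n + i)))) (ones n, int i) y) 1 (D (Suc i))"
      by (rule runs_MoveR) (simp_all add: D_def add.commute)
    ultimately show "runs (Write 1 False ;; MoveR 2) (D i) 3 (D (Suc i))"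
      by (rule runs_mono[OF runs_Seq]) simp
  qed (auto simp: D_def on_bit_def)
  have 3: "runs (rewind 2) (D n) (2 * n + 5) (mk x (full (ones (n + n))) (ones n, 0) y)"
    using runs_rewind[of 2 "D n" "ones n"] by (simp add: D_def full_def)
  have 4: "runs (rewind 1) (mk x (full (ones (n + n))) (ones n, 0) y) (4 * n + 5)
      (mk x (ones (n + n), 0) (ones n, 0) y)"
    using runs_rewind[of 1 "mk x (full (ones (n + n))) (ones n, 0) y" "ones (n + n)"] by simp
  define E where "E i = mk x (ones (n + n), int i) (ones n, int i) y" for i
  have 5: "runs (While 2 (MoveR 1 ;; MoveR 2)) (E 0) (n * Suc 3 + 1) (E n)"
  proof (rule runs_While)
    fix i
    have "runs (MoveR 1) (E i) 1 (mk x (ones (n + n), int i + 1) (ones n, int i) y)"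
      by (rule runs_MoveR) (simp_all add: E_def)
    moreover have "runs (MoveR 2) (mk x (ones (n + n), int i + 1) (ones n, int i) y) 1 (E (Suc i))"
      by (rule runs_MoveR) (simp_all add: E_def add.commute)
    ultimately show "runs (MoveR 1 ;; MoveR 2) (E i) 3 (E (Suc i))"
      by (rule runs_mono[OF runs_Seq]) simp
  qed (auto simp: E_def on_bit_def)
  define F where "F i = mk x (ones (n + n), int (n + i)) (full (ones (n + i))) y" for i
  have 6: "runs (While 1 (Write 2 False ;; MoveR 1)) (F 0) (n * Suc 3 + 1) (F n)"
  proof (rule runs_While)
    fix i
    have "runs (Write 2 False) (F i) 1 (mk x (ones (n + n), int (n + i)) (full (ones (Suc (n + i)))) y)"
      by (rule runs_Write[where ys = "ones (n + i)"]) (simp_all add: F_def full_ones_Suc del: replicate.simps)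
    moreover have "runs (MoveR 1) (mk x (ones (n + n), int (n + i)) (full (ones (Suc (n + i)))) y) 1
        (F (Suc i))"
      by (rule runs_MoveR, simp, simp add: F_def, simp add: F_def add.commute)
    ultimately show "runs (Write 2 False ;; MoveR 1) (F i) 3 (F (Suc i))"
      by (rule runs_mono[OF runs_Seq]) simp
  qed (auto simp: F_def on_bit_def)
  have eqs: "mk x (full (ones n)) (ones n, 0) y = D 0" "mk x (ones (n + n), 0) (ones n, 0) y = E 0"
    "E n = F 0" "F n = mk x (full (ones (n + n))) (full (ones (n + n))) y"
    by (simp_all only: D_def E_def F_def full_def length_replicate add_0_right of_nat_0)
  show ?thesis
    unfolding double_def mult_2[of n]
    by (rule runs_mono[OF runs_Seq[OF 1[unfolded eqs] runs_Seq[OF 2 runs_Seq[OF 3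
        runs_Seq[OF 4[unfolded eqs] runs_Seq[OF 5[unfolded eqs] 6[unfolded eqs]]]]]]]) simp
qed

primrec double_iter :: "nat \<Rightarrow> prog" where
  "double_iter 0 = Skip"
| "double_iter (Suc c) = double ;; double_iter c"

lemma runs_double_iter:
  "2 ^ c * n \<le> B \<Longrightarrow> runs (double_iter c) (mk x (full (ones n)) (full (ones n)) y) (c * (20 * B + 31) + 1)
    (mk x (full (ones (2 ^ c * n))) (full (ones (2 ^ c * n))) y)"
proof (induction c arbitrary: n)
  case 0
  then show ?case using runs_Skip by simp
next
  case (Suc c)
  have "2 ^ c * (2 * n) \<le> B" using Suc.prems by (simp add: mult.assoc mult.left_commute)
  from runs_Seq[OF runs_double Suc.IH[OF this]]
  have "runs (double_iter (Suc c)) (mk x (full (ones n)) (full (ones n)) y)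
      (Suc (20 * n + 30 + (c * (20 * B + 31) + 1)))
      (mk x (full (ones (2 ^ Suc c * n))) (full (ones (2 ^ Suc c * n))) y)"
    by (simp add: mult.assoc mult.left_commute)
  moreover have "n \<le> B"
  proof -
    have "n * 1 \<le> n * 2 ^ Suc c" by (intro mult_le_mono2) simp
    also have "\<dots> \<le> B" using Suc.prems by (simp only: mult.commute)
    finally show ?thesis by simp
  qed
  ultimately show ?case by (elim runs_mono) simp
qed

text \<open>The first pass over \<open>x\<close> builds the power
  \<open>2 ^ (c0 + c * length x)\<close>, and \<open>inc\<close> adds the end mark. The second pass
  runs from right to left, since Horner's rule takes the highest digit of \<open>x\<close> first;
  the final \<open>inc\<close> leads from \<open>N - 1\<close> to \<open>N\<close>.\<close>

definition count_up :: "nat \<Rightarrow> nat \<Rightarrow> prog" where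
  "count_up c c0 = inc ;; double_iter c0 ;; While 0 (double_iter c ;; MoveR 0) ;; inc ;; MoveL 0 ;;
     While 0 (double ;; IfOne 0 inc Skip ;; MoveL 0) ;; inc"

text \<open>The intermediate values of Horner's rule belong to the suffixes of \<open>x\<close>.
  None exceeds the final value, so each doubling takes O(N) steps.\<close>

lemma bits_value_drop_le: "bits_value (drop i x) m \<le> bits_value x m"
proof (induction x arbitrary: i)
  case (Cons b x)
  have "bits_value (drop (i - 1) x) m \<le> bits_value x m" by (rule Cons)
  then show ?case by (cases i) auto
qed simp

lemma length_le_bits_value: "0 < m \<Longrightarrow> length x < bits_value x m"
  by (induction x) auto

lemma runs_count_up:
  fixes x :: "bool list"
  assumes N: "N = Suc (bits_value x (1 + 2 ^ (c0 + c * length x)))"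
  shows "\<exists>h. runs (count_up c c0) (mk (x, 0) ([], 0) ([], 0) y) ((51 * c0 + 52 * c + 100) * N * N)
    (mk (x, h) (full (ones N)) (full (ones N)) y)"
proof -
  let ?L = "length x"
  define p where "p i = (2::nat) ^ (c0 + c * i)" for i
  define m where "m = Suc (p ?L)"
  have NB: "N = Suc (bits_value x m)" using N by (simp add: m_def p_def)
  have mN: "m \<le> N" using bits_value_drop_le[of ?L x m] by (simp add: NB)
  have pN: "p i \<le> N" if "i \<le> ?L" for i
  proof -
    have "p i \<le> p ?L" unfolding p_def using that by (intro power_increasing) auto
    then show ?thesis using mN by (simp add: m_def)
  qed
  have LN: "?L < N" using length_le_bits_value[of m x] by (simp add: NB m_def)
  let ?f = "\<lambda>x n. mk x (full (ones n)) (full (ones n)) y"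
  have 1: "runs inc (?f (x, 0) 0) 3 (?f (x, 0) 1)"
    using runs_inc[of "(x, 0)" 0 y] by simp
  have 2: "runs (double_iter c0) (?f (x, 0) 1) (c0 * (20 * N + 31) + 1) (?f (x, 0) (p 0))"
    using runs_double_iter[of c0 1 N] pN[of 0] by (simp add: p_def)
  define D where "D i = ?f (x, int i) (p i)" for i
  have 3: "runs (While 0 (double_iter c ;; MoveR 0)) (D 0) (?L * Suc (c * (20 * N + 31) + 3) + 1) (D ?L)"
  proof (rule runs_While)
    fix i assume i: "i < ?L"
    have "2 ^ c * p i = p (Suc i)" by (simp add: p_def power_add)
    then have "runs (double_iter c) (D i) (c * (20 * N + 31) + 1) (?f (x, int i) (p (Suc i)))"
      using runs_double_iter[of c "p i" N "(x, int i)" y] pN[of "Suc i"] i by (simp add: D_def)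
    moreover have "runs (MoveR 0) (?f (x, int i) (p (Suc i))) 1 (D (Suc i))"
      by (rule runs_MoveR) (simp_all add: D_def add.commute)
    ultimately show "runs (double_iter c ;; MoveR 0) (D i) (c * (20 * N + 31) + 3) (D (Suc i))"
      by (rule runs_mono[OF runs_Seq]) simp
  qed (auto simp: D_def on_bit_def)
  have 4: "runs inc (D ?L) 3 (?f (x, int ?L) m)"
    using runs_inc by (simp only: D_def m_def)
  have 5: "runs (MoveL 0) (?f (x, int ?L) m) 1 (?f (x, int ?L - 1) m)"
    by (rule runs_MoveL, simp, simp, simp)
  define E where "E i = ?f (x, int ?L - 1 - int i) (bits_value (drop (?L - i) x) m)" for i
  have 6: "runs (While 0 (double ;; IfOne 0 inc Skip ;; MoveL 0)) (E 0) (?L * Suc (20 * N + 37) + 1) (E ?L)"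
  proof (rule runs_While)
    fix i assume i: "i < ?L"
    let ?v = "bits_value (drop (?L - i) x) m" and ?b = "x ! (?L - Suc i)"
    have v: "?v \<le> N" using bits_value_drop_le[of "?L - i" x m] by (simp add: NB)
    have d: "drop (?L - Suc i) x = ?b # drop (?L - i) x"
      using i by (subst Cons_nth_drop_Suc[symmetric]) (auto simp: Suc_diff_Suc)
    have "runs double (E i) (20 * N + 30) (?f (x, int ?L - 1 - int i) (2 * ?v))"
      using runs_double[of "(x, int ?L - 1 - int i)" ?v y] v by (auto simp: E_def intro: runs_mono)
    moreover have "runs (IfOne 0 inc Skip) (?f (x, int ?L - 1 - int i) (2 * ?v)) 4
        (?f (x, int ?L - 1 - int i) (2 * ?v + of_bool ?b))"
    proof -
      have "nat (int ?L - 1 - int i) = ?L - Suc i" by simp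
      moreover have "runs (if ?b then inc else Skip) (?f (x, int ?L - 1 - int i) (2 * ?v)) 3
          (?f (x, int ?L - 1 - int i) (2 * ?v + of_bool ?b))"
        using runs_inc[of "(x, int ?L - 1 - int i)" "2 * ?v" y] runs_mono[OF runs_Skip, of 3]
        by (simp del: replicate.simps)
      ultimately have "runs (IfOne 0 inc Skip) (?f (x, int ?L - 1 - int i) (2 * ?v)) (Suc 3)
        (?f (x, int ?L - 1 - int i) (2 * ?v + of_bool ?b))"
        using i by (intro runs_IfOne[of 0 _ x "int ?L - 1 - int i"]) simp_all
      then show ?thesis by simp
    qed
    moreover have "runs (MoveL 0) (?f (x, int ?L - 1 - int i) (2 * ?v + of_bool ?b)) 1 (E (Suc i))"
      by (rule runs_MoveL[where ys = x and h = "int ?L - 1 - int i"]) (use d in \<open>simp_all add: E_def\<close>)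
    ultimately have "runs (double ;; IfOne 0 inc Skip ;; MoveL 0) (E i)
        (Suc (20 * N + 30 + Suc (4 + 1))) (E (Suc i))"
      by (intro runs_Seq)
    then show "runs (double ;; IfOne 0 inc Skip ;; MoveL 0) (E i) (20 * N + 37) (E (Suc i))"
      by (rule runs_mono) simp
  qed (auto simp: E_def on_bit_def)
  have 7: "runs inc (E ?L) 3 (?f (x, -1) N)"
    using runs_inc[of "(x, -1)" "bits_value x m" y] by (simp only: E_def NB) simp
  have eqs: "mk (x, 0) ([], 0) ([], 0) y = ?f (x, 0) 0" "?f (x, 0) (p 0) = D 0"
    "?f (x, int ?L - 1) m = E 0"
    by (simp_all add: D_def E_def full_def)
  have "runs (count_up c c0) (?f (x, 0) 0) (Suc (3 + Suc (c0 * (20 * N + 31) + 1 +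
      Suc (?L * Suc (c * (20 * N + 31) + 3) + 1 + Suc (3 + Suc (1 + Suc (?L * Suc (20 * N + 37) + 1 + 3)))))))
      (?f (x, -1) N)"
    unfolding count_up_def
    by (rule runs_Seq[OF 1 runs_Seq[OF 2[unfolded eqs(2)] runs_Seq[OF 3 runs_Seq[OF 4
        runs_Seq[OF 5[unfolded eqs(3)] runs_Seq[OF 6 7]]]]]])
  moreover have "Suc (3 + Suc (c0 * (20 * N + 31) + 1 + Suc (?L * Suc (c * (20 * N + 31) + 3) + 1 +
      Suc (3 + Suc (1 + Suc (?L * Suc (20 * N + 37) + 1 + 3)))))) \<le> (51 * c0 + 52 * c + 100) * N * N"
  proof -
    \<comment> \<open>Both passes make fewer than \<open>N\<close> rounds of O(N) steps each; the
      numerical factors are generous.\<close>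
    have N1: "1 \<le> N" using LN by simp
    have NN: "N \<le> N * N" "1 \<le> N * N" using N1 by (auto intro: le_trans[OF N1])
    have "20 * N + 31 \<le> 51 * (N * N)" using NN by linarith
    then have "c0 * (20 * N + 31) \<le> c0 * (51 * (N * N))" by (rule mult_le_mono2)
    then have "c0 * (20 * N + 31) \<le> 51 * c0 * (N * N)" by (simp only: mult.left_commute mult.assoc)
    moreover have "?L * Suc (c * (20 * N + 31) + 3) \<le> 51 * c * (N * N) + 4 * (N * N)"
    proof -
      have "20 * N + 31 \<le> 51 * N" using N1 by linarith
      then have "c * (20 * N + 31) \<le> c * (51 * N)" by (rule mult_le_mono2)
      then have "?L * Suc (c * (20 * N + 31) + 3) \<le> N * (c * (51 * N) + 4)"
        using LN by (intro mult_le_mono) auto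
      also have "\<dots> = 51 * c * (N * N) + 4 * N" by (simp add: algebra_simps)
      finally show ?thesis using NN by linarith
    qed
    moreover have "?L * Suc (20 * N + 37) \<le> 58 * (N * N)"
      using mult_le_mono[of ?L N "Suc (20 * N + 37)" "58 * N"] LN N1 by simp
    ultimately have "Suc (3 + Suc (c0 * (20 * N + 31) + 1 + Suc (?L * Suc (c * (20 * N + 31) + 3) + 1 +
      Suc (3 + Suc (1 + Suc (?L * Suc (20 * N + 37) + 1 + 3)))))) \<le>
      51 * c0 * (N * N) + 51 * c * (N * N) + 100 * (N * N)"
      using NN by linarith
    also have "\<dots> \<le> (51 * c0 + 52 * c + 100) * N * N" by (simp add: algebra_simps)
    finally show ?thesis .
  qed
  ultimately show ?thesis unfolding eqs by (blast intro: runs_mono)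
qed

section \<open>Writing the code of the instance\<close>

text \<open>The way right writes the row of an even vertex, the way back that of an odd one. The
  head is back at cell 0 afterwards, ready for the next pair of rows.\<close>

definition write_rows :: prog where
  "write_rows = While 2 (write_out [False, True] ;; MoveR 2) ;; MoveL 2 ;;
     While 2 (write_out [True, False] ;; MoveL 2) ;; MoveR 2"

text \<open>Every mark stands for two vertices. The four bits written first in each token set use up
  two marks, so the loops for the sets cover \<open>N - 2\<close> marks: on tape 2 to the right from
  cell 2, on tape 1 to the left from cell \<open>N - 3\<close>, three moves before the end.\<close>

definition write_instance :: "bool list \<Rightarrow> prog" where
  "write_instance w = write_out w ;; rewind 1 ;; While 1 (write_out [True, True] ;; MoveR 1) ;;
     write_out [False] ;; rewind 1 ;; rewind 2 ;; While 1 (write_rows ;; MoveR 1) ;;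
     MoveR 2 ;; MoveR 2 ;; write_out [True, False, True, False] ;;
     While 2 (write_out [False, False] ;; MoveR 2) ;;
     MoveL 1 ;; MoveL 1 ;; MoveL 1 ;; write_out [False, True, False, True] ;;
     While 1 (write_out [False, False] ;; MoveL 1) ;; rewind 3"

definition two_rows :: "nat \<Rightarrow> bool list" where
  "two_rows N = concat (replicate N [False, True]) @ concat (replicate N [True, False])"

lemma runs_write_rows:
  "runs write_rows (mk x u (ones N, 0) (full zs)) (16 * N + 7) (mk x u (ones N, 0) (full (zs @ two_rows N)))"
proof -
  let ?z = "zs @ concat (replicate N [False, True])"
  have 1: "runs (While 2 (write_out [False, True] ;; MoveR 2)) (mk x u (ones N, 0) (full zs)) (N * 8 + 1)
      (mk x u (full (ones N)) (full ?z))"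
    using runs_write_loop_right[of 2 "mk x u (ones N, 0) (full zs)" "ones N" 0 N zs "[False, True]"] by simp
  have 2: "runs (MoveL 2) (mk x u (full (ones N)) (full ?z)) 1 (mk x u (ones N, int N - 1) (full ?z))"
    by (rule runs_MoveL) (simp_all add: full_def)
  have 3: "runs (While 2 (write_out [True, False] ;; MoveL 2)) (mk x u (ones N, int N - 1) (full ?z)) (N * 8 + 1)
      (mk x u (ones N, -1) (full (zs @ two_rows N)))"
    using runs_write_loop_left[of 2 "mk x u (ones N, int N - 1) (full ?z)" "ones N" N ?z "[True, False]"]
    by (simp add: two_rows_def)
  have 4: "runs (MoveR 2) (mk x u (ones N, -1) (full (zs @ two_rows N))) 1
      (mk x u (ones N, 0) (full (zs @ two_rows N)))"
    by (rule runs_MoveR, simp, simp, simp)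
  show ?thesis unfolding write_rows_def
    by (rule runs_mono[OF runs_Seq[OF 1 runs_Seq[OF 2 runs_Seq[OF 3 4]]]]) simp
qed

definition graph_code :: "nat \<Rightarrow> bool list" where
  "graph_code N = concat (replicate N [True, True]) @ [False] @ concat (replicate N (two_rows N))"

definition sets_code :: "nat \<Rightarrow> bool list" where
  "sets_code N = [True, False, True, False] @ concat (replicate (N - 2) [False, False]) @
     [False, True, False, True] @ concat (replicate (N - 2) [False, False])"

lemma length_concat_replicate: "length (concat (replicate n bs)) = n * length bs"
  by (induction n) auto

lemma runs_write_instance:
  assumes "2 \<le> N"
  shows "\<exists>u v. runs (write_instance w) (mk x (full (ones N)) (full (ones N)) ([], 0))
      ((4 * length w + 200) * N * N) (mk x u v (w @ graph_code N @ sets_code N, 0))"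
proof -
  let ?U = "full (ones N)" and ?u = "\<lambda>h. (ones N, h)"
  have 1: "runs (write_out w) (mk x ?U ?U ([], 0)) (2 * length w + 1) (mk x ?U ?U (full w))"
    using runs_write_out[of "mk x ?U ?U ([], 0)" "[]" w] by (simp add: full_def)
  have 2: "runs (rewind 1) (mk x ?U ?U (full w)) (2 * N + 5) (mk x (?u 0) ?U (full w))"
    using runs_rewind[of 1 "mk x ?U ?U (full w)" "ones N"] by simp
  let ?z3 = "w @ concat (replicate N [True, True])"
  have 3: "runs (While 1 (write_out [True, True] ;; MoveR 1)) (mk x (?u 0) ?U (full w)) (N * 8 + 1)
      (mk x ?U ?U (full ?z3))"
    using runs_write_loop_right[of 1 "mk x (?u 0) ?U (full w)" "ones N" 0 N w "[True, True]"] by simp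
  have 4: "runs (write_out [False]) (mk x ?U ?U (full ?z3)) 3 (mk x ?U ?U (full (?z3 @ [False])))"
    using runs_write_out[of "mk x ?U ?U (full ?z3)" ?z3 "[False]"] by simp
  have 5: "runs (rewind 1) (mk x ?U ?U (full (?z3 @ [False]))) (2 * N + 5)
      (mk x (?u 0) ?U (full (?z3 @ [False])))"
    using runs_rewind[of 1 "mk x ?U ?U (full (?z3 @ [False]))" "ones N"] by simp
  have 6: "runs (rewind 2) (mk x (?u 0) ?U (full (?z3 @ [False]))) (2 * N + 5)
      (mk x (?u 0) (?u 0) (full (?z3 @ [False])))"
    using runs_rewind[of 2 "mk x (?u 0) ?U (full (?z3 @ [False]))" "ones N"] by simp
  define D where "D i = mk x (?u (int i)) (?u 0)
      (full (?z3 @ [False] @ concat (replicate i (two_rows N))))" for i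
  have 7: "runs (While 1 (write_rows ;; MoveR 1)) (D 0) (N * Suc (16 * N + 9) + 1) (D N)"
  proof (rule runs_While)
    fix i
    let ?z = "?z3 @ [False] @ concat (replicate i (two_rows N))"
    have "runs write_rows (D i) (16 * N + 7) (mk x (?u (int i)) (?u 0) (full (?z @ two_rows N)))"
      unfolding D_def by (rule runs_write_rows)
    moreover have "?z @ two_rows N = ?z3 @ [False] @ concat (replicate (Suc i) (two_rows N))"
      by (simp only: append_assoc concat_replicate_snoc)
    moreover have "runs (MoveR 1)
        (mk x (?u (int i)) (?u 0) (full (?z3 @ [False] @ concat (replicate (Suc i) (two_rows N))))) 1 (D (Suc i))"
      by (rule runs_MoveR) (simp_all add: D_def add.commute)
    ultimately have "runs (write_rows ;; MoveR 1) (D i) (Suc (16 * N + 7 + 1)) (D (Suc i))"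
      by (metis runs_Seq)
    then show "runs (write_rows ;; MoveR 1) (D i) (16 * N + 9) (D (Suc i))"
      by (rule runs_mono) simp
  qed (auto simp: D_def on_bit_def)
  let ?z7 = "w @ graph_code N"
  have D: "mk x (?u 0) (?u 0) (full (?z3 @ [False])) = D 0" "D N = mk x ?U (?u 0) (full ?z7)"
    by (simp_all add: D_def graph_code_def full_def)
  have 8: "runs (MoveR 2) (D N) 1 (mk x ?U (?u 1) (full ?z7))"
    by (rule runs_MoveR, simp, simp add: D, simp add: D)
  have 9: "runs (MoveR 2) (mk x ?U (?u 1) (full ?z7)) 1 (mk x ?U (?u 2) (full ?z7))"
    by (rule runs_MoveR, simp, simp, simp)
  let ?z10 = "?z7 @ [True, False, True, False]"
  have 10: "runs (write_out [True, False, True, False]) (mk x ?U (?u 2) (full ?z7)) 9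
      (mk x ?U (?u 2) (full ?z10))"
    using runs_write_out[of "mk x ?U (?u 2) (full ?z7)" ?z7 "[True, False, True, False]"] by simp
  let ?z11 = "?z10 @ concat (replicate (N - 2) [False, False])"
  have 11: "runs (While 2 (write_out [False, False] ;; MoveR 2)) (mk x ?U (?u 2) (full ?z10))
      ((N - 2) * 8 + 1) (mk x ?U ?U (full ?z11))"
    using runs_write_loop_right[of 2 "mk x ?U (?u 2) (full ?z10)" "ones N" 2 "N - 2" ?z10 "[False, False]"]
      assms by simp
  have 12: "runs (MoveL 1) (mk x ?U ?U (full ?z11)) 1 (mk x (?u (int N - 1)) ?U (full ?z11))"
    by (rule runs_MoveL) (simp_all add: full_def)
  have 13: "runs (MoveL 1) (mk x (?u (int N - 1)) ?U (full ?z11)) 1 (mk x (?u (int N - 2)) ?U (full ?z11))"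
    by (rule runs_MoveL, simp, simp, simp)
  have 14: "runs (MoveL 1) (mk x (?u (int N - 2)) ?U (full ?z11)) 1
      (mk x (?u (int (N - 2) - 1)) ?U (full ?z11))"
    by (rule runs_MoveL, simp, simp, use assms in \<open>simp add: of_nat_diff\<close>)
  let ?z15 = "?z11 @ [False, True, False, True]"
  have 15: "runs (write_out [False, True, False, True]) (mk x (?u (int (N - 2) - 1)) ?U (full ?z11)) 9
      (mk x (?u (int (N - 2) - 1)) ?U (full ?z15))"
    using runs_write_out[of "mk x (?u (int (N - 2) - 1)) ?U (full ?z11)" ?z11 "[False, True, False, True]"]
    by simp
  let ?z16 = "w @ graph_code N @ sets_code N"
  have 16: "runs (While 1 (write_out [False, False] ;; MoveL 1)) (mk x (?u (int (N - 2) - 1)) ?U (full ?z15))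
      ((N - 2) * 8 + 1) (mk x (?u (-1)) ?U (full ?z16))"
    using runs_write_loop_left[of 1 "mk x (?u (int (N - 2) - 1)) ?U (full ?z15)" "ones N" "N - 2" ?z15
        "[False, False]"] by (simp add: sets_code_def)
  have 17: "runs (rewind 3) (mk x (?u (-1)) ?U (full ?z16)) (2 * length ?z16 + 5) (mk x (?u (-1)) ?U (?z16, 0))"
    using runs_rewind[of 3 "mk x (?u (-1)) ?U (full ?z16)" ?z16] by simp
  have len: "length ?z16 = length w + 2 * N + 1 + 4 * (N * N) + 8 + 4 * (N - 2)"
    by (simp add: graph_code_def sets_code_def two_rows_def length_concat_replicate algebra_simps)
  have NN: "N \<le> N * N" "1 \<le> N * N" using assms by (auto intro: le_trans[of 1 N])
  have lw: "length w \<le> length w * (N * N)" using NN(2) by simp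
  \<comment> \<open>With the products replaced by variables, \<open>a\<close> for
    \<open>N * N\<close>, \<open>b\<close> for \<open>length w * (N * N)\<close> and
    \<open>d\<close> for \<open>N - 2\<close>, the estimate is linear.\<close>
  have gen: "Suc (2 * W + 1 + Suc (2 * N + 5 + Suc (N * 8 + 1 + Suc (3 + Suc (2 * N + 5 +
      Suc (2 * N + 5 + Suc (16 * a + 10 * N + 1 + Suc (1 + Suc (1 + Suc (9 + Suc (d * 8 + 1 +
      Suc (1 + Suc (1 + Suc (1 + Suc (9 + Suc (d * 8 + 1 +
      (2 * (W + 2 * N + 1 + 4 * a + 8 + 4 * d) + 5))))))))))))))))) \<le> 4 * b + 200 * a"
    if "N \<le> a" "1 \<le> a" "W \<le> b" "d \<le> N" for W a b d
    using that by simp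
  have key: "(4 * length w + 200) * N * N = 4 * (length w * (N * N)) + 200 * (N * N)"
    "N * Suc (16 * N + 9) = 16 * (N * N) + 10 * N"
    by (simp_all add: algebra_simps)
  show ?thesis
  proof (intro exI)
    show "runs (write_instance w) (mk x ?U ?U ([], 0)) ((4 * length w + 200) * N * N)
      (mk x (?u (-1)) ?U (?z16, 0))"
      unfolding write_instance_def
      by (rule runs_mono[OF runs_Seq[OF 1 runs_Seq[OF 2 runs_Seq[OF 3 runs_Seq[OF 4 runs_Seq[OF 5
        runs_Seq[OF 6[unfolded D] runs_Seq[OF 7 runs_Seq[OF 8 runs_Seq[OF 9 runs_Seq[OF 10 runs_Seq[OF 11
        runs_Seq[OF 12 runs_Seq[OF 13 runs_Seq[OF 14 runs_Seq[OF 15 runs_Seq[OF 16 17]]]]]]]]]]]]]]]]])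
        (unfold len key, rule gen, use NN lw in auto)
  qed
qed

lemma map_upt_double: "map f [0..<2 * n] = concat (map (\<lambda>i. [f (2 * i), f (2 * i + 1)]) [0..<n])"
  by (induction n) auto

lemma map_const_upt: "map (\<lambda>_. c) [0..<n] = replicate n c"
  by (simp add: map_replicate_const)

lemma concat_concat_replicate: "concat (concat (replicate n [xs, ys])) = concat (replicate n (xs @ ys))"
  by (induction n) auto

text \<open>Indices are taken in pairs, one of each parity; then both the matrix and the token sets
  become repetitions of a fixed block, up to the first two pairs of each set.\<close>

lemma enc_instance_bipartite_graph:
  assumes "2 \<le> N"
  shows "enc_instance \<phi> (2 * N) (bipartite_graph N) {0, 2} {1, 3} =
    enc_fm \<phi> @ graph_code N @ sets_code N"
proof -
  have row: "map (\<lambda>j. {i, j} \<in> edges (bipartite_graph N)) [0..<2 * N] =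
      concat (replicate N (if even i then [False, True] else [True, False]))" if "i < 2 * N" for i
  proof -
    have "map (\<lambda>j. {i, j} \<in> edges (bipartite_graph N)) [0..<2 * N] = map (\<lambda>j. odd (i + j)) [0..<2 * N]"
      using that by (auto simp: edge_bipartite_graph)
    also have "\<dots> = concat (map (\<lambda>_. if even i then [False, True] else [True, False]) [0..<N])"
      unfolding map_upt_double by (intro arg_cong[where f = concat] map_cong) auto
    finally show ?thesis by (simp only: map_const_upt)
  qed
  have "concat (map (\<lambda>i. map (\<lambda>j. {i, j} \<in> edges (bipartite_graph N)) [0..<2 * N]) [0..<2 * N]) =
      concat (map (\<lambda>i. concat (replicate N (if even i then [False, True] else [True, False]))) [0..<2 * N])"
    using row by (intro arg_cong[where f = concat] map_cong) auto
  also have "\<dots> = concat (concat (map (\<lambda>_. [concat (replicate N [False, True]),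
      concat (replicate N [True, False])]) [0..<N]))"
    unfolding map_upt_double by simp
  also have "\<dots> = concat (replicate N (two_rows N))"
    unfolding map_const_upt concat_concat_replicate two_rows_def ..
  finally have rows: "concat (map (\<lambda>i. map (\<lambda>j. {i, j} \<in> edges (bipartite_graph N)) [0..<2 * N]) [0..<2 * N]) =
      concat (replicate N (two_rows N))" .
  have "enc_nat (2 * N) = concat (replicate N [True, True]) @ [False]"
    unfolding enc_nat_def by (induction N) auto
  with rows have graph: "enc_graph (2 * N) (bipartite_graph N) = graph_code N"
    by (simp add: enc_graph_def graph_code_def)
  obtain n where n: "N = Suc (Suc n)" using assms by (metis Suc_le_D numeral_2_eq_2 Suc_le_mono)
  have upt: "[0..<Suc (Suc n)] = 0 # 1 # map (\<lambda>i. i + 2) [0..<n]"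
    unfolding map_add_upt by (simp add: upt_conv_Cons numeral_2_eq_2)
  have "enc_vset (2 * N) {0, 2} = [True, False, True, False] @ concat (replicate (N - 2) [False, False])"
    unfolding enc_vset_def map_upt_double n upt by (simp add: comp_def map_const_upt)
  moreover have "enc_vset (2 * N) {1, 3} = [False, True, False, True] @ concat (replicate (N - 2) [False, False])"
    unfolding enc_vset_def map_upt_double n upt by (simp add: comp_def map_const_upt)
  ultimately show ?thesis by (simp add: enc_instance_def graph sets_code_def)
qed


section \<open>From solvability to \<open>E = NE\<close>\<close>

text \<open>The gap between the two marks grows with the length of the word at the rate
  \<open>c\<close> of the exponent in the time bound; \<open>c0\<close> takes care of the constant
  factor.\<close>

definition instance_size :: "nat \<Rightarrow> nat \<Rightarrow> bool list \<Rightarrow> nat" where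
  "instance_size c c0 x = Suc (bits_value x (1 + 2 ^ (c0 + c * length x)))"

lemma halts_within_mono: "halts_within M x t \<Longrightarrow> t \<le> t' \<Longrightarrow> halts_within M x t'"
  unfolding halts_within_def by (meson le_trans)

lemma class_E_subset_class_NE: "class_E \<subseteq> class_NE"
  unfolding class_E_def class_NE_def DTIME_def NTIME_def by blast

lemma class_NE_reduces_to_MSOR2:
  assumes "L \<in> class_NE"
  obtains \<phi> c c0 where
    "\<And>x. 2 \<le> instance_size c c0 x"
    "\<And>x. MSOR2_instance \<phi> (bipartite_graph (instance_size c c0 x)) {0, 2} {1, 3}"
    "\<And>x. MSOR2_yes \<phi> (bipartite_graph (instance_size c c0 x)) {0, 2} {1, 3} \<longleftrightarrow> x \<in> L"
proof -
  obtain c M C where M: "turing_machine M"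
    "\<And>x. halts_within M x (C * 2 ^ (c * length x))" "\<And>x. accepts M x \<longleftrightarrow> x \<in> L"
    using assms unfolding class_NE_def NTIME_def by blast
  obtain ts qs ss where "tableau M ts qs ss" using tableau_exists[OF M(1)] .
  then interpret tableau M ts qs ss .
  obtain \<psi> where \<psi>: "fv \<psi> = {}"
    "\<And>(G :: nat ugraph) N \<alpha> \<beta> v vs e es. grid_enum G N \<alpha> \<beta> \<Longrightarrow> N > 0 \<Longrightarrow>
       sat G \<psi> v vs e es \<longleftrightarrow> (\<exists>R. grid_sat N R accept_fm (\<lambda>_. 0) (\<lambda>_. 0))"
    using grid_sentence_in_mso[OF grid_fv_accept_fm] by blast
  \<comment> \<open>\<open>2 ^ (2 * C)\<close> exceeds \<open>2 * C\<close>, and the 3 contributes a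
    factor 8, which covers the additive constants and the bound 7; it also makes the gap
    positive.\<close>
  define c0 where "c0 = 2 * C + 3"
  have size: "2 * (C * 2 ^ (c * length x)) + 2 \<le> instance_size c c0 x" "7 \<le> instance_size c c0 x"
    for x :: "bool list"
  proof -
    have "2 * C + 8 \<le> 2 ^ c0"
    proof -
      have "2 * C < 2 ^ (2 * C)" by (rule less_exp)
      moreover have "2 ^ c0 = (2::nat) ^ (2 * C) * 8" by (simp add: c0_def power_add)
      ultimately show ?thesis by linarith
    qed
    then have "(2 * C + 8) * 2 ^ (c * length x) \<le> 2 ^ c0 * 2 ^ (c * length x)" by (rule mult_le_mono1)
    also have "\<dots> = 1 * 2 ^ (c0 + c * length x)" by (simp add: power_add)
    also have "\<dots> < 2 ^ length x * (1 + 2 ^ (c0 + c * length x))"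
      by (rule le_less_trans[OF mult_le_mono1[of 1 "2 ^ length x"]]) simp_all
    also have "\<dots> \<le> bits_value x (1 + 2 ^ (c0 + c * length x))" by (rule bits_value_bounds)
    finally have "(2 * C + 8) * 2 ^ (c * length x) + 1 < instance_size c c0 x"
      unfolding instance_size_def by simp
    moreover have "(1::nat) \<le> 2 ^ (c * length x)" by simp
    moreover have "(2 * C + 8) * 2 ^ (c * length x) = 2 * (C * 2 ^ (c * length x)) + 8 * 2 ^ (c * length x)"
      by (simp add: algebra_simps)
    ultimately show "2 * (C * 2 ^ (c * length x)) + 2 \<le> instance_size c c0 x" "7 \<le> instance_size c c0 x"
      by linarith+
  qed
  have sat: "sat (bipartite_graph (instance_size c c0 x)) \<psi> v vs e es \<longleftrightarrow> x \<in> L" for x v vs e es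
  proof -
    have "accepts M x \<longleftrightarrow> (\<exists>R. grid_sat (instance_size c c0 x) R accept_fm (\<lambda>_. 0) (\<lambda>_. 0))"
      by (rule accepts_iff_grid_sat[OF M(2) instance_size_def _ size]) (simp add: c0_def)
    then show ?thesis
      using \<psi>(2)[OF grid_enum_bipartite_graph] M(3) by (simp add: instance_size_def)
  qed
  have two: "2 \<le> instance_size c c0 x" for x using size(2)[of x] by simp
  show thesis
    by (rule that[of c c0 "reconf_fm \<psi>", OF two])
      (use MSOR2_bipartite_graph[OF two \<psi>(1) sat] in blast)+
qed

lemma runs_instance:
  assumes "2 \<le> instance_size c c0 x"
  shows "\<exists>g. g 3 = (w @ graph_code (instance_size c c0 x) @ sets_code (instance_size c c0 x), 0) \<and>
    (\<forall>j>3. g j = ([], 0)) \<and>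
    runs (count_up c c0 ;; write_instance w) (\<lambda>j. if j = 0 then (x, 0) else ([], 0))
      ((51 * c0 + 52 * c + 4 * length w + 301) * instance_size c c0 x ^ 2) g"
proof -
  let ?N = "instance_size c c0 x"
  obtain h where 1: "runs (count_up c c0) (mk (x, 0) ([], 0) ([], 0) ([], 0))
      ((51 * c0 + 52 * c + 100) * ?N * ?N) (mk (x, h) (full (ones ?N)) (full (ones ?N)) ([], 0))"
    using runs_count_up[OF instance_size_def] by blast
  obtain u v where 2: "runs (write_instance w) (mk (x, h) (full (ones ?N)) (full (ones ?N)) ([], 0))
      ((4 * length w + 200) * ?N * ?N) (mk (x, h) u v (w @ graph_code ?N @ sets_code ?N, 0))"
    using runs_write_instance[OF assms] by blast
  have "mk (x, 0) ([], 0) ([], 0) ([], 0) = (\<lambda>j. if j = 0 then (x, 0) else ([], 0))"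
    by (auto simp: mk_def)
  moreover have "(1::nat) \<le> ?N ^ 2" using assms by simp
  then have "Suc ((51 * c0 + 52 * c + 100) * ?N * ?N + (4 * length w + 200) * ?N * ?N) \<le>
      (51 * c0 + 52 * c + 4 * length w + 301) * ?N ^ 2"
    by (simp add: power2_eq_square algebra_simps)
  ultimately have "runs (count_up c c0 ;; write_instance w) (\<lambda>j. if j = 0 then (x, 0) else ([], 0))
      ((51 * c0 + 52 * c + 4 * length w + 301) * ?N ^ 2)
      (mk (x, h) u v (w @ graph_code ?N @ sets_code ?N, 0))"
    using runs_mono[OF runs_Seq[OF 1 2]] by simp
  moreover have "mk (x, h) u v (w @ graph_code ?N @ sets_code ?N, 0) j = ([], 0)" if "j > 3" for j
    using that by (simp add: mk_def)
  ultimately show ?thesis by (intro exI[of _ "mk (x, h) u v (w @ graph_code ?N @ sets_code ?N, 0)"]) simp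
qed

text \<open>The size is at most \<open>3 * 2 ^ c0\<close> times
  \<open>2 ^ ((c + 1) * length x)\<close>, so fixed powers of it stay exponential with linear
  exponent. Exponent \<open>l + 2\<close> dominates both 2, for writing the instance, and
  \<open>l\<close>, for solving it on \<open>2 * N\<close> vertices.\<close>

lemma time_bound:
  "A * instance_size c c0 x ^ 2 + B * (2 * instance_size c c0 x) ^ l \<le>
    (A * (3 * 2 ^ c0) ^ 2 + B * (2 * (3 * 2 ^ c0)) ^ l) * 2 ^ ((c + 1) * (l + 2) * length x)"
proof -
  let ?E = "3 * 2 ^ c0 :: nat" and ?P = "2 ^ ((c + 1) * length x) :: nat" and ?N = "instance_size c c0 x"
  have P: "1 \<le> ?P" by simp
  have "?N \<le> 2 ^ length x * Suc (1 + 2 ^ (c0 + c * length x))"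
    unfolding instance_size_def using bits_value_bounds(2) by (simp add: Suc_le_eq del: mult_Suc_right)
  also have "\<dots> \<le> 2 ^ length x * (3 * 2 ^ (c0 + c * length x))"
  proof (rule mult_le_mono2)
    have "(1::nat) \<le> 2 ^ (c0 + c * length x)" by simp
    then show "Suc (1 + 2 ^ (c0 + c * length x)) \<le> 3 * 2 ^ (c0 + c * length x)" by linarith
  qed
  also have "\<dots> = ?E * ?P" by (simp add: power_add algebra_simps)
  finally have N: "?N \<le> ?E * ?P" .
  have 1: "A * ?N ^ 2 \<le> A * (?E ^ 2 * ?P ^ (l + 2))"
  proof (rule mult_le_mono2)
    have "?N ^ 2 \<le> (?E * ?P) ^ 2" using N by (rule power_mono) simp
    also have "\<dots> = ?E ^ 2 * ?P ^ 2" by (rule power_mult_distrib)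
    also have "\<dots> \<le> ?E ^ 2 * ?P ^ (l + 2)" by (intro mult_le_mono2 power_increasing P) simp
    finally show "?N ^ 2 \<le> ?E ^ 2 * ?P ^ (l + 2)" .
  qed
  have 2: "B * (2 * ?N) ^ l \<le> B * ((2 * ?E) ^ l * ?P ^ (l + 2))"
  proof (rule mult_le_mono2)
    have "(2 * ?N) ^ l \<le> (2 * ?E * ?P) ^ l" using N by (intro power_mono) auto
    also have "\<dots> = (2 * ?E) ^ l * ?P ^ l" by (rule power_mult_distrib)
    also have "\<dots> \<le> (2 * ?E) ^ l * ?P ^ (l + 2)" by (intro mult_le_mono2 power_increasing P) simp
    finally show "(2 * ?N) ^ l \<le> (2 * ?E) ^ l * ?P ^ (l + 2)" .
  qed
  have 3: "?P ^ (l + 2) = 2 ^ ((c + 1) * (l + 2) * length x)"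
    unfolding power_mult[symmetric] by (simp only: mult.commute mult.left_commute)
  have "A * ?N ^ 2 + B * (2 * ?N) ^ l \<le> A * (?E ^ 2 * ?P ^ (l + 2)) + B * ((2 * ?E) ^ l * ?P ^ (l + 2))"
    using 1 2 by (rule add_mono)
  also have "\<dots> = (A * ?E ^ 2 + B * (2 * ?E) ^ l) * ?P ^ (l + 2)"
    by (simp only: add_mult_distrib mult.assoc)
  finally show ?thesis unfolding 3 .
qed

lemma class_NE_subset_class_E:
  assumes "MSOR2_solvable_in_time {G. neighborhood_diversity G = 2} (\<lambda>n l. n ^ f l)"
  shows "class_NE \<subseteq> class_E"
proof
  fix L assume "L \<in> class_NE"
  then obtain \<phi> c c0 where size: "\<And>x. 2 \<le> instance_size c c0 x"
    and inst: "\<And>x. MSOR2_instance \<phi> (bipartite_graph (instance_size c c0 x)) {0, 2} {1, 3}"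
    and yes: "\<And>x. MSOR2_yes \<phi> (bipartite_graph (instance_size c c0 x)) {0, 2} {1, 3} \<longleftrightarrow> x \<in> L"
    by (rule class_NE_reduces_to_MSOR2) blast
  obtain M C where M: "turing_machine M" "deterministic M"
    and solves: "\<And>\<phi> n G S S'. MSOR2_instance \<phi> G S S' \<Longrightarrow> neighborhood_diversity G = 2 \<Longrightarrow>
      verts G = {..<n} \<Longrightarrow>
      halts_within M (enc_instance \<phi> n G S S') (C * n ^ f (fm_length \<phi>)) \<and>
      (accepts M (enc_instance \<phi> n G S S') \<longleftrightarrow> MSOR2_yes \<phi> G S S')"
    using assms unfolding MSOR2_solvable_in_time_def by (simp only: mem_Collect_eq) blast
  define w where "w = enc_fm \<phi>"
  interpret preprocessed M "count_up c c0 ;; write_instance w"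
    by unfold_locales (use M in auto)
  \<comment> \<open>\<open>f\<close> enters only through its value at the length of one formula,
    obtained from \<open>L\<close>; so \<open>?D\<close> and \<open>?d\<close> are constants for all
    inputs \<open>x\<close>.\<close>
  let ?A = "51 * c0 + 52 * c + 4 * length w + 301" and ?l = "f (fm_length \<phi>)"
  let ?D = "?A * (3 * 2 ^ c0) ^ 2 + C * (2 * (3 * 2 ^ c0)) ^ ?l" and ?d = "(c + 1) * (?l + 2)"
  have "halts_within machine x (?D * 2 ^ (?d * length x)) \<and> (accepts machine x \<longleftrightarrow> x \<in> L)" for x
  proof -
    let ?N = "instance_size c c0 x"
    let ?y = "enc_instance \<phi> (2 * ?N) (bipartite_graph ?N) {0, 2} {1, 3}"
    have y: "?y = w @ graph_code ?N @ sets_code ?N"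
      using enc_instance_bipartite_graph[OF size] by (simp add: w_def)
    obtain g where g: "g 3 = (?y, 0)" "\<And>j. 3 < j \<Longrightarrow> g j = ([], 0)"
      "runs (count_up c c0 ;; write_instance w) (\<lambda>j. if j = 0 then (x, 0) else ([], 0)) (?A * ?N ^ 2) g"
      using runs_instance[OF size, of w x] unfolding y by blast
    obtain t where t: "t \<le> ?A * ?N ^ 2"
      "exec (count_up c c0 ;; write_instance w) (\<lambda>j. if j = 0 then (x, 0) else ([], 0)) t g"
      using g(3) unfolding runs_def by blast
    have sol: "halts_within M ?y (C * (2 * ?N) ^ ?l)"
      "accepts M ?y \<longleftrightarrow> MSOR2_yes \<phi> (bipartite_graph ?N) {0, 2} {1, 3}"
      using solves[OF inst neighborhood_diversity_bipartite_graph[OF size] verts_bipartite_graph] by blast+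
    have "halts_within machine x (t + C * (2 * ?N) ^ ?l)"
      using machine_correct(1)[OF t(2) g(1,2) sol(1)] .
    moreover have "t + C * (2 * ?N) ^ ?l \<le> ?D * 2 ^ (?d * length x)"
      using t(1) time_bound[of ?A c c0 x C ?l] by linarith
    moreover have "accepts machine x \<longleftrightarrow> x \<in> L"
      using machine_correct(2)[OF t(2) g(1,2)] sol(2) yes by blast
    ultimately show ?thesis using halts_within_mono by blast
  qed
  then show "L \<in> class_E"
    unfolding class_E_def DTIME_def using turing_machine_machine deterministic_machine by blast
qed

theorem theorem3p14:
  assumes "class_E \<noteq> class_NE"
  shows "\<not> (\<exists>f :: nat \<Rightarrow> nat.
    MSOR2_solvable_in_time {G. neighborhood_diversity G = 2} (\<lambda>n l. n ^ f l))"
  using assms class_NE_subset_class_E class_E_subset_class_NE by blast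

end
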